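(* Let $f \in \mathbb{Z}[x_1,\ldots,x_n]$, let $p$ be a prime, and for $i \in \mathbb{Z}_{\geq 0}$ let $M_i$ be the number of solutions of $f(x) \equiv 0 \bmod p^i$ in $(\mathbb{Z}/p^i\mathbb{Z})^n$. Let $P(t)=\sum_{i\ge 0} M_i (p^{-n}t)^i$ be the Poincaré series of $f$, written as \[P(t) = \frac{B(t)}{\prod_{j \in J} (1-p^{-\nu_j}t^{N_j})},\] with $J$, $\nu_j$, $N_j$, $B(t)$ as in the context. Let $J=\bigsqcup_{k\in V}J_k$ be the partition of $J$ into the equivalence classes of the relation $j_1\sim j_2 \iff \nu_{j_1}/N_{j_1}=\nu_{j_2}/N_{j_2}$, and for $k\in V$ let $a_k=\mathrm{lcm}\{\nu_j : j\in J_k\}$, $b_k=\mathrm{lcm}\{N_j : j\in J_k\}$ (so $a_k/b_k=\nu_j/N_j$ for all $j\in J_k$) and $m_k=\# J_k$. Then there exists a unique decomposition of every $M_i$ with $i > \deg(P(t))$ of the form \[ M_i = \sum_{k=1}^r g_k(i)\,p^{\lceil l_k i \rceil}, \] where the $l_k$ are pairwise different rational numbers and where every $g_k$ is a nonzero function which is polynomial with rational coefficients on residue classes (i.e. there is a modulus such that $g_k$ agrees with a polynomial in $\mathbb{Q}[i]$ on each residue class). The $r$ numbers $l_k-n$ are the real parts of the poles of $Z_f(s)$. If the elements of $V$ are denoted by $1,\ldots,r$ in such a way that $l_k-n=-a_k/b_k$ for every $k\in\{1,\ldots,r\}$, then for every $k \in \{1,\ldots,r\}$: (1) the function $g_k(i)$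 is polynomial on each residue class modulo $b_k$; (2) the maximum of the degrees of these polynomials is equal to $m_k-1$; (3) these polynomials (and thus also $g_k$) are determined by the principal parts of the Laurent series of $Z_f(s)$ at the poles with real part $-a_k/b_k$.
   Context: Igusa's $p$-adic zeta function of $f$ is $Z_f(s)=\int_{\mathbb{Z}_p^n}|f(x)|_p^s\,|dx|$ for $\mathrm{Re}(s)>0$, where $|dx|$ is the Haar measure on $\mathbb{Q}_p^n$ normalized so that $\mathbb{Z}_p^n$ has measure $1$; it depends only on $t:=p^{-s}$, and one writes $Z_f(t)$ when viewing it as a function of $t$. One has $P(t)=\frac{1-tZ_f(t)}{1-t}$. By Igusa's theorem, $Z_f(t)$ is a rational function of $t$ (so $Z_f(s)$ extends meromorphically to $\mathbb{C}$), and more precisely: taking an embedded resolution $g$ of $f^{-1}\{0\}$, with irreducible components $E_j$ of $g^{-1}(f^{-1}\{0\})$ along which $f\circ g$ and $g^*dx$ have multiplicities $N_j$ and $\nu_j-1$ respectively, one can write $Z_f(t)=A(t)/\prod_{j\in J}(1-p^{-\nu_j}t^{N_j})$ for a certain set $J$ of such components, with $A(t)\in S[t]$ not divisible by any of the factors $1-p^{-\nu_j}t^{N_j}$, where $S=\{z/p^i : z\in\mathbb{Z}, i\in\mathbb{Z}_{\ge 0}\}$. Consequently $P(t)=B(t)/\prod_{j\in J}(1-p^{-\nu_j}t^{N_j})$ with $B(t)\in S[t]$ not divisible by any $1-p^{-\nu_j}t^{N_j}$; the poles of $P(t)$ and $Z_f(t)$ coincide. This fixed representation (with its $J$, $\nu_j$,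 $N_j$, positive integers) is the one used in the claim. $\deg(P(t))$ denotes the degree of the rational function $P$ (degree of numerator minus degree of denominator), and $\lceil\cdot\rceil$ is the ceiling function.
   Formalization: Part (2) is false as stated (B may vanish at common zeros of the factors in J_k though no single factor divides B); proved instead: the maximum degree is at most m_k−1, with equality iff 1−p^{−gcd ν_j}t^{gcd N_j} (gcds over j in J_k) does not divide B(t). *)

theory Defs
  imports
    "HOL-Library.Poly_Mapping"
    "HOL-Number_Theory.Cong"
    "HOL-Computational_Algebra.Polynomial_FPS"
    "HOL-Complex_Analysis.Complex_Analysis"
begin

text \<open>
  An integer polynomial in variables indexed by \<open>nat\<close> is a finitely supported map from
  monomials (finitely supported exponent vectors) to coefficients. A polynomial in $n$
  variables is one whose monomials only use the variables \<open>0, \<dots>, n - 1\<close>.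
\<close>

type_synonym intpoly = "(nat \<Rightarrow>\<^sub>0 nat) \<Rightarrow>\<^sub>0 int"

definition in_vars :: "nat \<Rightarrow> intpoly \<Rightarrow> bool" where
  "in_vars n f \<longleftrightarrow> (\<forall>m \<in> Poly_Mapping.keys f. Poly_Mapping.keys m \<subseteq> {..<n})"

definition eval_intpoly :: "intpoly \<Rightarrow> (nat \<Rightarrow> int) \<Rightarrow> int" where
  "eval_intpoly f x =
     (\<Sum>m \<in> Poly_Mapping.keys f. Poly_Mapping.lookup f m *
        (\<Prod>v \<in> Poly_Mapping.keys m. x v ^ Poly_Mapping.lookup m v))"

definition num_sols :: "nat \<Rightarrow> nat \<Rightarrow> intpoly \<Rightarrow> nat \<Rightarrow> nat" where
  "num_sols p n f i =
     card {x \<in> {..<n} \<rightarrow>\<^sub>E {0..<int p ^ i}. [eval_intpoly f x = 0] (mod int p ^ i)}"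

definition poincare_series :: "nat \<Rightarrow> nat \<Rightarrow> intpoly \<Rightarrow> rat fps" where
  "poincare_series p n f =
     Abs_fps (\<lambda>i. of_nat (num_sols p n f i) * inverse (of_nat p ^ n) ^ i)"

text \<open>
  The $p$-adic integers as the inverse limit of the rings $\mathbb{Z}/p^k$: an element is the
  sequence of its residues mod $p^k$, each represented in \<open>{0..<p ^ k}\<close>.
\<close>

definition Zp :: "nat \<Rightarrow> (nat \<Rightarrow> int) set" where
  "Zp p = {x. (\<forall>k. x k \<in> {0..<int p ^ k}) \<and> (\<forall>k. x (Suc k) mod int p ^ k = x k)}"

text \<open>The order of \<open>x \<noteq> 0\<close> is the largest $k$ with \<open>x k = 0\<close>.\<close>

definition Zp_norm :: "nat \<Rightarrow> (nat \<Rightarrow> int) \<Rightarrow> real" where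
  "Zp_norm p x =
     (if \<forall>k. x k = 0 then 0 else inverse (real p) ^ (LEAST k. x (Suc k) \<noteq> 0))"

definition Zp_vec :: "nat \<Rightarrow> nat \<Rightarrow> (nat \<Rightarrow> nat \<Rightarrow> int) set" where
  "Zp_vec p n = {..<n} \<rightarrow>\<^sub>E Zp p"

definition Zp_vec_add ::
  "nat \<Rightarrow> nat \<Rightarrow> (nat \<Rightarrow> nat \<Rightarrow> int) \<Rightarrow> (nat \<Rightarrow> nat \<Rightarrow> int) \<Rightarrow> nat \<Rightarrow> nat \<Rightarrow> int" where
  "Zp_vec_add p n x y = (\<lambda>v\<in>{..<n}. \<lambda>k. (x v k + y v k) mod int p ^ k)"

definition Zp_eval :: "nat \<Rightarrow> intpoly \<Rightarrow> (nat \<Rightarrow> nat \<Rightarrow> int) \<Rightarrow> nat \<Rightarrow> int" where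
  "Zp_eval p f x = (\<lambda>k. eval_intpoly f (\<lambda>v. x v k) mod int p ^ k)"

text \<open>
  The balls, i.e. the residue classes mod $p^k$, are a countable basis of the topology of
  $\mathbb{Z}_p^n$, so they generate its Borel sets.
\<close>

definition Zp_balls :: "nat \<Rightarrow> nat \<Rightarrow> (nat \<Rightarrow> nat \<Rightarrow> int) set set" where
  "Zp_balls p n = {{x \<in> Zp_vec p n. \<forall>v<n. x v k = a v k} | a k. a \<in> Zp_vec p n}"

definition is_normalized_haar :: "nat \<Rightarrow> nat \<Rightarrow> (nat \<Rightarrow> nat \<Rightarrow> int) measure \<Rightarrow> bool" where
  "is_normalized_haar p n \<mu> \<longleftrightarrow>
     space \<mu> = Zp_vec p n \<and>
     sets \<mu> = sigma_sets (Zp_vec p n) (Zp_balls p n) \<and>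
     emeasure \<mu> (Zp_vec p n) = 1 \<and>
     (\<forall>y \<in> Zp_vec p n. \<forall>A \<in> sets \<mu>. emeasure \<mu> (Zp_vec_add p n y ` A) = emeasure \<mu> A)"

definition haar :: "nat \<Rightarrow> nat \<Rightarrow> (nat \<Rightarrow> nat \<Rightarrow> int) measure" where
  "haar p n = (SOME \<mu>. is_normalized_haar p n \<mu>)"

definition igusa_integral :: "nat \<Rightarrow> nat \<Rightarrow> intpoly \<Rightarrow> complex \<Rightarrow> complex" where
  "igusa_integral p n f s =
     integral\<^sup>L (haar p n) (\<lambda>x. complex_of_real (Zp_norm p (Zp_eval p f x)) powr s)"

text \<open>
  The meromorphic continuation to $\mathbb{C}$; requiring it to be nicely meromorphic (no
  removable singularities, value 0 at poles) makes it unique.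
\<close>

definition igusa_zeta :: "nat \<Rightarrow> nat \<Rightarrow> intpoly \<Rightarrow> complex \<Rightarrow> complex" where
  "igusa_zeta p n f =
     (SOME Z. Z nicely_meromorphic_on UNIV \<and> (\<forall>s. Re s > 0 \<longrightarrow> Z s = igusa_integral p n f s))"

text \<open>The poles with real part \<open>\<sigma>\<close>, each together with its principal part.\<close>

definition principal_parts ::
  "nat \<Rightarrow> nat \<Rightarrow> intpoly \<Rightarrow> real \<Rightarrow> (complex \<times> complex poly) set" where
  "principal_parts p n f \<sigma> =
     {(s, fls_prpart (laurent_expansion (igusa_zeta p n f) s)) | s.
        is_pole (igusa_zeta p n f) s \<and> Re s = \<sigma>}"

definition den_factor :: "nat \<Rightarrow> nat \<Rightarrow> nat \<Rightarrow> rat poly" where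
  "den_factor p \<nu> N = 1 - monom (inverse (of_nat p) ^ \<nu>) N"

definition den :: "nat \<Rightarrow> nat set \<Rightarrow> (nat \<Rightarrow> nat) \<Rightarrow> (nat \<Rightarrow> nat) \<Rightarrow> rat poly" where
  "den p J \<nu> N = (\<Prod>j\<in>J. den_factor p (\<nu> j) (N j))"

text \<open>
  Divisibility below is in $\mathbb{Q}[t]$. It coincides with divisibility in
  $\mathbb{Z}[1/p][t]$ because the leading coefficient of each factor is a unit of
  $\mathbb{Z}[1/p]$.
\<close>

definition igusa_rep ::
  "nat \<Rightarrow> nat \<Rightarrow> intpoly \<Rightarrow> nat set \<Rightarrow> (nat \<Rightarrow> nat) \<Rightarrow> (nat \<Rightarrow> nat) \<Rightarrow> rat poly \<Rightarrow> bool" where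
  "igusa_rep p n f J \<nu> N B \<longleftrightarrow>
     finite J \<and> (\<forall>j\<in>J. 0 < \<nu> j \<and> 0 < N j) \<and>
     (\<forall>d. \<exists>(z::int) (e::nat). coeff B d = of_int z / of_nat p ^ e) \<and>
     (\<forall>j\<in>J. \<not> den_factor p (\<nu> j) (N j) dvd B) \<and>
     poincare_series p n f = fps_of_poly B / fps_of_poly (den p J \<nu> N)"

definition rat_fun_degree :: "rat poly \<Rightarrow> rat poly \<Rightarrow> int" where
  "rat_fun_degree B D = int (degree B) - int (degree D)"

text \<open>
  For a class $K$ of indices with equal ratio \<open>\<nu> j / N j\<close>, the gcd of the factors
  \<open>den_factor p (\<nu> j) (N j)\<close>, $j \in K$, is \<open>den_factor p (Gcd (\<nu> ` K)) (Gcd (N ` K))\<close>; its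
  zeros are the common zeros of these factors. A pole of order \<open>card K\<close> exists on the
  corresponding circle iff $B$ is not divisible by this gcd, which for \<open>card K > 1\<close> is more
  than $B$ not being divisible by any single factor. For instance, let $p = 2$,
  $f = (x^2+xy+y^2) N_3(x-1,y,z)$ with $N_3$ the norm form of the unramified cubic extension of
  $\mathbb{Q}_2$. Then the number of solutions mod $2^i$ is
  $8^i (4^{-\lceil i/2\rceil} + 8^{-\lceil i/3\rceil})$, so $P$ has denominator
  $(1-2^{-2}t^2)(1-2^{-3}t^3)$, neither factor divides $B$, and all poles are simple.
\<close>

definition ratio_rel :: "nat set \<Rightarrow> (nat \<Rightarrow> nat) \<Rightarrow> (nat \<Rightarrow> nat) \<Rightarrow> (nat \<times> nat) set" where
  "ratio_rel J \<nu> N =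
     {(i, j). i \<in> J \<and> j \<in> J \<and> (of_nat (\<nu> i) / of_nat (N i) :: rat) = of_nat (\<nu> j) / of_nat (N j)}"

definition poly_on_residues :: "nat \<Rightarrow> (nat \<Rightarrow> rat) \<Rightarrow> (nat \<Rightarrow> rat poly) \<Rightarrow> bool" where
  "poly_on_residues m g q \<longleftrightarrow> 0 < m \<and> (\<forall>i. g i = poly (q (i mod m)) (of_nat i))"

definition sol_decomposition ::
  "nat \<Rightarrow> nat \<Rightarrow> intpoly \<Rightarrow> int \<Rightarrow> nat \<Rightarrow> (nat \<Rightarrow> rat) \<Rightarrow> (nat \<Rightarrow> nat \<Rightarrow> rat) \<Rightarrow> bool" where
  "sol_decomposition p n f d r l g \<longleftrightarrow>
     inj_on l {1..r} \<and>
     (\<forall>k\<in>{1..r}. (\<exists>m q. poly_on_residues m (g k) q) \<and> (\<exists>i. g k i \<noteq> 0)) \<and>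
     (\<forall>i. d < int i \<longrightarrow>
        of_nat (num_sols p n f i) = (\<Sum>k=1..r. g k i * of_nat p powi \<lceil>l k * of_nat i\<rceil>))"

end

theory Submission
  imports
    Defs
    "HOL-Probability.Infinite_Product_Measure"
    "HOL-Computational_Algebra.Fundamental_Theorem_Algebra"
begin

text \<open>
  Group the factors of the denominator of $P$ by the ratio $\nu_j/N_j$. Factors of different
  ratio are comaximal, so $P = Q + \sum_K A_K/D_K$ with one proper fraction per class $K$, and $Q$
  contributes nothing beyond $\deg P$. Over the common multiple $1 - p^{-a}t^b$ of the factors in
  $K$, the fraction $A_K/D_K$ has coefficients that are $p^{-a\lfloor i/b\rfloor}$ times a
  polynomial on residue classes mod $b$ of degree at most $m - 1$; the coefficient of degree
  $m - 1$ vanishes on all residue classes iff $A_K$, equivalently $B$, vanishes at the common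
  zeros of the factors. Comparing growth rates gives uniqueness.

  The integral equals $\sum_i t^i(c_i - c_{i+1})$ with $c_i = M_i p^{-ni}$ the measure of
  $\{f \equiv 0 \bmod p^i\}$, hence $tZ = 1 - (1 - t)P$, and poles of $Z$ come from zeros of the
  denominator at which $B$ does not vanish. If two polynomials have the same principal parts on
  a vertical line, the difference of the corresponding fractions $A_K/D_K$ has no pole at all and
  is proper, so it is zero.
\<close>

section \<open>Haar measure on the $p$-adic integers and Igusa's integral\<close>

text \<open>Both \<open>haar\<close> and \<open>igusa_zeta\<close> are given by choice from their
  defining properties, so each needs a witness: a measure built from random digits, and a rational
  function of p^(-s). Afterwards only the properties are used. With l = n - a/b and x = i mod b, the
  power with exponent ceil(l*i) differs from p^(n*i - a*floor(i/b)) by p^floor(a*x/b), which is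
  constant on the residue class and goes into the polynomial. That a gcd decides about the top
  degree comes from writing \<nu> j = u * c j and N j = v * c j on a class: the factor j vanishes at
  z iff (z^v / p^u)^(c j) = 1, so all of them vanish iff this holds with the gcd of the c j as
  exponent. The last claim concerns an arbitrary decomposition of another polynomial. Therefore
  uniqueness is proved for any two decompositions, also with different bounds on i, and every
  decomposition is first identified with the canonical one built from partial fractions.\<close>

lemma Zp_residue_seqI:
  assumes "p > 0" and "\<And>k. [z (Suc k) = z k] (mod int p ^ k)"
  shows "(\<lambda>k. z k mod int p ^ k) \<in> Zp p"
proof -
  have "z (Suc k) mod int p ^ Suc k mod int p ^ k = z k mod int p ^ k" for k
  proof -
    have "z (Suc k) mod int p ^ Suc k mod int p ^ k = z (Suc k) mod int p ^ k"
      by (rule mod_mod_cancel) simp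
    with assms(2)[of k] show ?thesis by (simp add: unique_euclidean_semiring_class.cong_def)
  qed
  with assms(1) show ?thesis by (auto simp: Zp_def)
qed

lemma Zp_range: "x \<in> Zp p \<Longrightarrow> 0 \<le> x k \<and> x k < int p ^ k"
  by (auto simp: Zp_def)

lemma Zp_mod_self: "x \<in> Zp p \<Longrightarrow> x k mod int p ^ k = x k"
  using Zp_range[of x p k] by simp

lemma Zp_Suc_mod: "x \<in> Zp p \<Longrightarrow> x (Suc k) mod int p ^ k = x k"
  by (auto simp: Zp_def)

lemma Zp_Suc_cong: "x \<in> Zp p \<Longrightarrow> [x (Suc k) = x k] (mod int p ^ k)"
  using Zp_Suc_mod[of x p k] Zp_mod_self[of x p k] by (simp add: unique_euclidean_semiring_class.cong_def)

lemma Zp_mod: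
  assumes "x \<in> Zp p" "j \<le> k"
  shows "x k mod int p ^ j = x j"
  using assms(2)
proof (induction k rule: dec_induct)
  case base
  show ?case by (rule Zp_mod_self[OF assms(1)])
next
  case (step k)
  have "x (Suc k) mod int p ^ k mod int p ^ j = x (Suc k) mod int p ^ j"
    using step by (intro mod_mod_cancel le_imp_power_dvd)
  then show ?case using step Zp_Suc_mod[OF assms(1), of k] by simp
qed

text \<open>A residue class mod p^k whose centre is a mere residue vector, whereas
  \<open>Zp_balls\<close> takes its centres in Z_p^n. Residue vectors are finitely many and are what
  \<open>num_sols\<close> counts.\<close>

definition Zp_cell :: "nat \<Rightarrow> nat \<Rightarrow> nat \<Rightarrow> (nat \<Rightarrow> int) \<Rightarrow> (nat \<Rightarrow> nat \<Rightarrow> int) set" where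
  "Zp_cell p n k r = {x \<in> Zp_vec p n. \<forall>v<n. x v k = r v}"

definition Zp_vec_neg :: "nat \<Rightarrow> nat \<Rightarrow> (nat \<Rightarrow> nat \<Rightarrow> int) \<Rightarrow> nat \<Rightarrow> nat \<Rightarrow> int" where
  "Zp_vec_neg p n x = (\<lambda>v\<in>{..<n}. \<lambda>k. (- x v k) mod int p ^ k)"

definition Zp_vec_of_int :: "nat \<Rightarrow> nat \<Rightarrow> (nat \<Rightarrow> int) \<Rightarrow> nat \<Rightarrow> nat \<Rightarrow> int" where
  "Zp_vec_of_int p n r = (\<lambda>v\<in>{..<n}. \<lambda>k. r v mod int p ^ k)"

lemma Zp_balls_eq: "Zp_balls p n = {Zp_cell p n k (\<lambda>v. a v k) | a k. a \<in> Zp_vec p n}"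
  by (simp add: Zp_balls_def Zp_cell_def)

lemma Zp_vecD: "x \<in> Zp_vec p n \<Longrightarrow> v < n \<Longrightarrow> x v \<in> Zp p"
  by (auto simp: Zp_vec_def)

lemma Zp_vecI:
  assumes "p > 0" and "\<And>v k. v < n \<Longrightarrow> [z v (Suc k) = z v k] (mod int p ^ k)"
  shows "(\<lambda>v\<in>{..<n}. \<lambda>k. z v k mod int p ^ k) \<in> Zp_vec p n"
  unfolding Zp_vec_def using assms by (intro restrict_PiE_iff[THEN iffD2] ballI Zp_residue_seqI) auto

lemma Zp_vec_add_in:
  assumes "p > 0" "x \<in> Zp_vec p n" "y \<in> Zp_vec p n"
  shows "Zp_vec_add p n x y \<in> Zp_vec p n"
  unfolding Zp_vec_add_def using assms by (intro Zp_vecI cong_add Zp_Suc_cong) (auto dest: Zp_vecD)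

lemma Zp_vec_neg_in:
  assumes "p > 0" "x \<in> Zp_vec p n"
  shows "Zp_vec_neg p n x \<in> Zp_vec p n"
  unfolding Zp_vec_neg_def
  using assms by (intro Zp_vecI cong_minus_minus_iff[THEN iffD2] Zp_Suc_cong) (auto dest: Zp_vecD)

lemma Zp_vec_of_int_in:
  assumes "p > 0"
  shows "Zp_vec_of_int p n r \<in> Zp_vec p n"
  unfolding Zp_vec_of_int_def using assms by (intro Zp_vecI) auto

lemma Zp_vec_eqI:
  assumes "x \<in> Zp_vec p n" "y \<in> Zp_vec p n" "\<And>v k. v < n \<Longrightarrow> x v k = y v k"
  shows "x = y"
  using assms unfolding Zp_vec_def by (intro PiE_ext[of x _ _ y]) auto

lemma Zp_vec_add_neg:
  assumes "p > 0" "x \<in> Zp_vec p n" "y \<in> Zp_vec p n"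
  shows "Zp_vec_add p n y (Zp_vec_add p n (Zp_vec_neg p n y) x) = x"
    and "Zp_vec_add p n (Zp_vec_neg p n y) (Zp_vec_add p n y x) = x"
proof -
  have "(y v k + (- y v k + x v k)) mod int p ^ k = x v k"
     "(- y v k + (y v k + x v k)) mod int p ^ k = x v k" if "v < n" for v k
    using Zp_mod_self[OF Zp_vecD[OF assms(2) that]] by simp_all
  then have *: "(y v k + ((- y v k) mod int p ^ k + x v k) mod int p ^ k) mod int p ^ k = x v k"
     "((- y v k) mod int p ^ k + (y v k + x v k) mod int p ^ k) mod int p ^ k = x v k" if "v < n" for v k
    using that by (simp_all only: mod_simps)
  note mem = Zp_vec_add_in[OF assms(1)] Zp_vec_neg_in[OF assms(1)] assms(2,3)
  have "Zp_vec_add p n y (Zp_vec_add p n (Zp_vec_neg p n y) x) v k = x v k"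
    "Zp_vec_add p n (Zp_vec_neg p n y) (Zp_vec_add p n y x) v k = x v k" if "v < n" for v k
    using *[OF that] that by (simp_all add: Zp_vec_add_def Zp_vec_neg_def)
  then show "Zp_vec_add p n y (Zp_vec_add p n (Zp_vec_neg p n y) x) = x"
    "Zp_vec_add p n (Zp_vec_neg p n y) (Zp_vec_add p n y x) = x"
    by (blast intro: Zp_vec_eqI mem)+
qed

text \<open>\<open>is_normalized_haar\<close> speaks of images under translations,
  \<open>emeasure_distr\<close> of preimages. Translation by y is undone by translation by -y, which
  converts one into the other.\<close>

lemma Zp_vec_add_vimage:
  assumes "p > 0" "y \<in> Zp_vec p n" "A \<subseteq> Zp_vec p n"
  shows "Zp_vec_add p n y ` A = Zp_vec_add p n (Zp_vec_neg p n y) -` A \<inter> Zp_vec p n"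
proof (intro equalityI subsetI)
  fix x assume "x \<in> Zp_vec_add p n y ` A"
  then obtain a where "a \<in> A" "x = Zp_vec_add p n y a" by auto
  with assms show "x \<in> Zp_vec_add p n (Zp_vec_neg p n y) -` A \<inter> Zp_vec p n"
    by (auto simp: Zp_vec_add_neg subset_iff intro: Zp_vec_add_in)
next
  fix x assume "x \<in> Zp_vec_add p n (Zp_vec_neg p n y) -` A \<inter> Zp_vec p n"
  then show "x \<in> Zp_vec_add p n y ` A"
    using Zp_vec_add_neg(1)[OF assms(1) _ assms(2), of x] by (intro image_eqI[where x = "Zp_vec_add p n (Zp_vec_neg p n y) x"]) auto
qed

lemma Zp_vec_add_vimage_cell:
  assumes "p > 0" "y \<in> Zp_vec p n" "a \<in> Zp_vec p n"
  shows "Zp_vec_add p n y -` Zp_cell p n k (\<lambda>v. a v k) \<inter> Zp_vec p n =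
    Zp_cell p n k (\<lambda>v. Zp_vec_add p n (Zp_vec_neg p n y) a v k)"
proof -
  have *: "(y v k + x v k) mod int p ^ k = a v k \<longleftrightarrow> x v k = ((- y v k) mod int p ^ k + a v k) mod int p ^ k"
    if "x \<in> Zp_vec p n" "v < n" for x v
  proof -
    note Zp_mod_self[OF Zp_vecD[OF that(1,2)], of k]  Zp_mod_self[OF Zp_vecD[OF assms(3) that(2)], of k]
    then have "(y v k + x v k) mod int p ^ k = a v k \<longleftrightarrow> [y v k + x v k = a v k] (mod int p ^ k)"
      by (simp add: unique_euclidean_semiring_class.cong_def)
    also have "\<dots> \<longleftrightarrow> [x v k = - y v k + a v k] (mod int p ^ k)"
      by (simp add: cong_iff_dvd_diff algebra_simps)
    also have "\<dots> \<longleftrightarrow> x v k = (- y v k + a v k) mod int p ^ k"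
      using Zp_mod_self[OF Zp_vecD[OF that(1,2)], of k] by (simp add: unique_euclidean_semiring_class.cong_def)
    finally show ?thesis by (simp add: mod_simps)
  qed
  have "Zp_vec_add p n y x v k = a v k \<longleftrightarrow> x v k = Zp_vec_add p n (Zp_vec_neg p n y) a v k"
    if "x \<in> Zp_vec p n" "v < n" for x v
    using *[OF that] that(2) by (simp add: Zp_vec_add_def Zp_vec_neg_def)
  then show ?thesis using Zp_vec_add_in[OF assms(1,2)] by (auto simp: Zp_cell_def)
qed

lemma Zp_cell_zero:
  assumes "a \<in> Zp_vec p n"
  shows "Zp_cell p n 0 (\<lambda>v. a v 0) = Zp_vec p n"
proof -
  have "x v 0 = a v 0" if "x \<in> Zp_vec p n" "v < n" for x v
    using Zp_range[OF Zp_vecD[OF that], of 0] Zp_range[OF Zp_vecD[OF assms that(2)], of 0] by simp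
  then show ?thesis unfolding Zp_cell_def by blast
qed

lemma Zp_vec_in_balls:
  assumes "p > 0"
  shows "Zp_vec p n \<in> Zp_balls p n"
proof -
  have a: "Zp_vec_of_int p n (\<lambda>_. 0) \<in> Zp_vec p n" using assms by (rule Zp_vec_of_int_in)
  show ?thesis unfolding Zp_balls_eq using a Zp_cell_zero[OF a] by blast
qed

lemma Zp_balls_subset: "Zp_balls p n \<subseteq> Pow (Zp_vec p n)"
  by (auto simp: Zp_balls_def)

text \<open>Of two balls with a common point, the one of higher level lies in the other, because
  residues mod p^l determine residues mod p^k for k \<le> l. Disjoint balls are the reason for
  adjoining the empty set.\<close>

lemma Int_stable_Zp_balls: "Int_stable (insert {} (Zp_balls p n))"
proof -
  have *: "Zp_cell p n k (\<lambda>v. a v k) \<inter> Zp_cell p n l (\<lambda>v. b v l) \<in> insert {} (Zp_balls p n)"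
    if "a \<in> Zp_vec p n" "b \<in> Zp_vec p n" "k \<le> l" for a b k l
  proof (cases "\<forall>v<n. b v k = a v k")
    case True
    have "Zp_cell p n l (\<lambda>v. b v l) \<subseteq> Zp_cell p n k (\<lambda>v. a v k)"
    proof
      fix x assume x: "x \<in> Zp_cell p n l (\<lambda>v. b v l)"
      have "x v k = a v k" if "v < n" for v
        using that x True Zp_mod[of "x v" p k l] Zp_mod[of "b v" p k l] \<open>k \<le> l\<close> Zp_vecD[OF \<open>b \<in> _\<close> that]
        by (auto simp: Zp_cell_def dest: Zp_vecD)
      with x show "x \<in> Zp_cell p n k (\<lambda>v. a v k)" by (auto simp: Zp_cell_def)
    qed
    then show ?thesis using that by (auto simp: Zp_balls_eq Int_absorb1)
  next
    case False
    then obtain v where v: "v < n" "b v k \<noteq> a v k" by auto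
    have False if x: "x \<in> Zp_cell p n k (\<lambda>v. a v k)" "x \<in> Zp_cell p n l (\<lambda>v. b v l)" for x
      using v x Zp_mod[of "x v" p k l] Zp_mod[of "b v" p k l] \<open>k \<le> l\<close> Zp_vecD[OF \<open>b \<in> _\<close> v(1)]
      by (auto simp: Zp_cell_def dest: Zp_vecD)
    then show ?thesis by auto
  qed
  have "A \<inter> B \<in> insert {} (Zp_balls p n)" if "A \<in> Zp_balls p n" "B \<in> Zp_balls p n" for A B
  proof -
    from that obtain a k b l where ab: "a \<in> Zp_vec p n" "b \<in> Zp_vec p n"
      "A = Zp_cell p n k (\<lambda>v. a v k)" "B = Zp_cell p n l (\<lambda>v. b v l)"
      unfolding Zp_balls_eq by auto
    show ?thesis
      using *[of a b k l] *[of b a l k] ab by (cases "k \<le> l") (auto simp: Int_commute)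
  qed
  then show ?thesis unfolding Int_stable_def by auto
qed

lemma sigma_sets_Zp_balls_insert:
  "sigma_sets (Zp_vec p n) (insert {} (Zp_balls p n)) = sigma_sets (Zp_vec p n) (Zp_balls p n)"
proof (rule sigma_sets_eqI)
  show "a \<in> sigma_sets (Zp_vec p n) (Zp_balls p n)" if "a \<in> insert {} (Zp_balls p n)" for a
    using that by (auto intro: sigma_sets.intros)
qed auto

text \<open>Dynkin's uniqueness theorem for an intersection-stable generator; the exhausting
  sequence is constantly Z_p^n, which is itself a ball.\<close>

lemma measure_eq_on_Zp_balls:
  assumes "p > 0"
    and "sets M = sigma_sets (Zp_vec p n) (Zp_balls p n)" "sets M' = sigma_sets (Zp_vec p n) (Zp_balls p n)"
    and "\<And>X. X \<in> Zp_balls p n \<Longrightarrow> emeasure M X = emeasure M' X"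
    and "emeasure M (Zp_vec p n) \<noteq> \<infinity>"
  shows "M = M'"
proof (rule measure_eqI_generator_eq[of "insert {} (Zp_balls p n)" "Zp_vec p n" _ _ "\<lambda>_. Zp_vec p n"])
  show "Int_stable (insert {} (Zp_balls p n))" by (rule Int_stable_Zp_balls)
qed (use assms Zp_balls_subset[of p n] Zp_vec_in_balls[of p n] in \<open>auto simp: sigma_sets_Zp_balls_insert\<close>)

section \<open>Base p digits of p-adic integers and the existence of the Haar measure\<close>

lemma digit_sum_range:
  assumes "p > 0" "\<And>i. d i \<in> {0..<int p}"
  shows "(\<Sum>i<k. d i * int p ^ i) \<in> {0..<int p ^ k}"
proof (induction k)
  case (Suc k)
  have "d k * int p ^ k \<le> (int p - 1) * int p ^ k"
    using assms(2)[of k] by (intro mult_right_mono) auto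
  moreover have "0 \<le> d k * int p ^ k" using assms(2)[of k] by auto
  ultimately show ?case using Suc by (auto simp: algebra_simps)
qed simp

text \<open>The i-th digit of a is the quotient of its residue mod p^(i+1) by p^i. Agreement with a
  mod p^k thus splits into k conditions on single digits, which become independent events under the
  product measure.\<close>

lemma digit_sum_eq_iff:
  assumes "p > 0" "a \<in> Zp p" "\<And>i. d i \<in> {0..<int p}"
  shows "(\<Sum>i<k. d i * int p ^ i) = a k \<longleftrightarrow> (\<forall>i<k. d i = a (Suc i) div int p ^ i)"
proof (induction k)
  case 0
  then show ?case using Zp_range[OF assms(2), of 0] by simp
next
  case (Suc k)
  define s where "s = (\<Sum>i<k. d i * int p ^ i)"
  have s: "s \<in> {0..<int p ^ k}" unfolding s_def by (rule digit_sum_range[OF assms(1,3)])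
  have a: "a (Suc k) = a (Suc k) div int p ^ k * int p ^ k + a k"
    using Zp_Suc_mod[OF assms(2), of k] div_mult_mod_eq[of "a (Suc k)" "int p ^ k"] by simp
  have "s + d k * int p ^ k = a (Suc k) \<longleftrightarrow> s = a k \<and> d k = a (Suc k) div int p ^ k"
  proof
    assume eq: "s + d k * int p ^ k = a (Suc k)"
    then have "(s + d k * int p ^ k) mod int p ^ k = a k" using Zp_Suc_mod[OF assms(2), of k] by simp
    then have "s = a k" using s by simp
    moreover have "(s + d k * int p ^ k) div int p ^ k = d k" using s assms(1) by simp
    ultimately show "s = a k \<and> d k = a (Suc k) div int p ^ k" using eq by simp
  next
    assume "s = a k \<and> d k = a (Suc k) div int p ^ k"
    then show "s + d k * int p ^ k = a (Suc k)" using a by simp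
  qed
  then show ?case using Suc by (simp add: s_def less_Suc_eq) blast
qed

lemma Zp_digit_range:
  assumes "p > 0" "a \<in> Zp p"
  shows "a (Suc i) div int p ^ i \<in> {0..<int p}"
proof -
  have r: "0 \<le> a (Suc i)" "a (Suc i) < int p * int p ^ i" using Zp_range[OF assms(2), of "Suc i"] by auto
  have "int p * int p ^ i \<le> a (Suc i) div int p ^ i * int p ^ i" if "int p \<le> a (Suc i) div int p ^ i"
    using that by (intro mult_right_mono) auto
  also have "a (Suc i) div int p ^ i * int p ^ i \<le> a (Suc i)"
    using div_mult_mod_eq[of "a (Suc i)" "int p ^ i"] pos_mod_sign[of "int p ^ i" "a (Suc i)"] assms(1)
    by (smt (verit) of_nat_0_less_iff zero_less_power)
  finally show ?thesis using r assms(1) by (fastforce simp: pos_imp_zdiv_nonneg_iff)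
qed

definition Zp_of_digits :: "nat \<Rightarrow> nat \<Rightarrow> (nat \<times> nat \<Rightarrow> int) \<Rightarrow> nat \<Rightarrow> nat \<Rightarrow> int" where
  "Zp_of_digits p n w = (\<lambda>v\<in>{..<n}. \<lambda>k. (\<Sum>i<k. w (i, v) * int p ^ i) mod int p ^ k)"

lemma Zp_of_digits_in: "p > 0 \<Longrightarrow> Zp_of_digits p n w \<in> Zp_vec p n"
  unfolding Zp_of_digits_def by (intro Zp_vecI) (auto simp: unique_euclidean_semiring_class.cong_def)

lemma Zp_of_digits_in_cell:
  assumes "p > 0" "a \<in> Zp_vec p n" "\<And>j. w j \<in> {0..<int p}"
  shows "Zp_of_digits p n w \<in> Zp_cell p n k (\<lambda>v. a v k) \<longleftrightarrow>
     (\<forall>j\<in>{..<k} \<times> {..<n}. w j = a (snd j) (Suc (fst j)) div int p ^ fst j)"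
proof -
  have "Zp_of_digits p n w v k = a v k \<longleftrightarrow> (\<forall>i<k. w (i, v) = a v (Suc i) div int p ^ i)" if "v < n" for v
    using digit_sum_eq_iff[OF assms(1) Zp_vecD[OF assms(2) that], of "\<lambda>i. w (i, v)" k]
      digit_sum_range[OF assms(1), of "\<lambda>i. w (i, v)" k] assms(3) that
    by (simp add: Zp_of_digits_def)
  then show ?thesis
    using Zp_of_digits_in[OF assms(1)] by (auto simp: Zp_cell_def)
qed

text \<open>The Haar measure is the law of a random vector with independent uniform $p$-adic digits.\<close>

theorem ex_normalized_haar:
  assumes "p > 0"
  shows "\<exists>\<mu>. is_normalized_haar p n \<mu>"
proof -
  define D where "D = {0..<int p}"
  have D: "finite D" "D \<noteq> {}" "card D = p" using assms by (auto simp: D_def)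
  define M where "M = PiM (UNIV :: (nat \<times> nat) set) (\<lambda>_. uniform_count_measure D)"
  interpret P: product_prob_space "\<lambda>_ :: nat \<times> nat. uniform_count_measure D" UNIV
    using D by (intro product_prob_spaceI prob_space_uniform_count_measure)
  have space_M: "space M = UNIV \<rightarrow>\<^sub>E D"
    by (simp add: M_def space_PiM space_uniform_count_measure)
  define \<phi> where "\<phi> = Zp_of_digits p n"
  \<comment> \<open>\<open>S k a\<close> prescribes the k*n digits that make up the residue vector
    of a mod p^k. It is a cylinder set, and the preimage of the ball of level k around a.\<close>
  define S where "S = (\<lambda>k a. {w \<in> space M. \<forall>j\<in>{..<k} \<times> {..<n}. w j \<in> {a (snd j) (Suc (fst j)) div int p ^ fst j}})"
  have vimage: "\<phi> -` Zp_cell p n k (\<lambda>v. a v k) \<inter> space M = S k a" if "a \<in> Zp_vec p n" for a k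
  proof -
    have "w j \<in> {0..<int p}" if "w \<in> space M" for w j using that by (auto simp: space_M D_def)
    then have "\<phi> w \<in> Zp_cell p n k (\<lambda>v. a v k) \<longleftrightarrow>
        (\<forall>j\<in>{..<k} \<times> {..<n}. w j = a (snd j) (Suc (fst j)) div int p ^ fst j)" if "w \<in> space M" for w
      unfolding \<phi>_def using Zp_of_digits_in_cell[OF assms \<open>a \<in> _\<close>, of w k] that by blast
    then show ?thesis unfolding S_def by blast
  qed
  have dig: "a (snd j) (Suc (fst j)) div int p ^ fst j \<in> D" if "a \<in> Zp_vec p n" "j \<in> {..<k} \<times> {..<n}" for a j k
    using Zp_digit_range[OF assms Zp_vecD[OF that(1)]] that(2) by (auto simp: D_def)
  have S_sets: "S k a \<in> sets M" if "a \<in> Zp_vec p n" for k a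
    unfolding S_def
  proof (rule sets.sets_Collect_finite_All)
    fix j assume j: "j \<in> {..<k} \<times> {..<n}"
    have "(\<lambda>w. w j) \<in> measurable M (uniform_count_measure D)"
      unfolding M_def by (rule measurable_component_singleton) simp
    from measurable_sets[OF this, of "{a (snd j) (Suc (fst j)) div int p ^ fst j}"] dig[OF that j]
    show "{w \<in> space M. w j \<in> {a (snd j) (Suc (fst j)) div int p ^ fst j}} \<in> sets M"
      by (simp add: sets_uniform_count_measure vimage_def Int_def conj_commute)
  qed simp
  have S_emeasure: "emeasure M (S k a) = ennreal ((1 / real p) ^ (k * n))" if "a \<in> Zp_vec p n" for k a
  proof -
    have "emeasure M (S k a) = (\<Prod>j\<in>{..<k} \<times> {..<n}. emeasure (uniform_count_measure D) {a (snd j) (Suc (fst j)) div int p ^ fst j})"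
      unfolding S_def M_def using dig[OF that]
      by (intro P.emeasure_PiM_Collect) (auto simp: sets_uniform_count_measure)
    also have "\<dots> = (\<Prod>j\<in>{..<k} \<times> {..<n}. ennreal (1 / real p))"
      using dig[OF that] D by (intro prod.cong) (auto simp: emeasure_uniform_count_measure)
    also have "\<dots> = ennreal ((1 / real p) ^ (k * n))"
      by (simp add: ennreal_power)
    finally show ?thesis .
  qed
  define \<mu> where "\<mu> = distr M (sigma (Zp_vec p n) (Zp_balls p n)) \<phi>"
  have space_mu: "space \<mu> = Zp_vec p n" and sets_mu: "sets \<mu> = sigma_sets (Zp_vec p n) (Zp_balls p n)"
    using Zp_balls_subset[of p n] by (auto simp: \<mu>_def space_measure_of sets_measure_of)
  have meas: "\<phi> \<in> measurable M (sigma (Zp_vec p n) (Zp_balls p n))"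
  proof (rule measurable_measure_of[OF Zp_balls_subset])
    show "\<phi> \<in> space M \<rightarrow> Zp_vec p n" using Zp_of_digits_in[OF assms] by (auto simp: \<phi>_def)
    fix y assume "y \<in> Zp_balls p n"
    then show "\<phi> -` y \<inter> space M \<in> sets M" unfolding Zp_balls_eq using vimage S_sets by auto
  qed
  have ball_sets: "Zp_cell p n k (\<lambda>v. a v k) \<in> sets \<mu>" if "a \<in> Zp_vec p n" for a k
    unfolding sets_mu using that by (intro sigma_sets.Basic) (auto simp: Zp_balls_eq)
  have ball: "emeasure \<mu> (Zp_cell p n k (\<lambda>v. a v k)) = ennreal ((1 / real p) ^ (k * n))" if "a \<in> Zp_vec p n" for a k
    using ball_sets[OF that, of k] S_emeasure[OF that, of k] vimage[OF that, of k] meas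
    unfolding \<mu>_def by (subst emeasure_distr) auto
  have one: "emeasure \<mu> (Zp_vec p n) = 1"
    using ball[OF Zp_vec_of_int_in[OF assms], of 0] Zp_cell_zero[OF Zp_vec_of_int_in[OF assms]] by simp
  have "emeasure \<mu> (Zp_vec_add p n y ` A) = emeasure \<mu> A" if y: "y \<in> Zp_vec p n" and A: "A \<in> sets \<mu>" for y A
  proof -
    define z where "z = Zp_vec_neg p n y"
    have z: "z \<in> Zp_vec p n" unfolding z_def by (rule Zp_vec_neg_in[OF assms y])
    have T: "Zp_vec_add p n z \<in> measurable \<mu> \<mu>"
    proof (rule measurable_sigma_sets[OF sets_mu Zp_balls_subset])
      show "Zp_vec_add p n z \<in> space \<mu> \<rightarrow> Zp_vec p n"
        using Zp_vec_add_in[OF assms z] by (auto simp: space_mu)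
      fix X assume "X \<in> Zp_balls p n"
      then show "Zp_vec_add p n z -` X \<inter> space \<mu> \<in> sets \<mu>"
        unfolding Zp_balls_eq space_mu
        using Zp_vec_add_vimage_cell[OF assms z] ball_sets Zp_vec_add_in[OF assms Zp_vec_neg_in[OF assms z]] by auto
    qed
    \<comment> \<open>Preimages of balls under a translation are balls of the same level, and
      \<open>ball\<close> gives these equal measure; so the pushforward agrees with \<mu> on the
      generator.\<close>
    have "distr \<mu> \<mu> (Zp_vec_add p n z) = \<mu>"
    proof (rule measure_eq_on_Zp_balls[OF assms])
      fix X assume "X \<in> Zp_balls p n"
      then obtain a k where a: "a \<in> Zp_vec p n" "X = Zp_cell p n k (\<lambda>v. a v k)" unfolding Zp_balls_eq by auto
      then have "emeasure (distr \<mu> \<mu> (Zp_vec_add p n z)) X = emeasure \<mu> (Zp_vec_add p n z -` X \<inter> Zp_vec p n)"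
        using T ball_sets by (subst emeasure_distr) (auto simp: space_mu)
      also have "\<dots> = emeasure \<mu> X"
        using a ball Zp_vec_add_in[OF assms Zp_vec_neg_in[OF assms z]]
        by (simp add: Zp_vec_add_vimage_cell[OF assms z])
      finally show "emeasure (distr \<mu> \<mu> (Zp_vec_add p n z)) X = emeasure \<mu> X" .
    next
      show "emeasure (distr \<mu> \<mu> (Zp_vec_add p n z)) (Zp_vec p n) \<noteq> \<infinity>"
        using T one sets.top[of \<mu>] Zp_vec_add_in[OF assms z]
        by (subst emeasure_distr) (auto simp: space_mu Int_absorb1 subset_iff
           intro!: neq_top_trans[OF _ emeasure_mono[of _ "Zp_vec p n" \<mu>]])
    qed (auto simp: sets_mu)
    then have "emeasure \<mu> A = emeasure (distr \<mu> \<mu> (Zp_vec_add p n z)) A" by simp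
    also have "\<dots> = emeasure \<mu> (Zp_vec_add p n z -` A \<inter> Zp_vec p n)"
      using T A by (subst emeasure_distr) (auto simp: space_mu)
    also have "Zp_vec_add p n z -` A \<inter> Zp_vec p n = Zp_vec_add p n y ` A"
      unfolding z_def using A sets.sets_into_space[OF A] by (intro Zp_vec_add_vimage[symmetric] assms y) (auto simp: space_mu)
    finally show ?thesis by simp
  qed
  then have "is_normalized_haar p n \<mu>"
    unfolding is_normalized_haar_def using space_mu sets_mu one by blast
  then show ?thesis by blast
qed

lemma haar_is_normalized_haar: "p > 0 \<Longrightarrow> is_normalized_haar p n (haar p n)"
  unfolding haar_def using ex_normalized_haar by (rule someI_ex)

lemma normalized_haar_prob_space:
  assumes "is_normalized_haar p n \<mu>"
  shows "prob_space \<mu>"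
  using assms unfolding is_normalized_haar_def by (intro prob_spaceI) auto

section \<open>Measure of the residue classes\<close>

lemma Zp_vec_of_int_nth:
  assumes "r \<in> {..<n} \<rightarrow>\<^sub>E {0..<int p ^ k}" "v < n"
  shows "Zp_vec_of_int p n r v k = r v"
  using PiE_mem[OF assms(1), of v] assms(2) by (simp add: Zp_vec_of_int_def)

lemma Zp_cell_cong: "(\<And>v. v < n \<Longrightarrow> r v = r' v) \<Longrightarrow> Zp_cell p n k r = Zp_cell p n k r'"
  unfolding Zp_cell_def by auto

lemma Zp_cell_in_sets:
  assumes "p > 0" "is_normalized_haar p n \<mu>" "r \<in> {..<n} \<rightarrow>\<^sub>E {0..<int p ^ k}"
  shows "Zp_cell p n k r \<in> sets \<mu>"
proof -
  have "Zp_cell p n k r = Zp_cell p n k (\<lambda>v. Zp_vec_of_int p n r v k)"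
    by (rule Zp_cell_cong) (simp add: Zp_vec_of_int_nth[OF assms(3)])
  then have "Zp_cell p n k r \<in> Zp_balls p n"
    unfolding Zp_balls_eq using Zp_vec_of_int_in[OF assms(1)] by blast
  then show ?thesis using assms(2) unfolding is_normalized_haar_def by auto
qed

lemma disjoint_family_Zp_cell: "disjoint_family_on (Zp_cell p n k) ({..<n} \<rightarrow>\<^sub>E A)"
  unfolding disjoint_family_on_def
proof (intro ballI impI equals0I)
  fix r r' x assume *: "r \<in> {..<n} \<rightarrow>\<^sub>E A" "r' \<in> {..<n} \<rightarrow>\<^sub>E A" "r \<noteq> r'"
    "x \<in> Zp_cell p n k r \<inter> Zp_cell p n k r'"
  have "r = r'"
    by (rule PiE_ext[OF *(1,2)]) (use *(4) in \<open>auto simp: Zp_cell_def\<close>)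
  with * show False by simp
qed

lemma Zp_vec_eq_Union_cells:
  assumes "p > 0"
  shows "Zp_vec p n = (\<Union>r\<in>{..<n} \<rightarrow>\<^sub>E {0..<int p ^ k}. Zp_cell p n k r)"
proof -
  have "x \<in> Zp_cell p n k (\<lambda>v\<in>{..<n}. x v k)" "(\<lambda>v\<in>{..<n}. x v k) \<in> {..<n} \<rightarrow>\<^sub>E {0..<int p ^ k}"
    if "x \<in> Zp_vec p n" for x
    using that Zp_range[OF Zp_vecD[OF that]] by (auto simp: Zp_cell_def)
  moreover have "Zp_cell p n k r \<subseteq> Zp_vec p n" for r by (auto simp: Zp_cell_def)
  ultimately show ?thesis by blast
qed

text \<open>The p^(n*k) classes mod p^k partition Z_p^n and are translates of the class of 0. Only
  the defining properties of a normalized Haar measure enter, so this applies to whatever measure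
  \<open>haar\<close> selects.\<close>

lemma measure_Zp_cell:
  assumes "p > 0" "is_normalized_haar p n \<mu>" "r \<in> {..<n} \<rightarrow>\<^sub>E {0..<int p ^ k}"
  shows "measure \<mu> (Zp_cell p n k r) = inverse (real p ^ n) ^ k"
proof -
  interpret prob_space \<mu> by (rule normalized_haar_prob_space[OF assms(2)])
  let ?R = "{..<n} \<rightarrow>\<^sub>E {0..<int p ^ k}"
  define z where "z = Zp_vec_of_int p n (\<lambda>_. 0)"
  have z: "z \<in> Zp_vec p n" unfolding z_def by (rule Zp_vec_of_int_in[OF assms(1)])
  have inv: "measure \<mu> (Zp_vec_add p n y ` A) = measure \<mu> A" if "y \<in> Zp_vec p n" "A \<in> sets \<mu>" for y A
    using assms(2) that by (simp add: is_normalized_haar_def measure_def)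
  have z_sets: "Zp_cell p n k (\<lambda>v. z v k) \<in> sets \<mu>"
    using z assms(2) unfolding is_normalized_haar_def Zp_balls_eq by auto
  have eq: "measure \<mu> (Zp_cell p n k r) = measure \<mu> (Zp_cell p n k (\<lambda>v. z v k))" if "r \<in> ?R" for r
  proof -
    define y where "y = Zp_vec_of_int p n r"
    have y: "y \<in> Zp_vec p n" unfolding y_def by (rule Zp_vec_of_int_in[OF assms(1)])
    have y': "Zp_vec_neg p n y \<in> Zp_vec p n" by (rule Zp_vec_neg_in[OF assms(1) y])
    \<comment> \<open>The image under translation by y is the preimage under translation by -y, and
      taking the preimage of a ball negates once more; hence the double negation on the
      right.\<close>
    have "Zp_vec_add p n y ` Zp_cell p n k (\<lambda>v. z v k) =
      Zp_cell p n k (\<lambda>v. Zp_vec_add p n (Zp_vec_neg p n (Zp_vec_neg p n y)) z v k)"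
    proof -
      have "Zp_cell p n k (\<lambda>v. z v k) \<subseteq> Zp_vec p n" by (auto simp: Zp_cell_def)
      from Zp_vec_add_vimage[OF assms(1) y this] show ?thesis
        by (simp add: Zp_vec_add_vimage_cell[OF assms(1) y' z])
    qed
    also have "\<dots> = Zp_cell p n k r"
    proof (rule Zp_cell_cong)
      fix v assume v: "v < n"
      have "r v \<in> {0..<int p ^ k}" using PiE_mem[OF that, of v] v by simp
      moreover have "(- ((- (r v mod int p ^ k)) mod int p ^ k)) mod int p ^ k = r v mod int p ^ k"
        by (simp only: mod_minus_eq minus_minus mod_mod_trivial)
      ultimately show "Zp_vec_add p n (Zp_vec_neg p n (Zp_vec_neg p n y)) z v k = r v"
        using v by (simp add: Zp_vec_add_def Zp_vec_neg_def y_def z_def Zp_vec_of_int_def)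
    qed
    finally show ?thesis using inv[OF y z_sets] by simp
  qed
  have fin: "finite ?R" by (rule finite_PiE) auto
  have "1 = measure \<mu> (Zp_vec p n)"
    using prob_space assms(2) by (simp add: is_normalized_haar_def)
  also have "\<dots> = (\<Sum>r\<in>?R. measure \<mu> (Zp_cell p n k r))"
    unfolding Zp_vec_eq_Union_cells[OF assms(1), of n k]
    using fin Zp_cell_in_sets[OF assms(1,2)] disjoint_family_Zp_cell
    by (intro finite_measure_finite_Union) auto
  also have "\<dots> = (\<Sum>r\<in>?R. measure \<mu> (Zp_cell p n k (\<lambda>v. z v k)))"
    by (intro sum.cong refl eq)
  also have "\<dots> = real (card ?R) * measure \<mu> (Zp_cell p n k (\<lambda>v. z v k))" by simp
  also have "card ?R = (p ^ n) ^ k"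
    by (subst card_PiE) (auto simp: nat_power_eq simp flip: power_mult mult.commute)
  finally show ?thesis using eq[OF assms(3)] assms(1) by (simp add: field_simps)
qed

section \<open>Zero sets mod p^k and the integral as a power series\<close>

lemma eval_intpoly_cong:
  assumes "in_vars n f" "\<And>v. v < n \<Longrightarrow> x v = y v"
  shows "eval_intpoly f x = eval_intpoly f y"
proof -
  have "x v = y v" if "m \<in> Poly_Mapping.keys f" "v \<in> Poly_Mapping.keys m" for m v
    using assms that unfolding in_vars_def by blast
  then show ?thesis unfolding eval_intpoly_def by simp
qed

lemma eval_intpoly_mod_cong:
  assumes "in_vars n f" "\<And>v. v < n \<Longrightarrow> [x v = y v] (mod m)"
  shows "[eval_intpoly f x = eval_intpoly f y] (mod m)"
  unfolding eval_intpoly_def using assms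
  by (intro cong_sum cong_mult cong_refl cong_prod cong_pow) (auto simp: in_vars_def)

lemma Zp_eval_in:
  assumes "p > 0" "in_vars n f" "x \<in> Zp_vec p n"
  shows "Zp_eval p f x \<in> Zp p"
  unfolding Zp_eval_def
  using assms by (intro Zp_residue_seqI eval_intpoly_mod_cong Zp_Suc_cong) (auto dest: Zp_vecD)

definition zero_set_mod :: "nat \<Rightarrow> nat \<Rightarrow> intpoly \<Rightarrow> nat \<Rightarrow> (nat \<Rightarrow> nat \<Rightarrow> int) set" where
  "zero_set_mod p n f k = {x \<in> Zp_vec p n. Zp_eval p f x k = 0}"

text \<open>The residue of f(x) mod p^k depends only on x mod p^k, so the zero set is a union of the
  classes counted by \<open>num_sols\<close>.\<close>

lemma zero_set_mod_eq:
  assumes "p > 0" "in_vars n f"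
  shows "zero_set_mod p n f k =
    (\<Union>r\<in>{r \<in> {..<n} \<rightarrow>\<^sub>E {0..<int p ^ k}. [eval_intpoly f r = 0] (mod int p ^ k)}. Zp_cell p n k r)"
proof -
  have "Zp_eval p f x k = 0 \<longleftrightarrow> [eval_intpoly f r = 0] (mod int p ^ k)" if "x \<in> Zp_cell p n k r" for x r
  proof -
    have "eval_intpoly f (\<lambda>v. x v k) = eval_intpoly f r"
      using that by (intro eval_intpoly_cong[OF assms(2)]) (auto simp: Zp_cell_def)
    then show ?thesis by (simp add: Zp_eval_def unique_euclidean_semiring_class.cong_def)
  qed
  note iff = this
  show ?thesis
  proof (intro equalityI subsetI)
    fix x assume x: "x \<in> zero_set_mod p n f k"
    then obtain r where r: "r \<in> {..<n} \<rightarrow>\<^sub>E {0..<int p ^ k}" "x \<in> Zp_cell p n k r"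
      using Zp_vec_eq_Union_cells[OF assms(1), of n k] unfolding zero_set_mod_def by blast
    with iff[OF r(2)] x show "x \<in> (\<Union>r\<in>{r \<in> {..<n} \<rightarrow>\<^sub>E {0..<int p ^ k}. [eval_intpoly f r = 0] (mod int p ^ k)}. Zp_cell p n k r)"
      unfolding zero_set_mod_def by blast
  next
    fix x assume "x \<in> (\<Union>r\<in>{r \<in> {..<n} \<rightarrow>\<^sub>E {0..<int p ^ k}. [eval_intpoly f r = 0] (mod int p ^ k)}. Zp_cell p n k r)"
    then obtain r where r: "[eval_intpoly f r = 0] (mod int p ^ k)" "x \<in> Zp_cell p n k r" by blast
    with iff[OF r(2)] show "x \<in> zero_set_mod p n f k" unfolding zero_set_mod_def Zp_cell_def by blast
  qed
qed

lemma zero_set_mod_sets: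
  assumes "p > 0" "in_vars n f" "is_normalized_haar p n \<mu>"
  shows "zero_set_mod p n f k \<in> sets \<mu>"
proof -
  have "finite ({..<n} \<rightarrow>\<^sub>E {0..<int p ^ k})" by (rule finite_PiE) auto
  then show ?thesis
    unfolding zero_set_mod_eq[OF assms(1,2)] using Zp_cell_in_sets[OF assms(1,3)]
    by (intro sets.finite_UN) auto
qed

lemma measure_zero_set_mod:
  assumes "p > 0" "in_vars n f" "is_normalized_haar p n \<mu>"
  shows "measure \<mu> (zero_set_mod p n f k) = real (num_sols p n f k) * inverse (real p ^ n) ^ k"
proof -
  interpret prob_space \<mu> by (rule normalized_haar_prob_space[OF assms(3)])
  let ?S = "{r \<in> {..<n} \<rightarrow>\<^sub>E {0..<int p ^ k}. [eval_intpoly f r = 0] (mod int p ^ k)}"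
  have fin: "finite ({..<n} \<rightarrow>\<^sub>E {0..<int p ^ k})" by (rule finite_PiE) auto
  have "measure \<mu> (zero_set_mod p n f k) = (\<Sum>r\<in>?S. measure \<mu> (Zp_cell p n k r))"
    unfolding zero_set_mod_eq[OF assms(1,2)] using fin Zp_cell_in_sets[OF assms(1,3)]
    by (intro finite_measure_finite_Union disjoint_family_on_mono[OF _ disjoint_family_Zp_cell]) auto
  also have "\<dots> = (\<Sum>r\<in>?S. inverse (real p ^ n) ^ k)"
    by (intro sum.cong refl measure_Zp_cell[OF assms(1,3)]) auto
  finally show ?thesis by (simp add: num_sols_def)
qed

text \<open>The k-th term is nonzero only if y has order exactly k, so for y \<noteq> 0 a single
  term is left. For y = 0 all terms vanish, in agreement with the convention
  \<open>0 powr s = 0\<close>.\<close>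

lemma Zp_norm_powr_sums:
  fixes s :: complex
  assumes "prime p" "y \<in> Zp p"
  shows "(\<lambda>k. if y k = 0 \<and> y (Suc k) \<noteq> 0 then (of_nat p powr (- s)) ^ k else 0)
    sums (complex_of_real (Zp_norm p y) powr s)"
proof (cases "\<forall>k. y k = 0")
  case True
  then show ?thesis by (simp add: Zp_norm_def)
next
  case False
  have p: "p > 0" using assms(1) by (rule prime_gt_0_nat)
  have y0: "y 0 = 0" using Zp_range[OF assms(2), of 0] by simp
  define K where "K = (LEAST k. y (Suc k) \<noteq> 0)"
  from False y0 obtain k where "y (Suc k) \<noteq> 0" by (metis not0_implies_Suc)
  then have K: "y (Suc K) \<noteq> 0" unfolding K_def by (rule LeastI)
  have le: "y k = 0" if "k \<le> K" for k
    using that y0 not_less_Least[of "k - 1" "\<lambda>k. y (Suc k) \<noteq> 0"] by (cases k) (auto simp: K_def)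
  have gt: "y k \<noteq> 0" if "K < k" for k
    using Zp_mod[OF assms(2), of "Suc K" k] that K by auto
  have eq: "(if y k = 0 \<and> y (Suc k) \<noteq> 0 then (of_nat p powr (- s)) ^ k else 0) =
     (if k = K then (of_nat p powr (- s)) ^ k else 0)" for k
  proof (cases k K rule: linorder_cases)
    case less
    then show ?thesis using le[of "Suc k"] by simp
  next
    case equal
    then show ?thesis using le[of K] K by simp
  next
    case greater
    then show ?thesis using gt by simp
  qed
  have "complex_of_real (Zp_norm p y) = of_real (inverse (real p) ^ K)"
    unfolding Zp_norm_def if_not_P[OF False] K_def ..
  also have "\<dots> powr s = (of_nat p powr (- s)) ^ K"
  proof -
    have "complex_of_real (inverse (real p) ^ K) powr s = exp (s * of_real (ln (inverse (real p) ^ K)))"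
      using p by (subst powr_def) (simp add: Ln_of_real del: of_real_power)
    also have "ln (inverse (real p) ^ K) = - (real K * ln (real p))"
      using p by (simp add: ln_realpow ln_inverse)
    also have "exp (s * of_real (- (real K * ln (real p)))) = exp (of_nat K * (- s * of_real (ln (real p))))"
      by (simp add: algebra_simps)
    also have "\<dots> = exp (- s * of_real (ln (real p))) ^ K" by (rule exp_of_nat_mult)
    also have "exp (- s * of_real (ln (real p))) = of_nat p powr (- s)"
      using p by (simp add: powr_def Ln_of_nat)
    finally show ?thesis .
  qed
  finally have "complex_of_real (Zp_norm p y) powr s = (of_nat p powr (- s)) ^ K" .
  then show ?thesis
    unfolding eq using sums_single[of K "\<lambda>k. (of_nat p powr (- s)) ^ k"] by simp
qed

definition sol_density :: "nat \<Rightarrow> nat \<Rightarrow> intpoly \<Rightarrow> nat \<Rightarrow> real" where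
  "sol_density p n f k = real (num_sols p n f k) * inverse (real p ^ n) ^ k"

text \<open>Read off from the interpretation as a probability. The bounds make the power series with
  these coefficients converge for |t| < 1.\<close>

lemma sol_density_bounds:
  assumes "p > 0" "in_vars n f"
  shows "0 \<le> sol_density p n f k" "sol_density p n f k \<le> 1"
proof -
  let ?\<mu> = "haar p n"
  have h: "is_normalized_haar p n ?\<mu>" by (rule haar_is_normalized_haar[OF assms(1)])
  interpret prob_space ?\<mu> by (rule normalized_haar_prob_space[OF h])
  have "sol_density p n f k = measure ?\<mu> (zero_set_mod p n f k)"
    unfolding sol_density_def by (rule measure_zero_set_mod[OF assms h, symmetric])
  then show "0 \<le> sol_density p n f k" "sol_density p n f k \<le> 1" by simp_all
qed

lemma norm_of_nat_powr: "norm (of_nat p powr z :: complex) = real p powr Re z"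
  using norm_powr_real_powr[of "of_nat p" z] by simp

lemma norm_prime_powr_less_1:
  assumes "prime p" "Re s > 0"
  shows "norm (of_nat p powr (- s) :: complex) < 1"
  unfolding norm_of_nat_powr using assms prime_gt_1_nat[OF assms(1)] by (intro powr_less_one) auto

text \<open>Term-by-term integration of \<open>Zp_norm_powr_sums\<close> over the sets
  \<open>W k\<close> where f(x) has order exactly k. The interchange is dominated by the geometric
  series in |t|, and |t| < 1 is where Re s > 0 enters.\<close>

theorem igusa_integral_sums:
  assumes "prime p" "in_vars n f" "Re s > 0"
  shows "(\<lambda>k. (of_nat p powr (- s)) ^ k * of_real (sol_density p n f k - sol_density p n f (Suc k)))
    sums igusa_integral p n f s"
proof -
  let ?\<mu> = "haar p n"
  have p: "p > 0" using assms(1) by (rule prime_gt_0_nat)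
  have h: "is_normalized_haar p n ?\<mu>" by (rule haar_is_normalized_haar[OF p])
  interpret prob_space ?\<mu> by (rule normalized_haar_prob_space[OF h])
  have space: "space ?\<mu> = Zp_vec p n" using h by (simp add: is_normalized_haar_def)
  define t :: complex where "t = of_nat p powr (- s)"
  have t: "norm t < 1" unfolding t_def by (rule norm_prime_powr_less_1[OF assms(1,3)])
  define U where "U = zero_set_mod p n f"
  define W where "W = (\<lambda>k. U k - U (Suc k))"
  have U_sets: "U k \<in> sets ?\<mu>" for k unfolding U_def by (rule zero_set_mod_sets[OF p assms(2) h])
  then have W_sets: "W k \<in> sets ?\<mu>" for k unfolding W_def by auto
  have U_Suc: "U (Suc k) \<subseteq> U k" for k
    using Zp_Suc_mod[OF Zp_eval_in[OF p assms(2)], of _ k] by (fastforce simp: U_def zero_set_mod_def)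
  have W_measure: "measure ?\<mu> (W k) = sol_density p n f k - sol_density p n f (Suc k)" for k
    unfolding W_def using U_sets U_Suc
    by (subst finite_measure_Diff) (auto simp: U_def measure_zero_set_mod[OF p assms(2) h] sol_density_def)
  define F where "F = (\<lambda>k x. indicat_real (W k) x *\<^sub>R t ^ k)"
  have F_int: "integrable ?\<mu> (F k)" for k
    unfolding F_def using W_sets by (intro integrable_scaleR_left) (auto simp: emeasure_eq_measure)
  have F_integral: "integral\<^sup>L ?\<mu> (F k) = measure ?\<mu> (W k) *\<^sub>R t ^ k" for k
    unfolding F_def using W_sets sets.sets_into_space[OF W_sets]
    by (subst integral_scaleR_left) (auto simp: Int_absorb2 emeasure_eq_measure)
  have F_norm: "norm (F k x) = indicat_real (W k) x * norm t ^ k" for k x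
    by (simp add: F_def norm_power)
  have F_norm_integral: "(LINT x|?\<mu>. norm (F k x)) = measure ?\<mu> (W k) * norm t ^ k" for k
    unfolding F_norm using W_sets sets.sets_into_space[OF W_sets]
    by (subst integral_mult_left_zero) (auto simp: Int_absorb2)
  have geom: "summable (\<lambda>k. norm t ^ k)" using t by (intro summable_geometric) auto
  have pointwise: "(\<lambda>k. F k x) sums (complex_of_real (Zp_norm p (Zp_eval p f x)) powr s)"
    if "x \<in> space ?\<mu>" for x
  proof -
    have *: "F k x = (if Zp_eval p f x k = 0 \<and> Zp_eval p f x (Suc k) \<noteq> 0 then t ^ k else 0)" for k
      using that by (auto simp: F_def W_def U_def zero_set_mod_def space indicator_def)
    show ?thesis unfolding * t_def
      by (rule Zp_norm_powr_sums[OF assms(1) Zp_eval_in[OF p assms(2)]]) (use that space in simp)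
  qed
  have "(\<lambda>k. integral\<^sup>L ?\<mu> (F k)) sums (LINT x|?\<mu>. suminf (\<lambda>k. F k x))"
  proof (rule sums_integral)
    show "integrable ?\<mu> (F k)" for k by (rule F_int)
    show "AE x in ?\<mu>. summable (\<lambda>k. norm (F k x))"
      unfolding F_norm
      by (intro AE_I2 summable_comparison_test'[OF geom, of 0]) (auto simp: indicator_def)
    show "summable (\<lambda>k. LINT x|?\<mu>. norm (F k x))"
      unfolding F_norm_integral
      by (intro summable_comparison_test'[OF geom, of 0]) (auto intro: mult_left_le_one_le simp: abs_mult)
  qed
  also have "(LINT x|?\<mu>. suminf (\<lambda>k. F k x)) = igusa_integral p n f s"
    unfolding igusa_integral_def by (intro Bochner_Integration.integral_cong refl sums_unique[symmetric] pointwise)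
  finally show ?thesis
    by (simp add: F_integral W_measure t_def scaleR_conv_of_real mult.commute)
qed

section \<open>Partial fractions and quasi-polynomial coefficients\<close>

text \<open>The Bezout form is the one that is used: its coefficients produce the numerators of
  partial fractions and cancel a factor in a divisibility.\<close>

definition comaximal :: "'a::comm_ring_1 \<Rightarrow> 'a \<Rightarrow> bool" where
  "comaximal F G \<longleftrightarrow> (\<exists>U W. U * F + W * G = 1)"

lemma comaximalI: "U * F + W * G = 1 \<Longrightarrow> comaximal F G"
  unfolding comaximal_def by blast

lemma comaximal_sym: "comaximal F G \<Longrightarrow> comaximal G F"
  unfolding comaximal_def by (metis add.commute)

lemma comaximal_mult:
  assumes "comaximal F G" "comaximal F H"
  shows "comaximal F (G * H)"
proof -
  obtain U W U' W' where "U * F + W * G = 1" "U' * F + W' * H = 1"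
    using assms unfolding comaximal_def by blast
  then have "(U * F + W * G) * (U' * F + W' * H) = 1" by simp
  then have "(U * U' * F + U * W' * H + W * U' * G) * F + (W * W') * (G * H) = 1"
    by (simp add: algebra_simps)
  then show ?thesis by (rule comaximalI)
qed

lemma comaximal_1: "comaximal F 1"
  by (rule comaximalI[of 0 _ 1]) simp

lemma comaximal_prod:
  "(\<And>k. k \<in> S \<Longrightarrow> comaximal F (G k)) \<Longrightarrow> comaximal F (prod G S)"
  by (induction S rule: infinite_finite_induct) (auto intro: comaximal_1 comaximal_mult)

lemma comaximal_dvd:
  assumes "comaximal F' G'" "F dvd F'" "G dvd G'"
  shows "comaximal F G"
proof -
  obtain U W where "U * F' + W * G' = 1" using assms(1) unfolding comaximal_def by blast
  moreover obtain x y where "F' = F * x" "G' = G * y" using assms(2,3) by (auto elim!: dvdE)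
  ultimately have "(U * x) * F + (W * y) * G = 1" by (simp add: mult_ac)
  then show ?thesis by (rule comaximalI)
qed

lemma comaximal_dvd_mult_iff:
  assumes "comaximal F G"
  shows "F dvd A * G \<longleftrightarrow> F dvd A"
proof
  assume "F dvd A * G"
  obtain U W where "U * F + W * G = 1" using assms unfolding comaximal_def by blast
  then have "A = A * U * F + W * (A * G)" by (metis mult.assoc mult.commute mult.right_neutral distrib_left)
  with \<open>F dvd A * G\<close> show "F dvd A" by (metis dvd_add dvd_mult dvd_triv_right)
qed simp

text \<open>Stated with cleared denominators, because the identity is read in three ways: among
  formal power series, at complex points off the zeros of the denominator, and modulo a divisor of
  one denominator.\<close>

lemma partial_fractions:
  fixes D :: "'k \<Rightarrow> 'a::field poly"
  assumes "finite V" "\<And>k. k \<in> V \<Longrightarrow> degree (D k) > 0"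
    and "\<And>k l. k \<in> V \<Longrightarrow> l \<in> V \<Longrightarrow> k \<noteq> l \<Longrightarrow> comaximal (D k) (D l)"
  shows "\<exists>Q A. B = Q * prod D V + (\<Sum>k\<in>V. A k * prod D (V - {k})) \<and> (\<forall>k\<in>V. degree (A k) < degree (D k))"
  using assms
proof (induction V arbitrary: B rule: finite_induct)
  case empty
  then show ?case by simp
next
  case (insert x V)
  define G where "G = prod D V"
  have "comaximal (D x) G" unfolding G_def
    using insert.hyps by (intro comaximal_prod insert.prems(2)) auto
  then obtain U W where UW: "U * D x + W * G = 1" unfolding comaximal_def by blast
  \<comment> \<open>B * W is reduced mod \<open>D x\<close> to get a proper numerator; its quotient
    q stays over the other denominators and is handed to the induction together with B * U.\<close>
  define q where "q = B * W div D x"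
  define a where "a = B * W mod D x"
  have D0: "D x \<noteq> 0" using insert.prems(1)[of x] by auto
  have deg: "degree a < degree (D x)"
    using degree_mod_less[OF D0, of "B * W"] insert.prems(1)[of x] by (auto simp: a_def)
  obtain Q A where QA: "B * U + q * G = Q * prod D V + (\<Sum>k\<in>V. A k * prod D (V - {k}))"
    "\<forall>k\<in>V. degree (A k) < degree (D k)"
    using insert.IH[of "B * U + q * G"] insert.prems by auto
  have "B = B * (U * D x + W * G)" using UW by simp
  also have "\<dots> = B * U * D x + (B * W) * G" by (simp add: algebra_simps)
  also have "B * W = q * D x + a" unfolding q_def a_def by (rule div_mult_mod_eq[symmetric])
  finally have "B = (B * U + q * G) * D x + a * G" by (simp add: algebra_simps)
  also have "\<dots> = Q * (D x * prod D V) + ((\<Sum>k\<in>V. A k * (D x * prod D (V - {k}))) + a * G)"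
    unfolding QA(1) by (simp add: algebra_simps sum_distrib_left sum_distrib_right)
  also have "D x * prod D V = prod D (insert x V)" using insert by simp
  also have "(\<Sum>k\<in>V. A k * (D x * prod D (V - {k}))) = (\<Sum>k\<in>V. (A(x := a)) k * prod D (insert x V - {k}))"
  proof (rule sum.cong[OF refl])
    fix k assume "k \<in> V"
    then have "k \<noteq> x" "insert x V - {k} = insert x (V - {k})" using insert.hyps by auto
    then show "A k * (D x * prod D (V - {k})) = (A(x := a)) k * prod D (insert x V - {k})"
      using insert.hyps by simp
  qed
  also have "a * G = (A(x := a)) x * prod D (insert x V - {x})"
    using insert.hyps by (simp add: G_def)
  also have "(\<Sum>k\<in>V. (A(x := a)) k * prod D (insert x V - {k})) + (A(x := a)) x * prod D (insert x V - {x})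
      = (\<Sum>k\<in>insert x V. (A(x := a)) k * prod D (insert x V - {k}))"
    using insert.hyps by (subst sum.insert) (auto simp: add.commute)
  finally have "B = Q * prod D (insert x V) + (\<Sum>k\<in>insert x V. (A(x := a)) k * prod D (insert x V - {k}))" .
  moreover have "\<forall>k\<in>insert x V. degree ((A(x := a)) k) < degree (D k)"
    using QA(2) deg by auto
  ultimately show ?case by blast
qed

lemma partial_fractions_fps:
  fixes D :: "'k \<Rightarrow> 'a::field poly"
  assumes "finite V" "\<And>k. k \<in> V \<Longrightarrow> coeff (D k) 0 \<noteq> 0"
    and "B = Q * prod D V + (\<Sum>k\<in>V. A k * prod D (V - {k}))"
  shows "fps_of_poly B / fps_of_poly (prod D V) =
    fps_of_poly Q + (\<Sum>k\<in>V. fps_of_poly (A k) / fps_of_poly (D k))"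
proof -
  have unit: "inverse (fps_of_poly (D k)) * fps_of_poly (D k) = 1" if "k \<in> V" for k
    using assms(2)[OF that] by (intro inverse_mult_eq_1) simp
  let ?P = "fps_of_poly (prod D V)"
  have P0: "fps_nth ?P 0 \<noteq> 0" using assms(1,2) by (simp add: poly_0_coeff_0[symmetric] poly_prod)
  have "fps_of_poly B = fps_of_poly Q * ?P + (\<Sum>k\<in>V. fps_of_poly (A k) * fps_of_poly (prod D (V - {k})))"
    unfolding assms(3) by (simp add: fps_of_poly_add fps_of_poly_mult fps_of_poly_sum)
  also have "(\<Sum>k\<in>V. fps_of_poly (A k) * fps_of_poly (prod D (V - {k}))) =
      (\<Sum>k\<in>V. fps_of_poly (A k) * inverse (fps_of_poly (D k)) * ?P)"
  proof (rule sum.cong[OF refl])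
    fix k assume k: "k \<in> V"
    have "?P = fps_of_poly (D k) * fps_of_poly (prod D (V - {k}))"
      using prod.remove[OF assms(1) k, of D] by (simp add: fps_of_poly_mult)
    then have "inverse (fps_of_poly (D k)) * ?P =
        (inverse (fps_of_poly (D k)) * fps_of_poly (D k)) * fps_of_poly (prod D (V - {k}))"
      by (simp only: mult.assoc)
    then show "fps_of_poly (A k) * fps_of_poly (prod D (V - {k})) =
       fps_of_poly (A k) * inverse (fps_of_poly (D k)) * ?P"
      using unit[OF k] by (simp add: mult.assoc)
  qed
  finally have "fps_of_poly B = (fps_of_poly Q + (\<Sum>k\<in>V. fps_of_poly (A k) * inverse (fps_of_poly (D k)))) * ?P"
    by (simp add: algebra_simps sum_distrib_left sum_distrib_right)
  moreover have "?P * inverse ?P = 1" using P0 by (rule inverse_mult_eq_1')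
  ultimately have "fps_of_poly B * inverse ?P = fps_of_poly Q + (\<Sum>k\<in>V. fps_of_poly (A k) * inverse (fps_of_poly (D k)))"
    by (simp add: mult.assoc)
  then show ?thesis
    using P0 assms(2) by (simp add: fps_divide_unit)
qed

text \<open>Every term of the sum has degree below that of \<open>prod D V\<close>, so nothing
  cancels the leading term of Q * \<open>prod D V\<close>. This gives deg Q \<le> deg P, the source
  of the bound i > deg P.\<close>

lemma partial_fractions_degree:
  fixes D :: "'k \<Rightarrow> 'a::field poly"
  assumes "finite V" and "\<And>k. k \<in> V \<Longrightarrow> degree (A k) < degree (D k)"
    and "B = Q * prod D V + (\<Sum>k\<in>V. A k * prod D (V - {k}))" "Q \<noteq> 0"
  shows "degree Q + degree (prod D V) \<le> degree B"
proof (rule ccontr)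
  assume less: "\<not> ?thesis"
  have D0: "D k \<noteq> 0" if "k \<in> V" for k using assms(2)[OF that] by auto
  have P0: "prod D V \<noteq> 0" using assms(1) D0 by simp
  have QP: "degree (Q * prod D V) = degree Q + degree (prod D V)" using assms(4) P0 by (rule degree_mult_eq)
  have "coeff (A k * prod D (V - {k})) (degree Q + degree (prod D V)) = 0" if k: "k \<in> V" for k
  proof (rule coeff_eq_0)
    have "prod D V = D k * prod D (V - {k})" using assms(1) k by (rule prod.remove)
    then have "degree (prod D V) = degree (D k) + degree (prod D (V - {k}))"
      using P0 by (metis degree_mult_eq mult_eq_0_iff)
    then show "degree (A k * prod D (V - {k})) < degree Q + degree (prod D V)"
      using degree_mult_le[of "A k" "prod D (V - {k})"] assms(2)[OF k] by linarith
  qed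
  moreover have "coeff B (degree Q + degree (prod D V)) = 0" using less by (intro coeff_eq_0) simp
  ultimately have "coeff (Q * prod D V) (degree Q + degree (prod D V)) = 0"
    unfolding assms(3) by (simp add: coeff_sum)
  with QP have "lead_coeff (Q * prod D V) = 0" by simp
  with assms(4) P0 show False by simp
qed

text \<open>Interpolates the binomial coefficient $\binom{\lfloor i/b\rfloor + m}{m}$ on the residue class of $x$ mod $b$.\<close>

definition binomial_poly :: "nat \<Rightarrow> nat \<Rightarrow> nat \<Rightarrow> 'a::field_char_0 poly" where
  "binomial_poly b x m = (\<Prod>k=1..m. [:1 - of_nat x / of_nat (b * k), 1 / of_nat (b * k):])"

text \<open>With i = b*q + x the k-th linear factor takes the value (q + k)/k, and the product of
  these is the binomial coefficient.\<close>

lemma poly_binomial_poly: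
  assumes "b > 0"
  shows "poly (binomial_poly b (i mod b) m) (of_nat i :: 'a::field_char_0) = of_nat ((i div b + m) choose m)"
proof (induction m)
  case (Suc m)
  have i: "(of_nat i :: 'a) = of_nat b * of_nat (i div b) + of_nat (i mod b)"
    unfolding of_nat_mult[symmetric] of_nat_add[symmetric] by simp
  moreover have "1 - x / (c * d) + (c * q + x) * (1 / (c * d)) = (d + q) / d" if "c \<noteq> 0" "d \<noteq> 0" for x c d q :: 'a
    using that by (simp add: field_simps)
  ultimately have "poly [:1 - of_nat (i mod b) / of_nat (b * Suc m), 1 / of_nat (b * Suc m):] (of_nat i :: 'a) =
      (of_nat (Suc m) + of_nat (i div b)) / of_nat (Suc m)"
    using assms by (simp del: of_nat_Suc mult_Suc_right)
  moreover have "binomial_poly b (i mod b) (Suc m) =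
      binomial_poly b (i mod b) m * ([:1 - of_nat (i mod b) / of_nat (b * Suc m), 1 / of_nat (b * Suc m):] :: 'a poly)"
    unfolding binomial_poly_def by (subst prod.nat_ivl_Suc') (simp, rule mult.commute)
  ultimately have "poly (binomial_poly b (i mod b) (Suc m)) (of_nat i :: 'a) =
     of_nat ((i div b + m) choose m) * ((of_nat (Suc m) + of_nat (i div b)) / of_nat (Suc m))"
    using Suc by (simp only: poly_mult)
  also have "\<dots> = of_nat ((i div b + Suc m) choose Suc m)"
  proof -
    have "Suc m * (Suc (i div b + m) choose Suc m) = Suc (i div b + m) * ((i div b + m) choose m)"
      by (metis Suc_times_binomial_eq mult.commute)
    then have "of_nat (Suc m) * of_nat (Suc (i div b + m) choose Suc m) =
       (of_nat (Suc (i div b + m)) * of_nat ((i div b + m) choose m) :: 'a)"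
      by (metis of_nat_mult)
    moreover have "(of_nat (Suc m) :: 'a) \<noteq> 0" by (rule of_nat_neq_0)
    ultimately show ?thesis by (simp add: field_simps)
  qed
  finally show ?case .
qed (simp add: binomial_poly_def)

text \<open>The leading coefficient is nonzero and does not depend on x. Hence the top coefficients
  in \<open>coeff_divide_one_minus_monom_power\<close> are a fixed nonzero multiple of the
  coefficients of the remainder.\<close>

lemma binomial_poly_degree:
  assumes "b > 0"
  shows "degree (binomial_poly b x m :: 'a::field_char_0 poly) = m"
    and "coeff (binomial_poly b x m :: 'a poly) m = 1 / (of_nat b ^ m * fact m)"
proof -
  let ?f = "\<lambda>k. [:1 - of_nat x / of_nat (b * k), 1 / of_nat (b * k):] :: 'a poly"
  have nz: "?f k \<noteq> 0" "degree (?f k) = 1" if "k \<in> {1..m}" for k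
    using that assms by auto
  have "degree (binomial_poly b x m :: 'a poly) = (\<Sum>k=1..m. degree (?f k))"
    unfolding binomial_poly_def using nz by (intro degree_prod_eq_sum_degree) auto
  also have "\<dots> = m" using nz(2) by simp
  finally show deg: "degree (binomial_poly b x m :: 'a poly) = m" .
  have "lead_coeff (binomial_poly b x m :: 'a poly) = (\<Prod>k=1..m. lead_coeff (?f k))"
    unfolding binomial_poly_def by (rule lead_coeff_prod)
  also have "\<dots> = (\<Prod>k=1..m. 1 / of_nat (b * k))"
    using nz(2) by (intro prod.cong) auto
  also have "\<dots> = 1 / (of_nat b ^ m * fact m)"
    by (simp add: fact_prod prod_dividef prod.distrib)
  finally show "coeff (binomial_poly b x m :: 'a poly) m = 1 / (of_nat b ^ m * fact m)"
    using deg by simp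
qed

lemma degree_one_minus_monom:
  fixes c :: "'a::field"
  assumes "b > 0" "c \<noteq> 0"
  shows "degree (1 - monom c b) = b"
proof -
  have "degree (- monom c b) = b" using assms by (simp add: degree_monom_eq)
  then have "degree (1 + - monom c b) = b" using assms by (subst degree_add_eq_right) auto
  then show ?thesis by simp
qed

lemma fps_nth_mult_one_minus_monom:
  fixes c :: "'a::comm_ring_1"
  shows "fps_nth (f * fps_of_poly (1 - monom c b)) i = fps_nth f i - (if i < b then 0 else c * fps_nth f (i - b))"
proof -
  have "f * fps_of_poly (1 - monom c b) = f - fps_const c * (f * fps_X ^ b)"
    by (simp add: fps_of_poly_diff fps_of_poly_monom algebra_simps)
  then show ?thesis by (simp add: fps_X_power_mult_right_nth)
qed

text \<open>The expansion of $A/(1 - ct^b)^{m+1}$ when $\deg A < b$.\<close>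

definition geometric_fps :: "nat \<Rightarrow> 'a::field_char_0 \<Rightarrow> 'a poly \<Rightarrow> nat \<Rightarrow> 'a fps" where
  "geometric_fps b c A m = Abs_fps (\<lambda>i. c ^ (i div b) * coeff A (i mod b) * of_nat ((i div b + m) choose m))"

text \<open>One factor 1 - c t^b lowers m by one through Pascal's rule. For m = 0 it removes all but
  the block i < b, and this block is A because deg A < b.\<close>

lemma geometric_fps_mult:
  fixes c :: "'a::field_char_0"
  assumes "b > 0" "degree A < b"
  shows "geometric_fps b c A m * fps_of_poly (1 - monom c b) ^ Suc m = fps_of_poly A"
proof (induction m)
  case 0
  have "fps_nth (geometric_fps b c A 0 * fps_of_poly (1 - monom c b)) i = fps_nth (fps_of_poly A) i" for i
  proof (cases "i < b")
    case True
    then show ?thesis by (simp add: fps_nth_mult_one_minus_monom geometric_fps_def)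
  next
    case False
    then have "i div b = Suc ((i - b) div b)" "i mod b = (i - b) mod b"
      using assms(1) by (simp_all add: le_div_geq le_mod_geq)
    moreover have "coeff A i = 0" using False assms(2) by (intro coeff_eq_0) simp
    ultimately show ?thesis using False by (simp add: fps_nth_mult_one_minus_monom geometric_fps_def)
  qed
  then show ?case by (simp add: fps_ext)
next
  case (Suc m)
  have "fps_nth (geometric_fps b c A (Suc m) * fps_of_poly (1 - monom c b)) i = fps_nth (geometric_fps b c A m) i" for i
  proof (cases "i < b")
    case True
    then show ?thesis by (simp add: fps_nth_mult_one_minus_monom geometric_fps_def)
  next
    case False
    define j where "j = (i - b) div b"
    have ij: "i div b = Suc j" "i mod b = (i - b) mod b"
      using assms(1) False by (simp_all add: le_div_geq le_mod_geq j_def)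
    have "Suc j + Suc m choose Suc m = (Suc j + m choose m) + (j + Suc m choose Suc m)" by simp
    then have "(of_nat (Suc j + Suc m choose Suc m) :: 'a) = of_nat (Suc j + m choose m) + of_nat (j + Suc m choose Suc m)"
      by (simp only: of_nat_add)
    then show ?thesis using False ij unfolding fps_nth_mult_one_minus_monom geometric_fps_def
      by (simp add: j_def[symmetric] algebra_simps del: binomial_Suc_Suc add_Suc add_Suc_right)
  qed
  then have "geometric_fps b c A (Suc m) * fps_of_poly (1 - monom c b) = geometric_fps b c A m" by (rule fps_ext)
  then show ?case using Suc by (metis mult.assoc power_Suc)
qed

lemma fps_divide_eqI:
  fixes f g h :: "'a::field fps"
  assumes "h * g = f" "fps_nth g 0 \<noteq> 0"
  shows "f / g = h"
  using assms by (metis fps_divide_unit inverse_mult_eq_1' mult.assoc mult.right_neutral)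

lemma fps_divide_times_unit:
  fixes f g :: "'a::field fps"
  assumes "fps_nth g 0 \<noteq> 0"
  shows "f / g * g = f"
  using inverse_mult_eq_1[OF assms] by (simp add: fps_divide_unit[OF assms] mult.assoc)

text \<open>Division by E = 1 - c t^b peels off one power: the remainder over E^(m+1) expands into
  multiples of binomial polynomials of degree m, while the quotient over E^m has only degrees below
  m. So the coefficient of degree m sees only A mod E.\<close>

lemma coeff_divide_one_minus_monom_power:
  fixes c :: "'a::field_char_0"
  assumes b: "b > 0" and c: "c \<noteq> 0" and "degree A < b * Suc m"
  shows "\<exists>q. (\<forall>x. degree (q x) \<le> m) \<and>
    (\<forall>i. fps_nth (fps_of_poly A / fps_of_poly (1 - monom c b) ^ Suc m) i = c ^ (i div b) * poly (q (i mod b)) (of_nat i)) \<and>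
    (\<forall>x<b. coeff (q x) m = coeff (A mod (1 - monom c b)) x / (of_nat b ^ m * fact m))"
  using assms(3)
proof (induction m arbitrary: A)
  case (0 A)
  define E where "E = 1 - monom c b"
  have E: "degree E = b" unfolding E_def by (rule degree_one_minus_monom[OF b c])
  have E0: "fps_nth (fps_of_poly E) 0 \<noteq> 0" using b by (simp add: E_def)
  have "fps_of_poly A / fps_of_poly E ^ Suc 0 = geometric_fps b c A 0"
    unfolding E_def using geometric_fps_mult[OF b, of A c 0] 0 b by (intro fps_divide_eqI) (auto simp: E_def)
  moreover have "A mod E = A" using 0 E by (intro mod_poly_less) simp
  ultimately show ?case unfolding E_def
    by (intro exI[of _ "\<lambda>x. [:coeff A x:]"]) (auto simp: geometric_fps_def)
next
  case (Suc m A)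
  define E where "E = 1 - monom c b"
  have E: "degree E = b" unfolding E_def by (rule degree_one_minus_monom[OF b c])
  have E_nz: "E \<noteq> 0" using E b by auto
  have E0: "fps_nth (fps_of_poly E) 0 \<noteq> 0" using b by (simp add: E_def)
  define A0 where "A0 = A mod E"
  define A1 where "A1 = A div E"
  have A: "A = A1 * E + A0" unfolding A0_def A1_def by (rule div_mult_mod_eq[symmetric])
  have A0: "degree A0 < b" using degree_mod_less[OF E_nz, of A] E b by (auto simp: A0_def)
  have "degree A1 < b * Suc m"
  proof (rule ccontr)
    assume le: "\<not> degree A1 < b * Suc m"
    with b have "A1 \<noteq> 0" by (metis degree_0 nat_0_less_mult_iff zero_less_Suc)
    then have "degree (A1 * E) = degree A1 + b" using E E_nz by (simp add: degree_mult_eq)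
    then have "degree A = degree A1 + b" unfolding A using A0 by (subst degree_add_eq_left) auto
    with le Suc.prems show False by simp
  qed
  from Suc.IH[OF this, folded E_def] obtain q where q': "\<forall>x. degree (q x) \<le> m"
    "\<forall>i. fps_nth (fps_of_poly A1 / fps_of_poly E ^ Suc m) i = c ^ (i div b) * poly (q (i mod b)) (of_nat i)"
    by (elim exE conjE) (rule that)
  note q = q'(1)[rule_format] q'(2)[rule_format]
  define q' where "q' = (\<lambda>x. smult (coeff A0 x) (binomial_poly b x (Suc m)) + q x)"
  have "fps_of_poly A / fps_of_poly E ^ Suc (Suc m) =
      geometric_fps b c A0 (Suc m) + fps_of_poly A1 / fps_of_poly E ^ Suc m"
  proof (rule fps_divide_eqI)
    have "fps_of_poly A1 / fps_of_poly E ^ Suc m * fps_of_poly E ^ Suc m = fps_of_poly A1"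
      using E0 by (intro fps_divide_times_unit) simp
    moreover have "fps_of_poly E ^ Suc (Suc m) = fps_of_poly E ^ Suc m * fps_of_poly E" by (rule power_Suc2)
    ultimately have "fps_of_poly A1 / fps_of_poly E ^ Suc m * fps_of_poly E ^ Suc (Suc m) = fps_of_poly A1 * fps_of_poly E"
      by (simp only: mult.assoc[symmetric])
    then show "(geometric_fps b c A0 (Suc m) + fps_of_poly A1 / fps_of_poly E ^ Suc m) * fps_of_poly E ^ Suc (Suc m)
       = fps_of_poly A"
      using geometric_fps_mult[OF b A0, of c "Suc m"] unfolding E_def[symmetric]
      by (simp only: distrib_right) (simp add: A fps_of_poly_add fps_of_poly_mult)
  qed (use E0 in simp)
  then have "fps_nth (fps_of_poly A / fps_of_poly E ^ Suc (Suc m)) i = c ^ (i div b) * poly (q' (i mod b)) (of_nat i)" for i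
    using q(2)[of i] poly_binomial_poly[OF b, of i "Suc m", where ?'a = 'a]
    by (simp add: geometric_fps_def q'_def algebra_simps del: binomial_Suc_Suc add_Suc_right power_Suc)
  moreover have "degree (q' x) \<le> Suc m" for x
    unfolding q'_def using q(1)[of x] binomial_poly_degree(1)[OF b, of x "Suc m", where ?'a = 'a]
    by (intro degree_add_le order_trans[OF degree_smult_le]) auto
  moreover have "coeff (q' x) (Suc m) = coeff (A mod E) x / (of_nat b ^ Suc m * fact (Suc m))" for x
    using binomial_poly_degree(2)[OF b, of x "Suc m", where ?'a = 'a] q(1)[of x]
    by (simp add: q'_def A0_def coeff_eq_0 del: fact_Suc power_Suc)
  ultimately show ?case unfolding E_def by blast
qed

section \<open>Independence of exponential quasi-polynomials\<close>

lemma of_rat_poly: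
  "(of_rat (poly q x) :: 'a::field_char_0) = poly (map_poly of_rat q) (of_rat x)"
  by (induction q) (auto simp: map_poly_pCons of_rat_add of_rat_mult)

lemma of_rat_power_int: "(of_rat (x powi k) :: 'a::field_char_0) = of_rat x powi k"
  by (simp add: power_int_def of_rat_power of_rat_inverse)

lemma poly_times_power_null:
  fixes q :: "real poly" and c :: real
  assumes "0 \<le> c" "c < 1"
  shows "(\<lambda>i. poly q (real i) * c ^ i) \<longlonglongrightarrow> 0"
  using assms
proof (induction q arbitrary: c)
  case 0
  then show ?case by simp
next
  case (pCons a q)
  \<comment> \<open>With c = d * d, one power d^i absorbs the factor i and the other serves the
    induction hypothesis, which therefore quantifies over c.\<close>
  define d where "d = sqrt c"
  have d: "0 \<le> d" "d < 1" "c = d * d" using pCons.prems by (auto simp: d_def real_sqrt_lt_1_iff)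
  have "(\<lambda>i. a * c ^ i + (real i * d ^ i) * (poly q (real i) * d ^ i)) \<longlonglongrightarrow> a * 0 + 0 * 0"
    using pCons.prems d pCons.IH[OF d(1,2)] powser_times_n_limit_0[of d]
    by (intro tendsto_intros LIMSEQ_realpow_zero) auto
  moreover have "a * c ^ i + (real i * d ^ i) * (poly q (real i) * d ^ i) = poly (pCons a q) (real i) * c ^ i" for i
    by (simp add: d(3) power_mult_distrib algebra_simps)
  ultimately show ?case by simp
qed

lemma poly_on_residues_times_power_null:
  assumes "poly_on_residues m h q" "0 \<le> c" "c < 1"
  shows "(\<lambda>i. \<bar>real_of_rat (h i)\<bar> * c ^ i) \<longlonglongrightarrow> 0"
proof (rule Lim_null_comparison)
  let ?q = "\<lambda>x. map_poly of_rat (q x) :: real poly"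
  have m: "m > 0" and h: "\<And>i. h i = poly (q (i mod m)) (of_nat i)"
    using assms(1) by (auto simp: poly_on_residues_def)
  show "(\<lambda>i. \<Sum>x<m. \<bar>poly (?q x) (real i) * c ^ i\<bar>) \<longlonglongrightarrow> 0"
    by (intro tendsto_null_sum tendsto_rabs_zero poly_times_power_null assms)
  show "\<forall>\<^sub>F i in sequentially. norm (\<bar>real_of_rat (h i)\<bar> * c ^ i) \<le> (\<Sum>x<m. \<bar>poly (?q x) (real i) * c ^ i\<bar>)"
  proof (rule always_eventually, rule allI)
    fix i
    have "real_of_rat (h i) = poly (?q (i mod m)) (real i)"
      by (simp add: h of_rat_poly)
    then have "norm (\<bar>real_of_rat (h i)\<bar> * c ^ i) = \<bar>poly (?q (i mod m)) (real i) * c ^ i\<bar>"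
      by (simp add: abs_mult)
    also have "\<dots> \<le> (\<Sum>x<m. \<bar>poly (?q x) (real i) * c ^ i\<bar>)"
      using m by (intro member_le_sum) auto
    finally show "norm (\<bar>real_of_rat (h i)\<bar> * c ^ i) \<le> (\<Sum>x<m. \<bar>poly (?q x) (real i) * c ^ i\<bar>)" .
  qed
qed

lemma poly_comp_not_null:
  fixes q :: "real poly"
  assumes "q \<noteq> 0" "filterlim u at_top sequentially"
  shows "\<not> (\<lambda>i. poly q (u i)) \<longlonglongrightarrow> 0"
proof (cases "degree q = 0")
  case True
  then obtain a where "q = [:a:]" by (auto elim: degree_eq_zeroE)
  with assms(1) show ?thesis by (auto simp: LIMSEQ_const_iff)
next
  case False
  then have "filterlim (poly q) at_infinity at_infinity" by (intro filterlim_poly_at_infinity) auto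
  then have "filterlim (\<lambda>i. poly q (u i)) at_infinity sequentially"
    using filterlim_mono[OF assms(2) at_top_le_at_infinity order.refl] by (rule filterlim_compose)
  then show ?thesis using not_tendsto_and_filterlim_at_infinity[of sequentially "\<lambda>i. poly q (u i)" 0] by auto
qed

text \<open>Along i0 + m*t one nonzero polynomial is evaluated at arguments that tend to infinity.
  So a single nonzero value already prevents h from vanishing in the limit.\<close>

lemma poly_on_residues_not_null:
  assumes "poly_on_residues m h q" "h i0 \<noteq> 0"
  shows "\<not> (\<lambda>i. real_of_rat (h i)) \<longlonglongrightarrow> 0"
proof
  assume lim: "(\<lambda>i. real_of_rat (h i)) \<longlonglongrightarrow> 0"
  have m: "m > 0" and h: "\<And>i. h i = poly (q (i mod m)) (of_nat i)"
    using assms(1) by (auto simp: poly_on_residues_def)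
  define r :: "real poly" where "r = map_poly of_rat (q (i0 mod m))"
  have "poly r (real i0) = real_of_rat (h i0)" by (simp add: h of_rat_poly r_def)
  with assms(2) have r: "r \<noteq> 0" by auto
  define u where "u = (\<lambda>t. i0 + m * t)"
  have u: "strict_mono u" using m by (auto simp: u_def strict_mono_def)
  have "(\<lambda>t. real_of_rat (h (u t))) \<longlonglongrightarrow> 0"
    using LIMSEQ_subseq_LIMSEQ[OF lim u] by (simp add: o_def)
  moreover have "real_of_rat (h (u t)) = poly r (real (u t))" for t
    by (simp add: h of_rat_poly r_def u_def of_rat_add of_rat_mult)
  moreover have "filterlim (\<lambda>t. real (u t)) at_top sequentially"
    by (rule filterlim_compose[OF filterlim_real_sequentially filterlim_subseq[OF u]])
  ultimately show False using poly_comp_not_null[OF r] by simp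
qed

text \<open>Dividing by the power with the largest exponent y leaves h y equal to a sum of terms
  that decay exponentially, so it would tend to 0. The relation is assumed only for i > d, yet the
  conclusion covers every i, since a quasi-polynomial is determined by its tail.\<close>

lemma exponential_quasi_polys_independent:
  fixes p :: nat and h :: "rat \<Rightarrow> nat \<Rightarrow> rat"
  assumes p: "p > 1" and fin: "finite L"
    and quasi: "\<And>x. x \<in> L \<Longrightarrow> \<exists>m q. poly_on_residues m (h x) q"
    and sum0: "\<And>i. d < int i \<Longrightarrow> (\<Sum>x\<in>L. h x i * of_nat p powi \<lceil>x * of_nat i\<rceil>) = 0"
    and "x \<in> L"
  shows "h x i = 0"
proof (rule ccontr)
  assume "h x i \<noteq> 0"
  \<comment> \<open>Zero functions are dropped so that the largest remaining exponent belongs to a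
    nonzero function.\<close>
  define S where "S = {x \<in> L. \<exists>i. h x i \<noteq> 0}"
  have S: "finite S" "S \<noteq> {}" using fin \<open>x \<in> L\<close> \<open>h x i \<noteq> 0\<close> by (auto simp: S_def)
  define y where "y = Max S"
  have y: "y \<in> S" unfolding y_def using S by (rule Max_in)
  have le: "z < y" if "z \<in> S - {y}" for z
    using Max_ge[OF S(1), of z] that by (auto simp: y_def order.strict_iff_order)
  from y obtain i0 where i0: "h y i0 \<noteq> 0" and yL: "y \<in> L" by (auto simp: S_def)
  let ?e = "\<lambda>z (i::nat). real p powi \<lceil>z * of_nat i\<rceil>"
  let ?c = "\<lambda>z. real p powr (real_of_rat (z - y))"
  have e: "?e z i = real p powr real_of_int \<lceil>z * of_nat i\<rceil>" for z i
    using p by (simp add: powr_real_of_int')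
  have e0: "0 \<le> ?e z i" for z i unfolding e by (rule powr_ge_zero)
  \<comment> \<open>The extra factor p pays for the rounding: the ceiling of z*i exceeds that of y*i
    by at most (z - y)*i + 1.\<close>
  have bound: "\<bar>real_of_rat (h y i)\<bar> \<le> (\<Sum>z\<in>S - {y}. real p * (\<bar>real_of_rat (h z i)\<bar> * ?c z ^ i))" if "d < int i" for i
  proof -
    have "(\<Sum>x\<in>S. h x i * of_nat p powi \<lceil>x * of_nat i\<rceil>) = 0"
      using sum0[OF that] by (subst sum.mono_neutral_left[of L S]) (auto simp: S_def fin)
    then have "real_of_rat (\<Sum>x\<in>S. h x i * of_nat p powi \<lceil>x * of_nat i\<rceil>) = 0" by simp
    then have "(\<Sum>z\<in>S. real_of_rat (h z i) * ?e z i) = 0"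
      by (simp add: of_rat_sum of_rat_mult of_rat_power_int)
    then have "real_of_rat (h y i) * ?e y i = - (\<Sum>z\<in>S - {y}. real_of_rat (h z i) * ?e z i)"
      using sum.remove[OF S(1) y, of "\<lambda>z. real_of_rat (h z i) * ?e z i"] by linarith
    then have "\<bar>real_of_rat (h y i) * ?e y i\<bar> = \<bar>\<Sum>z\<in>S - {y}. real_of_rat (h z i) * ?e z i\<bar>"
      by (simp only: abs_minus_cancel)
    then have "\<bar>real_of_rat (h y i)\<bar> * ?e y i = \<bar>\<Sum>z\<in>S - {y}. real_of_rat (h z i) * ?e z i\<bar>"
      by (simp only: abs_mult[of _ "?e y i"] abs_of_nonneg[OF e0])
    also have "\<dots> \<le> (\<Sum>z\<in>S - {y}. \<bar>real_of_rat (h z i)\<bar> * ?e z i)"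
      by (intro order_trans[OF sum_abs] sum_mono) (simp only: abs_mult abs_of_nonneg[OF e0] order.refl)
    also have "\<dots> \<le> (\<Sum>z\<in>S - {y}. (real p * (\<bar>real_of_rat (h z i)\<bar> * ?c z ^ i)) * ?e y i)"
    proof (rule sum_mono)
      fix z
      have ceil: "real_of_int \<lceil>w\<rceil> \<le> real_of_rat w + 1" "real_of_rat w \<le> real_of_int \<lceil>w\<rceil>" for w
      proof -
        have "of_int \<lceil>w\<rceil> \<le> w + 1" "w \<le> of_int \<lceil>w\<rceil>" by linarith+
        then have "real_of_rat (of_int \<lceil>w\<rceil>) \<le> real_of_rat (w + 1)" "real_of_rat w \<le> real_of_rat (of_int \<lceil>w\<rceil>)"
          by (simp_all only: of_rat_less_eq)
        then show "real_of_int \<lceil>w\<rceil> \<le> real_of_rat w + 1" "real_of_rat w \<le> real_of_int \<lceil>w\<rceil>"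
          by (simp_all add: of_rat_add)
      qed
      have "?c z ^ i = real p powr (real_of_rat (z - y) * real i)"
        using p by (simp add: powr_powr[symmetric] powr_realpow)
      then have "real p * ?c z ^ i * ?e y i =
          real p powr (1 + real_of_rat (z - y) * real i + real_of_int \<lceil>y * of_nat i\<rceil>)"
        using p by (simp only: e powr_add) simp
      moreover have "real_of_int \<lceil>z * of_nat i\<rceil> \<le> 1 + real_of_rat (z - y) * real i + real_of_int \<lceil>y * of_nat i\<rceil>"
        using ceil(1)[of "z * of_nat i"] ceil(2)[of "y * of_nat i"]
        by (simp add: of_rat_mult of_rat_diff algebra_simps)
      ultimately have "?e z i \<le> real p * ?c z ^ i * ?e y i"
        using p unfolding e by simp
      then have "\<bar>real_of_rat (h z i)\<bar> * ?e z i \<le> \<bar>real_of_rat (h z i)\<bar> * (real p * ?c z ^ i * ?e y i)"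
        by (rule mult_left_mono) simp
      then show "\<bar>real_of_rat (h z i)\<bar> * ?e z i \<le> (real p * (\<bar>real_of_rat (h z i)\<bar> * ?c z ^ i)) * ?e y i"
        by (simp add: mult_ac)
    qed
    also have "\<dots> = (\<Sum>z\<in>S - {y}. real p * (\<bar>real_of_rat (h z i)\<bar> * ?c z ^ i)) * ?e y i"
      by (rule sum_distrib_right[symmetric])
    finally show ?thesis
      by (rule mult_right_le_imp_le) (use p in simp)
  qed
  have "(\<lambda>i. \<Sum>z\<in>S - {y}. real p * (\<bar>real_of_rat (h z i)\<bar> * ?c z ^ i)) \<longlonglongrightarrow> 0"
  proof (intro tendsto_null_sum tendsto_mult_right_zero)
    fix z assume z: "z \<in> S - {y}"
    then have "z \<in> L" by (auto simp: S_def)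
    from quasi[OF this] obtain m q where "poly_on_residues m (h z) q" by blast
    moreover have "?c z < 1" using p le[OF z] by (intro powr_less_one) auto
    ultimately show "(\<lambda>i. \<bar>real_of_rat (h z i)\<bar> * ?c z ^ i) \<longlonglongrightarrow> 0"
      by (intro poly_on_residues_times_power_null) auto
  qed
  moreover have "\<forall>\<^sub>F i in sequentially. norm (real_of_rat (h y i)) \<le> (\<Sum>z\<in>S - {y}. real p * (\<bar>real_of_rat (h z i)\<bar> * ?c z ^ i))"
    using eventually_gt_at_top[of "nat d"] by eventually_elim (use bound in auto)
  ultimately have "(\<lambda>i. real_of_rat (h y i)) \<longlonglongrightarrow> 0" by (rule Lim_null_comparison[rotated])
  moreover from quasi[OF yL] obtain m q where "poly_on_residues m (h y) q" by blast
  ultimately show False using poly_on_residues_not_null i0 by blast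
qed

lemma poly_on_residues_add:
  assumes "\<exists>m q. poly_on_residues m g q" "\<exists>m q. poly_on_residues m h q"
  shows "\<exists>m q. poly_on_residues m (\<lambda>i. g i + h i) q"
proof -
  obtain m q m' q' where "poly_on_residues m g q" "poly_on_residues m' h q'" using assms by blast
  then have "poly_on_residues (m * m') (\<lambda>i. g i + h i) (\<lambda>c. q (c mod m) + q' (c mod m'))"
    by (auto simp: poly_on_residues_def mod_mod_cancel)
  then show ?thesis by blast
qed

lemma poly_on_residues_minus:
  assumes "\<exists>m q. poly_on_residues m g q"
  shows "\<exists>m q. poly_on_residues m (\<lambda>i. - g i) q"
proof -
  obtain m q where "poly_on_residues m g q" using assms by blast
  then have "poly_on_residues m (\<lambda>i. - g i) (\<lambda>c. - q c)"
    by (auto simp: poly_on_residues_def)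
  then show ?thesis by blast
qed

lemma poly_on_residues_sum:
  assumes "\<And>k. k \<in> S \<Longrightarrow> \<exists>m q. poly_on_residues m (g k) q"
  shows "\<exists>m q. poly_on_residues m (\<lambda>i. \<Sum>k\<in>S. g k i) q"
proof -
  have zero: "\<exists>m q. poly_on_residues m (\<lambda>i. 0) q"
    by (intro exI[of _ 1] exI[of _ "\<lambda>_. 0"]) (simp add: poly_on_residues_def)
  show ?thesis using assms
    by (induction S rule: infinite_finite_induct) (simp_all add: zero poly_on_residues_add)
qed

lemma sol_decompositionD:
  assumes "sol_decomposition p n f d r l g" "d < int i"
  shows "of_nat (num_sols p n f i) = (\<Sum>k=1..r. g k i * of_nat p powi \<lceil>l k * of_nat i\<rceil>)"
  using assms unfolding sol_decomposition_def by blast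

text \<open>The difference of the two right-hand sides, grouped by exponent, vanishes beyond both
  thresholds, so independence applies. An exponent absent from the second decomposition would give g
  k = 0, which \<open>sol_decomposition\<close> excludes.\<close>

lemma sol_decomposition_component:
  assumes p: "p > 1" and S: "sol_decomposition p n f d r l g" and S': "sol_decomposition p n f d' r' l' g'"
    and k: "k \<in> {1..r}"
  shows "\<exists>k'\<in>{1..r'}. l' k' = l k \<and> g' k' = g k"
proof -
  define L where "L = l ` {1..r} \<union> l' ` {1..r'}"
  \<comment> \<open>Since l and l' are injective, each inner sum has at most one term; the empty sum
    stands for an exponent that does not occur.\<close>
  define h where "h = (\<lambda>x i. (\<Sum>k\<in>{k\<in>{1..r}. l k = x}. g k i) + - (\<Sum>k\<in>{k\<in>{1..r'}. l' k = x}. g' k i))"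
  have inj: "inj_on l {1..r}" "inj_on l' {1..r'}" using S S' by (auto simp: sol_decomposition_def)
  have sums: "(\<Sum>x\<in>L. (\<Sum>k\<in>{k\<in>{1..r}. l k = x}. g k i) * of_nat p powi \<lceil>x * of_nat i\<rceil>) =
        (\<Sum>k=1..r. g k i * of_nat p powi \<lceil>l k * of_nat i\<rceil>)" if "l ` {1..r} \<subseteq> L" "finite L"
      for r l and g :: "nat \<Rightarrow> nat \<Rightarrow> rat" and L i
  proof -
    have "(\<Sum>x\<in>L. (\<Sum>k\<in>{k\<in>{1..r}. l k = x}. g k i) * of_nat p powi \<lceil>x * of_nat i\<rceil>) =
       (\<Sum>x\<in>L. \<Sum>k\<in>{k\<in>{1..r}. l k = x}. g k i * of_nat p powi \<lceil>l k * of_nat i\<rceil>)"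
      by (intro sum.cong refl) (simp add: sum_distrib_right)
    also have "\<dots> = (\<Sum>k=1..r. g k i * of_nat p powi \<lceil>l k * of_nat i\<rceil>)"
      using that by (intro sum.group) auto
    finally show ?thesis .
  qed
  have "h (l k) i = 0" for i
  proof (rule exponential_quasi_polys_independent[OF p, of L h "max d d'"])
    show "finite L" by (simp add: L_def)
    show "l k \<in> L" using k by (auto simp: L_def)
    show "\<exists>m q. poly_on_residues m (h x) q" for x
    proof -
      have "\<exists>m q. poly_on_residues m (\<lambda>i. \<Sum>k\<in>{k\<in>{1..r}. l k = x}. g k i) q"
        "\<exists>m q. poly_on_residues m (\<lambda>i. \<Sum>k\<in>{k\<in>{1..r'}. l' k = x}. g' k i) q"
        by (rule poly_on_residues_sum; use S S' in \<open>simp add: sol_decomposition_def\<close>)+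
      from poly_on_residues_add[OF this(1) poly_on_residues_minus[OF this(2)]] show ?thesis
        unfolding h_def .
    qed
    fix i assume i: "max d d' < int i"
    have "(\<Sum>x\<in>L. h x i * of_nat p powi \<lceil>x * of_nat i\<rceil>) =
       (\<Sum>k=1..r. g k i * of_nat p powi \<lceil>l k * of_nat i\<rceil>) - (\<Sum>k=1..r'. g' k i * of_nat p powi \<lceil>l' k * of_nat i\<rceil>)"
    proof -
      have L: "l ` {1..r} \<subseteq> L" "l' ` {1..r'} \<subseteq> L" "finite L" by (auto simp: L_def)
      have "(a + - b) * c = a * c - b * c" for a b c :: rat by (simp add: algebra_simps)
      then show ?thesis
        unfolding h_def by (simp only: sum_subtractf sums[OF L(1,3)] sums[OF L(2,3)])
    qed
    also have "\<dots> = of_nat (num_sols p n f i) - of_nat (num_sols p n f i)"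
      using sol_decompositionD[OF S, of i] sol_decompositionD[OF S', of i] i by simp
    also have "\<dots> = 0" by simp
    finally show "(\<Sum>x\<in>L. h x i * of_nat p powi \<lceil>x * of_nat i\<rceil>) = 0" .
  qed
  moreover have "{k2 \<in> {1..r}. l k2 = l k} = {k}" using inj(1) k by (auto dest: inj_onD)
  ultimately have g: "g k i = (\<Sum>k'\<in>{k'\<in>{1..r'}. l' k' = l k}. g' k' i)" for i
    unfolding h_def by simp
  obtain i0 where "g k i0 \<noteq> 0" using S k unfolding sol_decomposition_def by blast
  with g[of i0] have "{k'\<in>{1..r'}. l' k' = l k} \<noteq> {}" by (metis sum.empty)
  then obtain k' where k': "k' \<in> {1..r'}" "l' k' = l k" by blast
  then have "{k2\<in>{1..r'}. l' k2 = l k} = {k'}"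
    unfolding k'(2)[symmetric] using inj_onD[OF inj(2)] by blast
  with g have "g k = g' k'" by (intro ext) simp
  with k' show ?thesis by auto
qed

lemma sol_decomposition_unique:
  assumes p: "p > 1" and S: "sol_decomposition p n f d r l g" and S': "sol_decomposition p n f d' r' l' g'"
  shows "r' = r \<and> (\<exists>\<pi>. bij_betw \<pi> {1..r} {1..r} \<and> (\<forall>k\<in>{1..r}. l' k = l (\<pi> k) \<and> g' k = g (\<pi> k)))"
proof -
  have inj: "inj_on l {1..r}" "inj_on l' {1..r'}" using S S' by (auto simp: sol_decomposition_def)
  have "\<forall>k\<in>{1..r'}. \<exists>k'\<in>{1..r}. l k' = l' k \<and> g k' = g' k"
    using sol_decomposition_component[OF p S' S] by blast
  then obtain \<pi> where \<pi>: "\<forall>k\<in>{1..r'}. \<pi> k \<in> {1..r} \<and> l (\<pi> k) = l' k \<and> g (\<pi> k) = g' k" by metis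
  have "l ` {1..r} = l' ` {1..r'}"
  proof (intro equalityI subsetI)
    fix x assume "x \<in> l ` {1..r}"
    then show "x \<in> l' ` {1..r'}" using sol_decomposition_component[OF p S S'] by force
  next
    fix x assume "x \<in> l' ` {1..r'}"
    then show "x \<in> l ` {1..r}" using sol_decomposition_component[OF p S' S] by force
  qed
  then have r: "r' = r" using card_image[OF inj(1)] card_image[OF inj(2)] by simp
  have "inj_on \<pi> {1..r}"
  proof (rule inj_onI)
    fix x y assume "x \<in> {1..r}" "y \<in> {1..r}" "\<pi> x = \<pi> y"
    then have "l' x = l' y" using \<pi> r by metis
    then show "x = y" using inj(2) r \<open>x \<in> _\<close> \<open>y \<in> _\<close> by (auto dest: inj_onD)
  qed
  moreover have "\<pi> ` {1..r} \<subseteq> {1..r}" using \<pi> r by auto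
  ultimately have "bij_betw \<pi> {1..r} {1..r}"
    by (simp add: bij_betw_def endo_inj_surj)
  moreover have "\<forall>k\<in>{1..r}. l' k = l (\<pi> k) \<and> g' k = g (\<pi> k)" using \<pi> r by simp
  ultimately show ?thesis using r by blast
qed

section \<open>The denominators and their complex zeros\<close>

abbreviation ceval :: "rat poly \<Rightarrow> complex \<Rightarrow> complex" where
  "ceval q \<equiv> poly (map_poly of_rat q)"

lemma coeff_of_rat_poly: "coeff (map_poly of_rat q :: 'a::field_char_0 poly) i = of_rat (coeff q i)"
  by (simp add: coeff_map_poly)

lemma map_poly_of_rat_mult: "(map_poly of_rat (q * r) :: 'a::field_char_0 poly) = map_poly of_rat q * map_poly of_rat r"
  by (rule poly_eqI) (simp add: coeff_map_poly coeff_mult of_rat_sum of_rat_mult)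

lemma map_poly_of_rat_add: "(map_poly of_rat (q + r) :: 'a::field_char_0 poly) = map_poly of_rat q + map_poly of_rat r"
  by (rule poly_eqI) (simp add: coeff_map_poly of_rat_add)

lemma map_poly_of_rat_diff: "(map_poly of_rat (q - r) :: 'a::field_char_0 poly) = map_poly of_rat q - map_poly of_rat r"
  by (rule poly_eqI) (simp add: coeff_map_poly of_rat_diff)

lemma map_poly_of_rat_1: "(map_poly of_rat 1 :: 'a::field_char_0 poly) = 1"
  by (rule poly_eqI) (simp add: coeff_map_poly)

lemma map_poly_of_rat_monom: "(map_poly of_rat (monom c k) :: 'a::field_char_0 poly) = monom (of_rat c) k"
  by (rule poly_eqI) (simp add: coeff_map_poly)

lemma map_poly_of_rat_eq_0_iff: "(map_poly of_rat q :: 'a::field_char_0 poly) = 0 \<longleftrightarrow> q = 0"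
  by (auto simp: poly_eq_iff coeff_map_poly)

lemma degree_map_poly_of_rat: "degree (map_poly of_rat q :: 'a::field_char_0 poly) = degree q"
  by (rule degree_map_poly) simp

lemma ceval_mult: "ceval (q * r) z = ceval q z * ceval r z"
  by (simp add: map_poly_of_rat_mult)

lemma ceval_add: "ceval (q + r) z = ceval q z + ceval r z"
  by (simp add: map_poly_of_rat_add)

lemma ceval_1: "ceval 1 z = 1"
  by (simp add: map_poly_of_rat_1)

lemma ceval_prod: "ceval (prod q S) z = (\<Prod>k\<in>S. ceval (q k) z)"
  by (induction S rule: infinite_finite_induct) (simp_all add: ceval_1 ceval_mult)

lemma ceval_sum: "ceval (sum q S) z = (\<Sum>k\<in>S. ceval (q k) z)"
  by (induction S rule: infinite_finite_induct) (simp_all add: ceval_add)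

lemma ceval_den_factor: "ceval (den_factor p \<nu> N) z = 1 - z ^ N / of_nat p ^ \<nu>"
  unfolding den_factor_def map_poly_of_rat_diff map_poly_of_rat_1 map_poly_of_rat_monom
  by (simp add: poly_monom of_rat_power of_rat_inverse divide_inverse power_inverse mult.commute)

lemma ceval_den_factor_eq_0_iff:
  assumes "p > 0"
  shows "ceval (den_factor p \<nu> N) z = 0 \<longleftrightarrow> z ^ N = of_nat p ^ \<nu>"
  using assms by (auto simp: ceval_den_factor)

lemma degree_den_factor: "p > 0 \<Longrightarrow> N > 0 \<Longrightarrow> degree (den_factor p \<nu> N) = N"
  unfolding den_factor_def by (rule degree_one_minus_monom) auto

lemma coeff_0_den_factor: "N > 0 \<Longrightarrow> coeff (den_factor p \<nu> N) 0 = 1"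
  by (simp add: den_factor_def)

text \<open>The factor has N distinct complex zeros, while the remainder of B has degree below N; if
  it vanishes at all of them it is 0. This replaces divisibility over the rationals by conditions at
  complex points.\<close>

lemma den_factor_dvd_iff:
  assumes "p > 0" "N > 0"
  shows "den_factor p \<nu> N dvd B \<longleftrightarrow> (\<forall>z. ceval (den_factor p \<nu> N) z = 0 \<longrightarrow> ceval B z = 0)"
proof
  assume "den_factor p \<nu> N dvd B"
  then show "\<forall>z. ceval (den_factor p \<nu> N) z = 0 \<longrightarrow> ceval B z = 0"
    by (auto elim!: dvdE simp: ceval_mult)
next
  assume roots: "\<forall>z. ceval (den_factor p \<nu> N) z = 0 \<longrightarrow> ceval B z = 0"
  define F where "F = den_factor p \<nu> N"
  define r where "r = B mod F"
  have F: "degree F = N" unfolding F_def using assms by (rule degree_den_factor)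
  then have "F \<noteq> 0" using assms by auto
  have B: "B = B div F * F + r" unfolding r_def by (rule div_mult_mod_eq[symmetric])
  have "ceval B z = ceval (B div F) z * ceval F z + ceval r z" for z
    by (subst B) (simp only: ceval_add ceval_mult)
  then have "ceval r z = 0" if "ceval F z = 0" for z using roots that unfolding F_def by simp
  then have r_roots: "{z. z ^ N = of_nat p ^ \<nu>} \<subseteq> {z. ceval r z = 0}"
    using assms by (auto simp: ceval_den_factor_eq_0_iff F_def)
  have "r = 0"
  proof (rule ccontr)
    assume "r \<noteq> 0"
    then have "degree r < N" using degree_mod_less[OF \<open>F \<noteq> 0\<close>, of B] F by (auto simp: r_def)
    have r': "map_poly of_rat r \<noteq> (0 :: complex poly)" using \<open>r \<noteq> 0\<close> by (simp add: map_poly_of_rat_eq_0_iff)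
    have "N = card {z :: complex. z ^ N = of_nat p ^ \<nu>}" using assms by (subst card_nth_roots) auto
    also have "\<dots> \<le> card {z. ceval r z = 0}"
      using r_roots poly_roots_finite[OF r'] by (rule card_mono[rotated])
    also have "\<dots> \<le> degree (map_poly of_rat r :: complex poly)" by (rule card_poly_roots_bound[OF r'])
    also have "\<dots> = degree r" by (rule degree_map_poly_of_rat)
    finally show False using \<open>degree r < N\<close> by simp
  qed
  then show "den_factor p \<nu> N dvd B" by (simp add: r_def F_def dvd_eq_mod_eq_0)
qed

text \<open>$(1 - y^k)/(1 - y)$ for $y = p^{-\nu}t^N$; at a zero of $1 - y$ its value is $k \neq 0$, so the zero is simple.\<close>

definition den_cofactor :: "nat \<Rightarrow> nat \<Rightarrow> nat \<Rightarrow> nat \<Rightarrow> rat poly" where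
  "den_cofactor p \<nu> N k = (\<Sum>i<k. monom (inverse (of_nat p) ^ \<nu>) N ^ i)"

lemma den_factor_mult: "den_factor p (\<nu> * k) (N * k) = den_factor p \<nu> N * den_cofactor p \<nu> N k"
proof -
  have "den_factor p (\<nu> * k) (N * k) = 1 - monom (inverse (of_nat p) ^ \<nu>) N ^ k"
    by (simp add: den_factor_def monom_power power_mult)
  then show ?thesis by (simp add: one_diff_power_eq den_factor_def den_cofactor_def)
qed

lemma den_factor_dvd_mult: "den_factor p \<nu> N dvd den_factor p (\<nu> * k) (N * k)"
  by (simp add: den_factor_mult)

lemma ceval_den_cofactor:
  assumes "ceval (den_factor p \<nu> N) z = 0"
  shows "ceval (den_cofactor p \<nu> N k) z = of_nat k"
proof -
  have "ceval (monom (inverse (of_nat p) ^ \<nu>) N) z = 1"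
    using assms by (simp add: den_factor_def map_poly_of_rat_diff map_poly_of_rat_1)
  moreover have "ceval (q ^ i) z = ceval q z ^ i" for q i
    by (induction i) (simp_all add: ceval_1 ceval_mult)
  ultimately show ?thesis by (simp add: den_cofactor_def ceval_sum)
qed

text \<open>Both factors divide binomials in the same power t^(N*N'), with coefficients c \<noteq>
  c'. Eliminating that power leaves the constant c' - c, and comaximality passes to
  divisors.\<close>

lemma den_factor_comaximal:
  assumes "p > 1" "\<nu> * N' \<noteq> \<nu>' * N"
  shows "comaximal (den_factor p \<nu> N) (den_factor p \<nu>' N')"
proof -
  define c where "c = (inverse (of_nat p) :: rat) ^ (\<nu> * N')"
  define c' where "c' = (inverse (of_nat p) :: rat) ^ (\<nu>' * N)"
  have "c \<noteq> c'"
  proof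
    assume "c = c'"
    then have "(of_nat p :: rat) ^ (\<nu> * N') = of_nat p ^ (\<nu>' * N)"
      by (simp add: c_def c'_def power_inverse)
    then have "\<nu> * N' = \<nu>' * N" using assms(1) by (simp add: power_inject_exp)
    with assms(2) show False by simp
  qed
  define F where "F = den_factor p (\<nu> * N') (N * N')"
  define F' where "F' = den_factor p (\<nu>' * N) (N' * N)"
  have "smult (c' / (c' - c)) 1 * F + smult (- c / (c' - c)) 1 * F' = smult (c' / (c' - c)) F - smult (c / (c' - c)) F'"
    by simp
  also have "\<dots> = 1"
  proof (rule poly_eqI)
    fix i
    show "coeff (smult (c' / (c' - c)) F - smult (c / (c' - c)) F') i = coeff 1 i"
    proof -
      have "c' / (c' - c) * (x - c * y) - c / (c' - c) * (x - c' * y) = x" for x y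
      proof -
        have "c' / (c' - c) * (x - c * y) - c / (c' - c) * (x - c' * y) = ((c' - c) * x) / (c' - c)"
          unfolding times_divide_eq_left diff_divide_distrib[symmetric] by (simp add: algebra_simps)
        then show ?thesis using \<open>c \<noteq> c'\<close> by simp
      qed
      moreover have "coeff F i = coeff 1 i - c * (if i = N * N' then 1 else 0)"
        "coeff F' i = coeff 1 i - c' * (if i = N * N' then 1 else 0)"
        unfolding F_def F'_def den_factor_def coeff_diff coeff_monom c_def c'_def mult.commute[of N' N] by auto
      ultimately show ?thesis by (simp only: coeff_diff coeff_smult)
    qed
  qed
  finally have "comaximal F F'" by (rule comaximalI)
  then show ?thesis
    by (rule comaximal_dvd) (simp_all add: F_def F'_def den_factor_dvd_mult)
qed

text \<open>All zeros of the factors of one ratio lie on one circle, and different ratios give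
  different circles; under t = p^(-s) these correspond to the vertical lines.\<close>

lemma norm_root_den_factor:
  assumes "p > 0" "N > 0" "ceval (den_factor p \<nu> N) z = 0"
  shows "norm z = real p powr (real \<nu> / real N)"
proof -
  have "z ^ N = of_nat p ^ \<nu>" using assms by (simp add: ceval_den_factor_eq_0_iff)
  then have "norm z ^ N = real p ^ \<nu>" by (metis norm_of_nat norm_power)
  also have "\<dots> = (real p powr (real \<nu> / real N)) ^ N"
    using assms by (simp add: powr_realpow[symmetric] powr_powr)
  finally show ?thesis by (rule power_eq_imp_eq_base) (use assms in auto)
qed

section \<open>Arithmetic and series expansion of a single ratio class\<close>

lemma ex_common_ratio:
  fixes \<nu> N :: "'j \<Rightarrow> nat"
  assumes "K \<noteq> {}" "\<And>j. j \<in> K \<Longrightarrow> \<nu> j > 0 \<and> N j > 0"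
    and "\<And>i j. i \<in> K \<Longrightarrow> j \<in> K \<Longrightarrow> \<nu> i * N j = \<nu> j * N i"
  shows "\<exists>u v c. u > 0 \<and> v > 0 \<and> (\<forall>j\<in>K. c j > 0 \<and> \<nu> j = u * c j \<and> N j = v * c j)"
proof -
  obtain j0 where j0: "j0 \<in> K" using assms(1) by blast
  define d where "d = gcd (\<nu> j0) (N j0)"
  define u where "u = \<nu> j0 div d"
  define v where "v = N j0 div d"
  have d: "d > 0" "\<nu> j0 = u * d" "N j0 = v * d" using assms(2)[OF j0] by (auto simp: d_def u_def v_def)
  have uv: "u > 0" "v > 0" using d assms(2)[OF j0] by (metis mult_0 neq0_conv)+
  have cop: "coprime u v" unfolding u_def v_def d_def using assms(2)[OF j0] by (intro div_gcd_coprime) auto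
  have "\<exists>c>0. \<nu> j = u * c \<and> N j = v * c" if j: "j \<in> K" for j
  proof -
    have "u * d * N j = \<nu> j * (v * d)" using assms(3)[OF j0 j] d by simp
    then have eq: "u * N j = \<nu> j * v" using d(1) by (simp add: mult_ac)
    then have "v dvd u * N j" by simp
    then have "v dvd N j" using cop by (simp add: coprime_dvd_mult_right_iff coprime_commute)
    then obtain c where c: "N j = v * c" by blast
    with eq have "\<nu> j = u * c" using uv by (simp add: mult_ac)
    moreover have "c > 0" using c assms(2)[OF j] by (metis mult_0_right neq0_conv)
    ultimately show ?thesis using c by blast
  qed
  then obtain c where "\<forall>j\<in>K. c j > 0 \<and> \<nu> j = u * c j \<and> N j = v * c j" by metis
  with uv show ?thesis by blast
qed

text \<open>The exponents k with w^k = 1 are closed under gcd by Bezout; the empty set gives Gcd 0,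
  and w^0 = 1.\<close>

lemma power_Gcd_eq_1:
  fixes w :: "'a::field"
  assumes "finite S" "\<And>k. k \<in> S \<Longrightarrow> w ^ k = 1"
  shows "w ^ Gcd S = 1"
  using assms
proof (induction S rule: finite_induct)
  case (insert x S)
  show ?case
  proof (cases "x = 0")
    case True
    then show ?thesis using insert by simp
  next
    case False
    from bezout_nat[OF this, of "Gcd S"] obtain y z where yz: "x * y = Gcd S * z + gcd x (Gcd S)" by blast
    have "w ^ (x * y) = 1" "w ^ (Gcd S * z) = 1" using insert by (simp_all add: power_mult)
    then have "w ^ gcd x (Gcd S) = 1" unfolding yz by (simp add: power_add)
    then show ?thesis by simp
  qed
qed simp

lemma ceiling_sub_ratio_mult:
  assumes "b > 0"
  shows "\<lceil>(of_nat n - of_nat a / of_nat b) * of_nat i :: rat\<rceil> = int (n * i) - int ((a * i) div b)"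
proof -
  have "(of_nat n - of_nat a / of_nat b) * of_nat i = (of_int (int (n * i)) - of_nat (a * i) / of_nat b :: rat)"
    by (simp add: algebra_simps)
  also have "\<lceil>\<dots>\<rceil> = int (n * i) - \<lfloor>of_nat (a * i) / of_nat b :: rat\<rfloor>"
    by linarith
  finally show ?thesis by (simp only: floor_divide_of_nat_eq)
qed

text \<open>Writing i = b*q + x, the floor of a*i/b is a*q plus that of a*x/b. The discrepancy
  between p^(n*i - a*q) and the power with the ceiling is therefore constant on each residue
  class.\<close>

lemma power_int_ceiling_sub_ratio_mult:
  fixes p a b n i :: nat
  assumes "p > 0" "b > 0"
  shows "of_nat p ^ (n * i) * (inverse (of_nat p) ^ a) ^ (i div b) =
    of_nat p ^ ((a * (i mod b)) div b) * (of_nat p powi \<lceil>(of_nat n - of_nat a / of_nat b) * of_nat i :: rat\<rceil> :: rat)"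
proof -
  have "a * i = b * (a * (i div b)) + a * (i mod b)"
    by (metis add_mult_distrib2 mult.left_commute mult_div_mod_eq)
  then have "(a * i) div b = (a * (i mod b)) div b + a * (i div b)"
    using assms(2) by (metis add.commute div_mult_self2 less_irrefl)
  then have "(of_nat p :: rat) ^ ((a * i) div b) = of_nat p ^ ((a * (i mod b)) div b) * of_nat p ^ (a * (i div b))"
    by (simp add: power_add)
  moreover have "(of_nat p powi \<lceil>(of_nat n - of_nat a / of_nat b) * of_nat i :: rat\<rceil> :: rat) =
      of_nat p ^ (n * i) / of_nat p ^ ((a * i) div b)"
    unfolding ceiling_sub_ratio_mult[OF assms(2)] using assms(1)
    by (simp add: power_int_diff del: of_nat_mult)
  ultimately show ?thesis using assms(1) by (simp add: field_simps power_inverse power_mult[symmetric])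
qed

definition ratio_class :: "nat set \<Rightarrow> (nat \<Rightarrow> nat) \<Rightarrow> (nat \<Rightarrow> nat) \<Rightarrow> bool" where
  "ratio_class K \<nu> N \<longleftrightarrow> finite K \<and> K \<noteq> {} \<and> (\<forall>j\<in>K. \<nu> j > 0 \<and> N j > 0) \<and>
     (\<forall>i\<in>K. \<forall>j\<in>K. \<nu> i * N j = \<nu> j * N i)"

text \<open>u/v is the common ratio. Lcm and Gcd commute with scaling, so the two Lcms and the two
  Gcds stand in the same ratio as every pair \<nu> j, N j.\<close>

lemma ratio_class_Lcm_Gcd:
  assumes "ratio_class K \<nu> N"
  obtains u v c where "u > 0" "v > 0" "\<And>j. j \<in> K \<Longrightarrow> c j > 0" "\<And>j. j \<in> K \<Longrightarrow> \<nu> j = u * c j"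
    "\<And>j. j \<in> K \<Longrightarrow> N j = v * c j"
    "Lcm (\<nu> ` K) = u * Lcm (c ` K)" "Lcm (N ` K) = v * Lcm (c ` K)"
    "Gcd (\<nu> ` K) = u * Gcd (c ` K)" "Gcd (N ` K) = v * Gcd (c ` K)"
    "Lcm (c ` K) > 0" "Gcd (c ` K) > 0"
proof -
  have K: "finite K" "K \<noteq> {}" using assms by (auto simp: ratio_class_def)
  obtain u v c where uvc: "u > 0" "v > 0" "\<forall>j\<in>K. c j > 0 \<and> \<nu> j = u * c j \<and> N j = v * c j"
    using ex_common_ratio[of K \<nu> N] assms by (auto simp: ratio_class_def)
  then have im: "\<nu> ` K = (*) u ` (c ` K)" "N ` K = (*) v ` (c ` K)" by (force simp: image_image)+
  have "Lcm (c ` K) \<noteq> 0" using K uvc(3) by (subst Lcm_0_iff) auto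
  moreover have "Gcd (c ` K) \<noteq> 0" using K uvc(3) by (force simp: Gcd_0_iff)
  ultimately have "Lcm (c ` K) > 0" "Gcd (c ` K) > 0" by blast+
  moreover have "Lcm (\<nu> ` K) = u * Lcm (c ` K)" "Lcm (N ` K) = v * Lcm (c ` K)"
    "Gcd (\<nu> ` K) = u * Gcd (c ` K)" "Gcd (N ` K) = v * Gcd (c ` K)"
    unfolding im using K by (simp_all add: Lcm_mult Gcd_mult)
  ultimately show thesis using that[of u v c] uvc by blast
qed

lemma ratio_class_Lcm_ratio:
  assumes "ratio_class K \<nu> N" "j \<in> K"
  shows "Lcm (\<nu> ` K) > 0" "Lcm (N ` K) > 0" "Lcm (\<nu> ` K) * N j = \<nu> j * Lcm (N ` K)"
  using assms(2) by (rule_tac[!] ratio_class_Lcm_Gcd[OF assms(1)]) simp_all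

lemma coeff_0_den: "(\<And>j. j \<in> K \<Longrightarrow> N j > 0) \<Longrightarrow> coeff (den p K \<nu> N) 0 = 1"
  unfolding den_def by (simp add: poly_0_coeff_0[symmetric] poly_prod) (simp add: poly_0_coeff_0 coeff_0_den_factor)

lemma degree_den:
  assumes "p > 0" "\<And>j. j \<in> K \<Longrightarrow> N j > 0"
  shows "degree (den p K \<nu> N) = (\<Sum>j\<in>K. N j)"
proof -
  have "degree (den_factor p (\<nu> j) (N j)) = N j" if "j \<in> K" for j
    using assms(1) assms(2)[OF that] by (rule degree_den_factor)
  moreover have "den_factor p (\<nu> j) (N j) \<noteq> 0" if "j \<in> K" for j
    using coeff_0_den_factor[OF assms(2)[OF that], of p "\<nu> j"] by auto
  ultimately show ?thesis unfolding den_def by (subst degree_prod_eq_sum_degree) auto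
qed

text \<open>The cofactors complete each factor of D to E = 1 - p^(-a) t^b, so A/D = A*R/E^m, and the
  coefficients of degree m - 1 are those of A*R mod E up to nonzero factors. E has distinct zeros,
  and at a zero of E the product R is nonzero exactly when all factors of D vanish there. So the
  remainder is 0 iff A vanishes at the common zeros of these factors.\<close>

lemma ratio_class_coeffs:
  fixes A :: "rat poly"
  assumes p: "p > 1" and K: "ratio_class K \<nu> N" and A: "degree A < degree (den p K \<nu> N)"
  defines "a \<equiv> Lcm (\<nu> ` K)" and "b \<equiv> Lcm (N ` K)" and "m \<equiv> card K"
  shows "\<exists>q. (\<forall>x. degree (q x) \<le> m - 1) \<and>
    (\<forall>i. of_nat p ^ (n * i) * fps_nth (fps_of_poly A / fps_of_poly (den p K \<nu> N)) i =
       poly (q (i mod b)) (of_nat i) * of_nat p powi \<lceil>(of_nat n - of_nat a / of_nat b) * of_nat i :: rat\<rceil>) \<and>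
    ((\<exists>x<b. coeff (q x) (m - 1) \<noteq> 0) \<longleftrightarrow> \<not> den_factor p (Gcd (\<nu> ` K)) (Gcd (N ` K)) dvd A)"
proof -
  obtain u v c where uvc: "u > 0" "v > 0" "\<And>j. j \<in> K \<Longrightarrow> c j > 0" "\<And>j. j \<in> K \<Longrightarrow> \<nu> j = u * c j"
    "\<And>j. j \<in> K \<Longrightarrow> N j = v * c j"
    and LG: "Lcm (\<nu> ` K) = u * Lcm (c ` K)" "Lcm (N ` K) = v * Lcm (c ` K)"
    "Gcd (\<nu> ` K) = u * Gcd (c ` K)" "Gcd (N ` K) = v * Gcd (c ` K)"
    "Lcm (c ` K) > 0" "Gcd (c ` K) > 0" using ratio_class_Lcm_Gcd[OF K] by metis
  have finK: "finite K" "K \<noteq> {}" and pos: "\<And>j. j \<in> K \<Longrightarrow> N j > 0" using K by (auto simp: ratio_class_def)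
  have p0: "p > 0" using p by simp
  define L where "L = Lcm (c ` K)"
  define G where "G = Gcd (c ` K)"
  define k where "k = (\<lambda>j. L div c j)"
  have k: "c j * k j = L" if "j \<in> K" for j using that by (simp add: k_def L_def)
  have k0: "k j > 0" if "j \<in> K" for j using k[OF that] LG(5) by (metis L_def mult_0_right neq0_conv)
  have ab: "a = u * L" "b = v * L" using LG by (simp_all add: a_def b_def L_def)
  have b0: "b > 0" using ab uvc LG by (simp add: L_def)
  define E where "E = den_factor p a b"
  define T where "T = (\<lambda>j. den_cofactor p (\<nu> j) (N j) (k j))"
  define D where "D = den p K \<nu> N"
  define R where "R = prod T K"
  define Gf where "Gf = den_factor p (u * G) (v * G)"
  have ET: "den_factor p (\<nu> j) (N j) * T j = E" if "j \<in> K" for j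
  proof -
    have "a = \<nu> j * k j" "b = N j * k j" using uvc(4,5)[OF that] k[OF that] ab by (simp_all add: mult.assoc)
    then show ?thesis unfolding T_def E_def by (simp add: den_factor_mult)
  qed
  have DR: "D * R = E ^ m"
    unfolding D_def den_def R_def m_def prod.distrib[symmetric] using ET by simp
  have E0: "coeff E 0 = 1" unfolding E_def using b0 by (rule coeff_0_den_factor)
  have D0: "coeff D 0 = 1" unfolding D_def using pos by (rule coeff_0_den)
  have Edeg: "degree E = b" unfolding E_def using p0 b0 by (rule degree_den_factor)
  have m: "m = Suc (m - 1)" using finK by (simp add: m_def card_gt_0_iff)
  have quot: "fps_of_poly (A * R) / fps_of_poly E ^ m = fps_of_poly A / fps_of_poly D"
  proof (rule fps_divide_eqI)
    have "fps_of_poly A / fps_of_poly D * fps_of_poly D = fps_of_poly A"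
      using D0 by (intro fps_divide_times_unit) simp
    moreover have "fps_of_poly E ^ m = fps_of_poly D * fps_of_poly R"
      unfolding fps_of_poly_power[symmetric] DR[symmetric] by (rule fps_of_poly_mult)
    ultimately show "fps_of_poly A / fps_of_poly D * fps_of_poly E ^ m = fps_of_poly (A * R)"
      by (simp only: fps_of_poly_mult mult.assoc[symmetric])
  qed (use E0 in simp)
  have degAR: "degree (A * R) < b * Suc (m - 1)"
  proof -
    have "E \<noteq> 0" using E0 by auto
    then have "D \<noteq> 0" "R \<noteq> 0" using DR by (metis mult_zero_left mult_zero_right power_not_zero)+
    then have "degree D + degree R = degree (E ^ m)" by (simp add: DR[symmetric] degree_mult_eq)
    also have "\<dots> = b * m" using \<open>E \<noteq> 0\<close> by (simp add: degree_power_eq Edeg mult.commute)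
    finally show ?thesis using m A degree_mult_le[of A R] unfolding D_def[symmetric] by simp
  qed
  have ip: "inverse (of_nat p :: rat) ^ a \<noteq> 0" using p0 by simp
  obtain q where q: "\<And>x. degree (q x) \<le> m - 1"
    "\<And>i. fps_nth (fps_of_poly (A * R) / fps_of_poly E ^ m) i = (inverse (of_nat p) ^ a) ^ (i div b) * poly (q (i mod b)) (of_nat i)"
    "\<And>x. x < b \<Longrightarrow> coeff (q x) (m - 1) = coeff (A * R mod E) x / (of_nat b ^ (m - 1) * fact (m - 1))"
    using coeff_divide_one_minus_monom_power[OF b0 ip degAR, folded m den_factor_def, folded E_def] by metis
  \<comment> \<open>The power of p supplied by \<open>power_int_ceiling_sub_ratio_mult\<close> is
    constant on the class of x and joins the polynomial.\<close>
  define q' where "q' = (\<lambda>x. smult (of_nat p ^ ((a * x) div b)) (q x))"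
  have "degree (q' x) \<le> m - 1" for x unfolding q'_def using q(1)[of x] degree_smult_le order_trans by blast
  moreover have "of_nat p ^ (n * i) * fps_nth (fps_of_poly A / fps_of_poly D) i =
       poly (q' (i mod b)) (of_nat i) * of_nat p powi \<lceil>(of_nat n - of_nat a / of_nat b) * of_nat i :: rat\<rceil>" for i
  proof -
    have "of_nat p ^ (n * i) * fps_nth (fps_of_poly A / fps_of_poly D) i =
        (of_nat p ^ (n * i) * (inverse (of_nat p) ^ a) ^ (i div b)) * poly (q (i mod b)) (of_nat i)"
      unfolding quot[symmetric] q(2) by (simp only: mult.assoc)
    then show ?thesis
      unfolding power_int_ceiling_sub_ratio_mult[OF p0 b0] q'_def by (simp only: poly_smult mult_ac)
  qed
  moreover have "(\<exists>x<b. coeff (q' x) (m - 1) \<noteq> 0) \<longleftrightarrow> \<not> Gf dvd A"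
  proof -
    have "(\<exists>x<b. coeff (q' x) (m - 1) \<noteq> 0) \<longleftrightarrow> (\<exists>x<b. coeff (A * R mod E) x \<noteq> 0)"
      using q(3) p0 b0 by (auto simp: q'_def)
    also have "\<dots> \<longleftrightarrow> A * R mod E \<noteq> 0"
    proof -
      have "degree (A * R mod E) < b" if "A * R mod E \<noteq> 0"
        using degree_mod_less[of E "A * R"] Edeg b0 that by fastforce
      then show ?thesis by (metis coeff_0 leading_coeff_0_iff)
    qed
    also have "\<dots> \<longleftrightarrow> \<not> E dvd A * R" by (simp only: dvd_eq_mod_eq_0)
    also have "E dvd A * R \<longleftrightarrow> Gf dvd A"
    proof -
      obtain j0 where "j0 \<in> K" using finK(2) by blast
      then have "G dvd c j0" "c j0 dvd L" unfolding L_def G_def by auto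
      then have "G dvd L" by (rule dvd_trans)
      then obtain e where e: "L = G * e" by (rule dvdE)
      have "E = Gf * den_cofactor p (u * G) (v * G) e"
        unfolding E_def Gf_def using den_factor_mult[of p "u * G" e "v * G"] ab e by (simp only: mult.assoc)
      then have GE: "ceval E z = 0" if "ceval Gf z = 0" for z
        using that by (simp only: ceval_mult mult_zero_left)
      have Gj: "ceval (den_factor p (\<nu> j) (N j)) z = 0" if "ceval Gf z = 0" "j \<in> K" for z j
      proof -
        have "G dvd c j" using that(2) unfolding G_def by auto
        then obtain e where e: "c j = G * e" by (rule dvdE)
        have "den_factor p (\<nu> j) (N j) = Gf * den_cofactor p (u * G) (v * G) e"
          unfolding uvc(4,5)[OF that(2)] Gf_def using den_factor_mult[of p "u * G" e "v * G"] e by (simp only: mult.assoc)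
        then show ?thesis using that(1) by (simp only: ceval_mult mult_zero_left)
      qed
      have R: "ceval R z \<noteq> 0 \<longleftrightarrow> (\<forall>j\<in>K. ceval (T j) z \<noteq> 0)" for z
        unfolding R_def ceval_prod using finK by (simp add: prod_zero_iff)
      have G_pos: "v * G > 0" using uvc LG by (simp add: G_def)
      show ?thesis
      proof
        assume "E dvd A * R"
        then have *: "ceval A z * ceval R z = 0" if "ceval E z = 0" for z
          using that unfolding E_def den_factor_dvd_iff[OF p0 b0] ceval_mult by blast
        show "Gf dvd A"
          unfolding Gf_def den_factor_dvd_iff[OF p0 G_pos]
        proof (intro allI impI)
          fix z assume "ceval (den_factor p (u * G) (v * G)) z = 0"
          then have z: "ceval Gf z = 0" by (simp add: Gf_def)
          \<comment> \<open>At a common zero of the factors the cofactor of j takes the value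
            \<open>k j\<close>, which is positive.\<close>
          have "ceval (T j) z \<noteq> 0" if "j \<in> K" for j
            using ceval_den_cofactor[OF Gj[OF z that], of "k j"] k0[OF that] by (simp add: T_def)
          then show "ceval A z = 0" using *[OF GE[OF z]] R[of z] by simp
        qed
      next
        assume "Gf dvd A"
        then have *: "ceval A z = 0" if "ceval Gf z = 0" for z
          using that unfolding Gf_def den_factor_dvd_iff[OF p0 G_pos] by blast
        show "E dvd A * R"
          unfolding E_def den_factor_dvd_iff[OF p0 b0] ceval_mult
        proof (intro allI impI)
          fix z assume "ceval (den_factor p a b) z = 0"
          then have z: "ceval E z = 0" by (simp add: E_def)
          show "ceval A z * ceval R z = 0"
          proof (cases "ceval R z = 0")
            case False
            \<comment> \<open>The j-th factor at z equals 1 - w^(c j). If all of them vanish then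
              w^G = 1, which says that z is a zero of \<open>Gf\<close>.\<close>
            define w where "w = z ^ v / of_nat p ^ u"
            have "w ^ c j = 1" if "j \<in> K" for j
            proof -
              have "ceval (den_factor p (\<nu> j) (N j)) z = 0"
                using z R[of z] False that ceval_mult[of "den_factor p (\<nu> j) (N j)" "T j" z] ET[OF that] by auto
              then have "z ^ (v * c j) = of_nat p ^ (u * c j)"
                using p0 uvc(4,5)[OF that] by (simp add: ceval_den_factor_eq_0_iff)
              then show ?thesis using p0 by (simp add: w_def power_divide power_mult)
            qed
            then have "w ^ G = 1" unfolding G_def using finK by (intro power_Gcd_eq_1) auto
            then have "z ^ (v * G) = of_nat p ^ (u * G)"
              using p0 by (simp add: w_def power_divide power_mult)
            then have "ceval Gf z = 0" unfolding Gf_def using p0 by (simp add: ceval_den_factor_eq_0_iff)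
            then show ?thesis using * by simp
          qed simp
        qed
      qed
    qed
    finally show ?thesis .
  qed
  ultimately show ?thesis unfolding D_def Gf_def G_def LG(3,4) by blast
qed

section \<open>The canonical decomposition\<close>

lemma equiv_ratio_rel: "equiv J (ratio_rel J \<nu> N)"
  by (rule equivI) (auto simp: ratio_rel_def refl_on_def sym_def trans_def)

lemma ratio_rel_iff:
  assumes "N i > 0" "N j > 0"
  shows "(i, j) \<in> ratio_rel J \<nu> N \<longleftrightarrow> i \<in> J \<and> j \<in> J \<and> \<nu> i * N j = \<nu> j * N i"
proof -
  have "(of_nat (\<nu> i) / of_nat (N i) :: rat) = of_nat (\<nu> j) / of_nat (N j) \<longleftrightarrow>
     (of_nat (\<nu> i) * of_nat (N j) :: rat) = of_nat (\<nu> j) * of_nat (N i)"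
    using assms by (intro frac_eq_eq) auto
  also have "\<dots> \<longleftrightarrow> \<nu> i * N j = \<nu> j * N i" by (metis of_nat_eq_iff of_nat_mult)
  finally show ?thesis by (auto simp: ratio_rel_def)
qed

section \<open>Ratio classes of a representation and their partial fractions\<close>

context
  fixes p n :: nat and f :: intpoly and J :: "nat set" and \<nu> N :: "nat \<Rightarrow> nat" and B :: "rat poly"
  assumes p: "prime p" and rep: "igusa_rep p n f J \<nu> N B"
begin

lemma igusa_rep_pos: "j \<in> J \<Longrightarrow> \<nu> j > 0" "j \<in> J \<Longrightarrow> N j > 0"
  and igusa_rep_finite: "finite J"
  using rep by (auto simp: igusa_rep_def)

lemma finite_classes: "finite (J // ratio_rel J \<nu> N)"
  using igusa_rep_finite by (rule finite_quotient) (auto simp: ratio_rel_def)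

lemma class_subset: "K \<in> J // ratio_rel J \<nu> N \<Longrightarrow> K \<subseteq> J"
  using equiv_ratio_rel by (rule in_quotient_imp_subset)

lemma class_ratio_class:
  assumes "K \<in> J // ratio_rel J \<nu> N"
  shows "ratio_class K \<nu> N"
proof -
  have K: "K \<subseteq> J" by (rule class_subset[OF assms])
  have "\<nu> i * N j = \<nu> j * N i" if "i \<in> K" "j \<in> K" for i j
  proof -
    have "(i, j) \<in> ratio_rel J \<nu> N"
      using quotient_eq_iff[OF equiv_ratio_rel assms assms that] by simp
    moreover have "N i > 0" "N j > 0" using K that igusa_rep_pos by auto
    ultimately show ?thesis by (simp add: ratio_rel_iff)
  qed
  moreover have "K \<noteq> {}" using in_quotient_imp_non_empty[OF equiv_ratio_rel assms] .
  ultimately show ?thesis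
    unfolding ratio_class_def using K igusa_rep_pos finite_subset[OF K igusa_rep_finite] by auto
qed

lemma classes_ratio_neq:
  assumes "K \<in> J // ratio_rel J \<nu> N" "K' \<in> J // ratio_rel J \<nu> N" "K \<noteq> K'" "i \<in> K" "j \<in> K'"
  shows "\<nu> i * N j \<noteq> \<nu> j * N i"
proof
  assume "\<nu> i * N j = \<nu> j * N i"
  moreover have ij: "i \<in> J" "j \<in> J" using assms class_subset by blast+
  ultimately have "(i, j) \<in> ratio_rel J \<nu> N" using igusa_rep_pos ratio_rel_iff[of N i j] by blast
  then have "K = K'" using quotient_eq_iff[OF equiv_ratio_rel assms(1,2,4,5)] by blast
  with assms(3) show False by simp
qed

lemma comaximal_den_classes:
  assumes "K \<in> J // ratio_rel J \<nu> N" "K' \<in> J // ratio_rel J \<nu> N" "K \<noteq> K'"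
  shows "comaximal (den p K \<nu> N) (den p K' \<nu> N)"
  unfolding den_def
proof (rule comaximal_prod)
  fix j assume j: "j \<in> K'"
  show "comaximal (\<Prod>j\<in>K. den_factor p (\<nu> j) (N j)) (den_factor p (\<nu> j) (N j))"
  proof (rule comaximal_sym, rule comaximal_prod)
    fix i assume i: "i \<in> K"
    show "comaximal (den_factor p (\<nu> j) (N j)) (den_factor p (\<nu> i) (N i))"
      using classes_ratio_neq[OF assms i j] by (intro den_factor_comaximal[OF prime_gt_1_nat[OF p]]) auto
  qed
qed

lemma den_eq_prod_classes: "den p J \<nu> N = (\<Prod>K\<in>J // ratio_rel J \<nu> N. den p K \<nu> N)"
proof -
  have U: "\<Union> (J // ratio_rel J \<nu> N) = J" by (rule Union_quotient[OF equiv_ratio_rel])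
  have "finite A" if "A \<in> J // ratio_rel J \<nu> N" for A
    using finite_subset[OF class_subset[OF that] igusa_rep_finite] .
  moreover have "A \<inter> A' = {}" if "A \<in> J // ratio_rel J \<nu> N" "A' \<in> J // ratio_rel J \<nu> N" "A \<noteq> A'" for A A'
    using quotient_disj[OF equiv_ratio_rel that(1,2)] that(3) by blast
  ultimately have "prod (\<lambda>j. den_factor p (\<nu> j) (N j)) (\<Union> (J // ratio_rel J \<nu> N)) =
      (\<Prod>K\<in>J // ratio_rel J \<nu> N. \<Prod>j\<in>K. den_factor p (\<nu> j) (N j))"
    by (subst prod.Union_disjoint) auto
  then show ?thesis unfolding U den_def .
qed

lemma degree_den_class:
  assumes "K \<in> J // ratio_rel J \<nu> N"
  shows "degree (den p K \<nu> N) > 0"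
proof -
  have "ratio_class K \<nu> N" by (rule class_ratio_class[OF assms])
  then obtain j where "j \<in> K" "finite K" "\<And>j. j \<in> K \<Longrightarrow> N j > 0" unfolding ratio_class_def by blast
  then show ?thesis
    using prime_gt_1_nat[OF p] by (subst degree_den) (auto intro!: sum_pos)
qed

lemma coeff_0_den_class:
  assumes "K \<in> J // ratio_rel J \<nu> N"
  shows "coeff (den p K \<nu> N) 0 = 1"
  using class_subset[OF assms] igusa_rep_pos by (intro coeff_0_den) auto

definition class_partial_fractions :: "rat poly \<Rightarrow> (nat set \<Rightarrow> rat poly) \<Rightarrow> bool" where
  "class_partial_fractions Q A \<longleftrightarrow>
     B = Q * (\<Prod>K\<in>J // ratio_rel J \<nu> N. den p K \<nu> N) +
       (\<Sum>K\<in>J // ratio_rel J \<nu> N. A K * (\<Prod>K'\<in>J // ratio_rel J \<nu> N - {K}. den p K' \<nu> N)) \<and>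
     (\<forall>K\<in>J // ratio_rel J \<nu> N. degree (A K) < degree (den p K \<nu> N))"

lemma ex_class_partial_fractions: "\<exists>Q A. class_partial_fractions Q A"
  unfolding class_partial_fractions_def
  by (intro partial_fractions finite_classes degree_den_class comaximal_den_classes)

definition class_series :: "(nat set \<Rightarrow> rat poly) \<Rightarrow> nat set \<Rightarrow> rat fps" where
  "class_series A K = fps_of_poly (A K) / fps_of_poly (den p K \<nu> N)"

lemma num_sols_eq_class_series:
  assumes QA: "class_partial_fractions Q A" and i: "rat_fun_degree B (den p J \<nu> N) < int i"
  shows "of_nat (num_sols p n f i) = (\<Sum>K\<in>J // ratio_rel J \<nu> N. of_nat p ^ (n * i) * fps_nth (class_series A K) i)"
proof -
  let ?V = "J // ratio_rel J \<nu> N"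
  have "poincare_series p n f = fps_of_poly Q + (\<Sum>K\<in>?V. class_series A K)"
    unfolding class_series_def using rep QA finite_classes coeff_0_den_class den_eq_prod_classes
    by (subst partial_fractions_fps[symmetric]) (auto simp: igusa_rep_def class_partial_fractions_def)
  moreover have "coeff Q i = 0"
  proof (cases "Q = 0")
    case False
    have "degree Q + degree (\<Prod>K\<in>?V. den p K \<nu> N) \<le> degree B"
      using QA False finite_classes unfolding class_partial_fractions_def
      by (intro partial_fractions_degree) auto
    then have "degree Q < i" using i unfolding rat_fun_degree_def den_eq_prod_classes by linarith
    then show ?thesis by (rule coeff_eq_0)
  qed simp
  ultimately have "of_nat (num_sols p n f i) * inverse (of_nat p ^ n) ^ i = (\<Sum>K\<in>?V. fps_nth (class_series A K) i)"
    by (simp add: poincare_series_def fps_eq_iff fps_sum_nth)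
  moreover have "of_nat (num_sols p n f i) = of_nat p ^ (n * i) * (of_nat (num_sols p n f i) * inverse (of_nat p ^ n) ^ i :: rat)"
    using prime_gt_1_nat[OF p] by (simp add: power_mult power_inverse)
  ultimately show ?thesis by (simp only: sum_distrib_left)
qed

text \<open>Modulo F every term of the cleared identity except that of K vanishes, as it contains
  \<open>den p K \<nu> N\<close>. The cofactor in the term of K consists of denominators of other
  classes, hence is comaximal to F and can be cancelled. This moves conditions on B to
  \<open>A K\<close>.\<close>

lemma class_numerator_dvd_iff:
  assumes QA: "class_partial_fractions Q A" and K: "K \<in> J // ratio_rel J \<nu> N" and F: "F dvd den p K \<nu> N"
  shows "F dvd B \<longleftrightarrow> F dvd A K"
proof -
  let ?V = "J // ratio_rel J \<nu> N"
  let ?D = "\<lambda>K. den p K \<nu> N"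
  have split: "prod ?D ?V = ?D K * prod ?D (?V - {K})"
    using finite_classes K by (rule prod.remove)
  have "F dvd A L * prod ?D (?V - {L})" if "L \<in> ?V - {K}" for L
  proof -
    have "?D K dvd prod ?D (?V - {L})" using that K finite_classes by (intro dvd_prodI) auto
    with F have "F dvd prod ?D (?V - {L})" by (rule dvd_trans)
    then show ?thesis by (rule dvd_mult)
  qed
  then have "F dvd (\<Sum>L\<in>?V - {K}. A L * prod ?D (?V - {L}))" by (rule dvd_sum)
  moreover have "F dvd Q * prod ?D ?V" unfolding split using F by (intro dvd_mult dvd_mult2)
  ultimately have "F dvd Q * prod ?D ?V + (\<Sum>L\<in>?V - {K}. A L * prod ?D (?V - {L}))" by (rule dvd_add[rotated])
  moreover have "B = A K * prod ?D (?V - {K}) + (Q * prod ?D ?V + (\<Sum>L\<in>?V - {K}. A L * prod ?D (?V - {L})))"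
  proof -
    have "B = Q * prod ?D ?V + (\<Sum>L\<in>?V. A L * prod ?D (?V - {L}))"
      using QA unfolding class_partial_fractions_def by (rule conjunct1)
    also have "(\<Sum>L\<in>?V. A L * prod ?D (?V - {L})) =
        A K * prod ?D (?V - {K}) + (\<Sum>L\<in>?V - {K}. A L * prod ?D (?V - {L}))"
      by (rule sum.remove[OF finite_classes K])
    finally show ?thesis by (simp only: add.left_commute)
  qed
  ultimately have "F dvd B \<longleftrightarrow> F dvd A K * prod ?D (?V - {K})" by (simp only: dvd_add_left_iff)
  also have "\<dots> \<longleftrightarrow> F dvd A K"
  proof (rule comaximal_dvd_mult_iff)
    have "comaximal (?D K) (prod ?D (?V - {K}))"
      using K by (intro comaximal_prod comaximal_den_classes) auto
    then show "comaximal F (prod ?D (?V - {K}))" using F dvd_refl by (rule comaximal_dvd)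
  qed
  finally show ?thesis .
qed

lemma den_factor_dvd_den_class:
  assumes "K \<in> J // ratio_rel J \<nu> N" "j \<in> K"
  shows "den_factor p (\<nu> j) (N j) dvd den p K \<nu> N"
  unfolding den_def using finite_subset[OF class_subset[OF assms(1)] igusa_rep_finite] assms(2) by (rule dvd_prodI)

lemma Gcd_den_factor_dvd_den_class:
  assumes "K \<in> J // ratio_rel J \<nu> N"
  shows "den_factor p (Gcd (\<nu> ` K)) (Gcd (N ` K)) dvd den p K \<nu> N"
proof -
  obtain u v c where uvc: "\<And>j. j \<in> K \<Longrightarrow> \<nu> j = u * c j" "\<And>j. j \<in> K \<Longrightarrow> N j = v * c j"
    "Gcd (\<nu> ` K) = u * Gcd (c ` K)" "Gcd (N ` K) = v * Gcd (c ` K)"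
    using ratio_class_Lcm_Gcd[OF class_ratio_class[OF assms]] by metis
  obtain j where j: "j \<in> K" using class_ratio_class[OF assms] by (auto simp: ratio_class_def)
  then have "Gcd (c ` K) dvd c j" by auto
  then obtain e where "c j = Gcd (c ` K) * e" by (rule dvdE)
  then have "den_factor p (\<nu> j) (N j) = den_factor p (u * Gcd (c ` K) * e) (v * Gcd (c ` K) * e)"
    using uvc(1,2)[OF j] by (metis mult.assoc)
  then have "den_factor p (Gcd (\<nu> ` K)) (Gcd (N ` K)) dvd den_factor p (\<nu> j) (N j)"
    unfolding uvc(3,4) using den_factor_dvd_mult by metis
  then show ?thesis using den_factor_dvd_den_class[OF assms j] by (rule dvd_trans)
qed

text \<open>A zero numerator would be divisible by every factor of its class, and by
  \<open>class_numerator_dvd_iff\<close> so would B. Hence no class drops out of the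
  decomposition.\<close>

lemma class_numerator_nonzero:
  assumes "class_partial_fractions Q A" "K \<in> J // ratio_rel J \<nu> N"
  shows "A K \<noteq> 0"
proof
  assume A: "A K = 0"
  obtain j where j: "j \<in> K" using class_ratio_class[OF assms(2)] by (auto simp: ratio_class_def)
  have "den_factor p (\<nu> j) (N j) dvd B"
    unfolding class_numerator_dvd_iff[OF assms den_factor_dvd_den_class[OF assms(2) j]] A by (rule dvd_0_right)
  moreover have "j \<in> J" using class_subset[OF assms(2)] j by blast
  ultimately show False using rep by (auto simp: igusa_rep_def)
qed

end

section \<open>Exponents and quasi-polynomials of the classes\<close>

definition class_exp :: "nat \<Rightarrow> (nat \<Rightarrow> nat) \<Rightarrow> (nat \<Rightarrow> nat) \<Rightarrow> nat set \<Rightarrow> rat" where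
  "class_exp n \<nu> N K = of_nat n - of_nat (Lcm (\<nu> ` K)) / of_nat (Lcm (N ` K))"

text \<open>Defined through the series instead of through the polynomials found in
  \<open>ratio_class_coeffs\<close>: then equal series and equal exponents give the same function at
  once, which is how the principal parts determine it.\<close>

definition class_fun :: "nat \<Rightarrow> nat \<Rightarrow> rat \<Rightarrow> rat fps \<Rightarrow> nat \<Rightarrow> rat" where
  "class_fun p n x F i = of_nat p ^ (n * i) * fps_nth F i / of_nat p powi \<lceil>x * of_nat i\<rceil>"

lemma class_exp_eq:
  assumes "ratio_class K \<nu> N" "j \<in> K"
  shows "class_exp n \<nu> N K = of_nat n - of_nat (\<nu> j) / of_nat (N j)"
proof -
  note Lcm = ratio_class_Lcm_ratio[OF assms]
  have "N j > 0" using assms by (auto simp: ratio_class_def)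
  moreover have "(of_nat (Lcm (\<nu> ` K)) * of_nat (N j) :: rat) = of_nat (\<nu> j) * of_nat (Lcm (N ` K))"
    using Lcm(3) by (metis of_nat_mult)
  ultimately have "(of_nat (Lcm (\<nu> ` K)) / of_nat (Lcm (N ` K)) :: rat) = of_nat (\<nu> j) / of_nat (N j)"
    using Lcm(2) by (subst frac_eq_eq) auto
  then show ?thesis by (simp add: class_exp_def)
qed

context
  fixes p n :: nat and f :: intpoly and J :: "nat set" and \<nu> N :: "nat \<Rightarrow> nat" and B :: "rat poly"
    and Q :: "rat poly" and A :: "nat set \<Rightarrow> rat poly"
  assumes p: "prime p" and rep: "igusa_rep p n f J \<nu> N B"
    and QA: "class_partial_fractions p J \<nu> N B Q A"
begin

lemma class_exp_inj:
  assumes "K \<in> J // ratio_rel J \<nu> N" "K' \<in> J // ratio_rel J \<nu> N" "class_exp n \<nu> N K = class_exp n \<nu> N K'"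
  shows "K = K'"
proof (rule ccontr)
  assume neq: "K \<noteq> K'"
  have R: "ratio_class K \<nu> N" "ratio_class K' \<nu> N" using class_ratio_class[OF p rep] assms by blast+
  then obtain i j where ij: "i \<in> K" "j \<in> K'" by (auto simp: ratio_class_def)
  then have pos: "N i > 0" "N j > 0" using R by (auto simp: ratio_class_def)
  have "(of_nat (\<nu> i) / of_nat (N i) :: rat) = of_nat (\<nu> j) / of_nat (N j)"
    using assms(3) class_exp_eq[OF R(1) ij(1), of n] class_exp_eq[OF R(2) ij(2), of n] by simp
  then have "(of_nat (\<nu> i * N j) :: rat) = of_nat (\<nu> j * N i)"
    using pos by (subst (asm) frac_eq_eq) auto
  then show False using classes_ratio_neq[OF p rep assms(1,2) neq ij] by (simp only: of_nat_eq_iff)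
qed

lemma class_fun_residues:
  assumes K: "K \<in> J // ratio_rel J \<nu> N"
  shows "\<exists>q. poly_on_residues (Lcm (N ` K)) (class_fun p n (class_exp n \<nu> N K) (class_series p \<nu> N A K)) q \<and>
     Max ((\<lambda>c. degree (q c)) ` {..<Lcm (N ` K)}) \<le> card K - 1 \<and>
     (Max ((\<lambda>c. degree (q c)) ` {..<Lcm (N ` K)}) = card K - 1 \<longleftrightarrow>
        \<not> den_factor p (Gcd (\<nu> ` K)) (Gcd (N ` K)) dvd B)"
proof -
  have R: "ratio_class K \<nu> N" using class_ratio_class[OF p rep] K by blast
  obtain j where j: "j \<in> K" using R by (auto simp: ratio_class_def)
  define b where "b = Lcm (N ` K)"
  have b: "b > 0" unfolding b_def by (rule ratio_class_Lcm_ratio(2)[OF R j])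
  have p1: "p > 1" using p by (rule prime_gt_1_nat)
  have "degree (A K) < degree (den p K \<nu> N)" using QA K by (auto simp: class_partial_fractions_def[OF p rep])
  from ratio_class_coeffs[OF p1 R this, of n, folded b_def] obtain q where
    q: "\<forall>x. degree (q x) \<le> card K - 1"
      "\<forall>i. of_nat p ^ (n * i) * fps_nth (fps_of_poly (A K) / fps_of_poly (den p K \<nu> N)) i =
       poly (q (i mod b)) (of_nat i) * of_nat p powi \<lceil>(of_nat n - of_nat (Lcm (\<nu> ` K)) / of_nat b) * of_nat i :: rat\<rceil>"
      "(\<exists>x<b. coeff (q x) (card K - 1) \<noteq> 0) \<longleftrightarrow> \<not> den_factor p (Gcd (\<nu> ` K)) (Gcd (N ` K)) dvd A K"
    by (elim exE conjE) (rule that)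
  have p_nz: "(of_nat p powi k :: rat) \<noteq> 0" for k using p1 by simp
  have "class_fun p n (class_exp n \<nu> N K) (class_series p \<nu> N A K) i = poly (q (i mod b)) (of_nat i)" for i
    using q(2)[rule_format, of i]
    unfolding class_fun_def class_series_def[OF p rep] class_exp_def b_def[symmetric]
    by (simp only: nonzero_mult_div_cancel_right[OF p_nz])
  then have "poly_on_residues b (class_fun p n (class_exp n \<nu> N K) (class_series p \<nu> N A K)) q"
    using b by (simp add: poly_on_residues_def)
  moreover have fin: "finite ((\<lambda>c. degree (q c)) ` {..<b})" "(\<lambda>c. degree (q c)) ` {..<b} \<noteq> {}" using b by auto
  have le: "Max ((\<lambda>c. degree (q c)) ` {..<b}) \<le> card K - 1"
    using fin q(1) by (subst Max_le_iff) auto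
  moreover have "Max ((\<lambda>c. degree (q c)) ` {..<b}) = card K - 1 \<longleftrightarrow>
      \<not> den_factor p (Gcd (\<nu> ` K)) (Gcd (N ` K)) dvd B"
  \<comment> \<open>A class with one element has m - 1 = 0, and the zero polynomial also has degree
    0, so a statement about the degree does not translate into one about the coefficient of degree m
    - 1. In that case both sides simply hold: the gcd factor is the single factor of the class,
    which does not divide B.\<close>
  proof (cases "card K = 1")
    case True
    then have K1: "K = {j}" using j by (auto simp: card_1_singleton_iff)
    have "j \<in> J" using class_subset[OF p rep K] j by blast
    then have "\<not> den_factor p (Gcd (\<nu> ` K)) (Gcd (N ` K)) dvd B"
      using rep by (simp add: K1 igusa_rep_def)
    moreover have "Max ((\<lambda>c. degree (q c)) ` {..<b}) = card K - 1" using le True by simp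
    ultimately show ?thesis by blast
  next
    case False
    have "card K > 0" using R by (auto simp: ratio_class_def card_gt_0_iff)
    with False have m: "card K - 1 > 0" by simp
    have "Max ((\<lambda>c. degree (q c)) ` {..<b}) = card K - 1 \<longleftrightarrow> (\<exists>x<b. degree (q x) = card K - 1)"
    proof
      assume "Max ((\<lambda>c. degree (q c)) ` {..<b}) = card K - 1"
      then have "card K - 1 \<in> (\<lambda>c. degree (q c)) ` {..<b}" using Max_in[OF fin] by simp
      then show "\<exists>x<b. degree (q x) = card K - 1" by auto
    next
      assume "\<exists>x<b. degree (q x) = card K - 1"
      then have "card K - 1 \<in> (\<lambda>c. degree (q c)) ` {..<b}" by force
      then have "card K - 1 \<le> Max ((\<lambda>c. degree (q c)) ` {..<b})" using fin(1) by (intro Max_ge)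
      then show "Max ((\<lambda>c. degree (q c)) ` {..<b}) = card K - 1" using le by simp
    qed
    also have "\<dots> \<longleftrightarrow> (\<exists>x<b. coeff (q x) (card K - 1) \<noteq> 0)"
    proof -
      have "degree (q x) = card K - 1 \<longleftrightarrow> coeff (q x) (card K - 1) \<noteq> 0" for x
      proof
        assume d: "degree (q x) = card K - 1"
        with m have "q x \<noteq> 0" by auto
        then show "coeff (q x) (card K - 1) \<noteq> 0" unfolding d[symmetric] by simp
      next
        assume "coeff (q x) (card K - 1) \<noteq> 0"
        then have "card K - 1 \<le> degree (q x)" by (rule le_degree)
        with q(1) show "degree (q x) = card K - 1" by (simp add: order.antisym)
      qed
      then show ?thesis by simp
    qed
    also have "\<dots> \<longleftrightarrow> \<not> den_factor p (Gcd (\<nu> ` K)) (Gcd (N ` K)) dvd B"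
      unfolding q(3) using class_numerator_dvd_iff[OF p rep QA K Gcd_den_factor_dvd_den_class[OF p rep K]] by blast
    finally show ?thesis .
  qed
  ultimately show ?thesis unfolding b_def by blast
qed

lemma class_fun_nonzero:
  assumes K: "K \<in> J // ratio_rel J \<nu> N"
  shows "\<exists>i. class_fun p n x (class_series p \<nu> N A K) i \<noteq> 0"
proof (rule ccontr)
  assume *: "\<not> ?thesis"
  have "p > 0" using p by (rule prime_gt_0_nat)
  with * have "class_series p \<nu> N A K = 0" by (simp add: class_fun_def fps_eq_iff)
  moreover have "class_series p \<nu> N A K * fps_of_poly (den p K \<nu> N) = fps_of_poly (A K)"
    unfolding class_series_def[OF p rep] using coeff_0_den_class[OF p rep K] by (intro fps_divide_times_unit) simp
  ultimately have "A K = 0" by simp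
  then show False using class_numerator_nonzero[OF p rep QA K] by simp
qed

lemma canonical_sol_decomposition:
  assumes C: "bij_betw C {1..r} (J // ratio_rel J \<nu> N)"
  shows "sol_decomposition p n f (rat_fun_degree B (den p J \<nu> N)) r (\<lambda>k. class_exp n \<nu> N (C k))
    (\<lambda>k. class_fun p n (class_exp n \<nu> N (C k)) (class_series p \<nu> N A (C k)))"
  unfolding sol_decomposition_def
proof (intro conjI ballI allI impI)
  have C_in: "C k \<in> J // ratio_rel J \<nu> N" if "k \<in> {1..r}" for k using C that by (rule bij_betwE[rule_format])
  show "inj_on (\<lambda>k. class_exp n \<nu> N (C k)) {1..r}"
  proof (rule inj_onI)
    fix k k' assume k: "k \<in> {1..r}" "k' \<in> {1..r}" "class_exp n \<nu> N (C k) = class_exp n \<nu> N (C k')"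
    then have "C k = C k'" using class_exp_inj C_in by blast
    then show "k = k'" using C k(1,2) by (auto simp: bij_betw_def dest: inj_onD)
  qed
  fix k assume k: "k \<in> {1..r}"
  show "\<exists>m q. poly_on_residues m (class_fun p n (class_exp n \<nu> N (C k)) (class_series p \<nu> N A (C k))) q"
    using class_fun_residues[OF C_in[OF k]] by blast
  show "\<exists>i. class_fun p n (class_exp n \<nu> N (C k)) (class_series p \<nu> N A (C k)) i \<noteq> 0"
    by (rule class_fun_nonzero[OF C_in[OF k]])
next
  fix i assume i: "rat_fun_degree B (den p J \<nu> N) < int i"
  have p_nz: "(of_nat p powi k :: rat) \<noteq> 0" for k using prime_gt_0_nat[OF p] by simp
  have "of_nat (num_sols p n f i) = (\<Sum>K\<in>J // ratio_rel J \<nu> N. of_nat p ^ (n * i) * fps_nth (class_series p \<nu> N A K) i)"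
    by (rule num_sols_eq_class_series[OF p rep QA i])
  also have "\<dots> = (\<Sum>K\<in>J // ratio_rel J \<nu> N. class_fun p n (class_exp n \<nu> N K) (class_series p \<nu> N A K) i *
      of_nat p powi \<lceil>class_exp n \<nu> N K * of_nat i\<rceil>)"
    unfolding class_fun_def using p_nz by simp
  also have "\<dots> = (\<Sum>k=1..r. class_fun p n (class_exp n \<nu> N (C k)) (class_series p \<nu> N A (C k)) i *
      of_nat p powi \<lceil>class_exp n \<nu> N (C k) * of_nat i\<rceil>)"
    by (rule sum.reindex_bij_betw[OF C, symmetric])
  finally show "of_nat (num_sols p n f i) = (\<Sum>k=1..r. class_fun p n (class_exp n \<nu> N (C k)) (class_series p \<nu> N A (C k)) i *
      of_nat p powi \<lceil>class_exp n \<nu> N (C k) * of_nat i\<rceil>)" .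
qed

end

section \<open>Poles of the zeta function\<close>

definition igusa_rational :: "nat \<Rightarrow> nat set \<Rightarrow> (nat \<Rightarrow> nat) \<Rightarrow> (nat \<Rightarrow> nat) \<Rightarrow> rat poly \<Rightarrow> complex \<Rightarrow> complex" where
  "igusa_rational p J \<nu> N B t = (1 - (1 - t) * (ceval B t / ceval (den p J \<nu> N) t)) / t"

text \<open>The variable $t = p^{-s}$.\<close>

definition exp_var :: "nat \<Rightarrow> complex \<Rightarrow> complex" where
  "exp_var p s = exp (- s * of_real (ln (real p)))"

lemma exp_var_eq_powr: "p > 0 \<Longrightarrow> of_nat p powr (- s) = exp_var p s"
  by (simp add: exp_var_def powr_def Ln_of_nat)

lemma exp_var_nonzero: "exp_var p s \<noteq> 0"
  by (simp add: exp_var_def)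

lemma norm_exp_var: "p > 0 \<Longrightarrow> norm (exp_var p s) = real p powr (- Re s)"
  by (simp add: exp_var_def norm_exp_eq_Re powr_def)

lemma exp_var_surj:
  assumes "p > 1" "z \<noteq> 0"
  shows "exp_var p (- Ln z / of_real (ln (real p))) = z"
  using assms by (simp add: exp_var_def)

lemma isCont_exp_var: "isCont (exp_var p) s"
  unfolding exp_var_def by (intro continuous_intros)

lemma analytic_exp_var: "exp_var p analytic_on A"
proof -
  have "exp_var p holomorphic_on UNIV" unfolding exp_var_def by (intro holomorphic_intros)
  then have "exp_var p analytic_on UNIV" by (simp add: analytic_on_open)
  then show ?thesis by (rule analytic_on_subset) simp
qed

lemma analytic_ceval_exp_var: "(\<lambda>s. ceval q (exp_var p s)) analytic_on A"
proof -
  have "exp_var p holomorphic_on UNIV" unfolding exp_var_def by (intro holomorphic_intros)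
  then have "(\<lambda>s. ceval q (exp_var p s)) holomorphic_on UNIV" by (rule poly_holomorphic_on)
  then have "(\<lambda>s. ceval q (exp_var p s)) analytic_on UNIV" by (simp add: analytic_on_open)
  then show ?thesis by (rule analytic_on_subset) simp
qed

lemma num_sols_0: "num_sols p n f 0 = 1"
proof -
  have "{x \<in> {..<n} \<rightarrow>\<^sub>E {0..<int p ^ 0}. [eval_intpoly f x = 0] (mod int p ^ 0)} = {..<n} \<rightarrow>\<^sub>E {0..<1}"
    by (auto simp: unique_euclidean_semiring_class.cong_def)
  moreover have "card ({..<n} \<rightarrow>\<^sub>E {0..<1::int}) = 1" by (subst card_PiE) auto
  ultimately show ?thesis unfolding num_sols_def by simp
qed

text \<open>The identity theorem on the connected plane, in a form that ignores values at isolated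
  points such as poles and removable singularities.\<close>

lemma eventually_eq_0_or_neq_0:
  assumes "f meromorphic_on UNIV"
  shows "(\<forall>s. eventually (\<lambda>s. f s = 0) (at s)) \<or> (\<forall>s. eventually (\<lambda>s. f s \<noteq> 0) (at s))"
  using meromorphic_imp_constant_or_avoid[OF assms open_UNIV connected_UNIV, of 0]
  by (simp add: eventually_cosparse_open_eq)

section \<open>Continuation of the integral and the real parts of its poles\<close>

context
  fixes p n :: nat and f :: intpoly and J :: "nat set" and \<nu> N :: "nat \<Rightarrow> nat" and B :: "rat poly"
  assumes p: "prime p" and vars: "in_vars n f" and rep: "igusa_rep p n f J \<nu> N B"
begin

lemma ceval_den_eq_0D:
  assumes "ceval (den p J \<nu> N) z = 0"
  obtains j where "j \<in> J" "ceval (den_factor p (\<nu> j) (N j)) z = 0"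
  using assms igusa_rep_finite[OF p rep] unfolding den_def ceval_prod by (auto simp: prod_zero_iff)

text \<open>The zeros have norm p^(\<nu> j / N j) > 1. So P has no pole in the closed unit disc; in
  particular t = 1 is never one.\<close>

lemma ceval_den_nonzero:
  assumes "norm z \<le> 1"
  shows "ceval (den p J \<nu> N) z \<noteq> 0"
proof
  assume "ceval (den p J \<nu> N) z = 0"
  then obtain j where j: "j \<in> J" "ceval (den_factor p (\<nu> j) (N j)) z = 0" by (rule ceval_den_eq_0D)
  have pos: "\<nu> j > 0" "N j > 0" using igusa_rep_pos[OF p rep] j by auto
  have "norm z = real p powr (real (\<nu> j) / real (N j))"
    using norm_root_den_factor[OF prime_gt_0_nat[OF p] pos(2) j(2)] .
  also have "\<dots> > 1" using pos prime_gt_1_nat[OF p] by (intro gr_one_powr) auto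
  finally show False using assms by simp
qed

text \<open>The representation is an identity of formal series. It carries over to values because
  coefficients between 0 and 1 give radius of convergence at least 1, and the denominator does not
  vanish for |z| < 1.\<close>

lemma poincare_series_sums:
  assumes "norm z < 1"
  shows "(\<lambda>k. of_real (sol_density p n f k) * z ^ k) sums (ceval B z / ceval (den p J \<nu> N) z)"
proof -
  have p0: "p > 0" using p by (rule prime_gt_0_nat)
  define F :: "complex fps" where "F = Abs_fps (\<lambda>k. of_rat (fps_nth (poincare_series p n f) k))"
  have F_nth: "fps_nth F k = of_real (sol_density p n f k)" for k
    by (simp add: F_def poincare_series_def sol_density_def of_rat_mult of_rat_power of_rat_inverse)
  have den0: "fps_nth (fps_of_poly (den p J \<nu> N)) 0 \<noteq> 0"
    using coeff_0_den[of J N p \<nu>] igusa_rep_pos[OF p rep] by simp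
  have "poincare_series p n f * fps_of_poly (den p J \<nu> N) = fps_of_poly B"
    using rep fps_divide_times_unit[OF den0] by (simp add: igusa_rep_def)
  then have "F * fps_of_poly (map_poly of_rat (den p J \<nu> N)) = fps_of_poly (map_poly of_rat B)"
    by (simp add: F_def fps_eq_iff fps_mult_nth coeff_of_rat_poly of_rat_sum[symmetric] of_rat_mult[symmetric])
  moreover have R: "fps_conv_radius F \<ge> 1"
    unfolding fps_conv_radius_def
  proof (rule conv_radius_geI_ex')
    fix r :: real assume r: "0 < r" "ereal r < 1"
    show "summable (\<lambda>k. fps_nth F k * of_real r ^ k)"
    proof (rule summable_comparison_test'[of "\<lambda>k. r ^ k" 0])
      show "summable (\<lambda>k. r ^ k)" using r by (intro summable_geometric) auto
      show "norm (fps_nth F k * of_real r ^ k) \<le> r ^ k" for k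
        using r sol_density_bounds[OF p0 vars, of k] by (simp add: F_nth norm_mult norm_power mult_left_le_one_le)
    qed
  qed
  moreover have z: "norm z < fps_conv_radius F"
    using assms R by (metis ereal_less(3) less_le_trans)
  ultimately have "eval_fps F z * ceval (den p J \<nu> N) z = ceval B z"
    using eval_fps_mult[of z F "fps_of_poly (map_poly of_rat (den p J \<nu> N))"] by simp
  then have "eval_fps F z = ceval B z / ceval (den p J \<nu> N) z"
    using ceval_den_nonzero[of z] assms by (simp add: field_simps)
  then show ?thesis using sums_eval_fps[OF z] by (simp add: F_nth)
qed

lemma igusa_integral_eq:
  assumes "Re s > 0"
  shows "igusa_integral p n f s = igusa_rational p J \<nu> N B (exp_var p s)"
proof -
  have p0: "p > 0" using p by (rule prime_gt_0_nat)
  define t where "t = exp_var p s"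
  define c where "c = (\<lambda>k. complex_of_real (sol_density p n f k))"
  define P where "P = ceval B t / ceval (den p J \<nu> N) t"
  have t: "norm t < 1" using norm_prime_powr_less_1[OF p assms] by (simp add: t_def exp_var_eq_powr[OF p0])
  have t0: "t \<noteq> 0" by (simp add: t_def exp_var_nonzero)
  \<comment> \<open>Modulo p^0 = 1 there is exactly one solution; this 1 is what the shift of the
    series removes, giving (P - 1)/t.\<close>
  have c0: "c 0 = 1" by (simp add: c_def sol_density_def num_sols_0)
  have P: "(\<lambda>k. c k * t ^ k) sums P" unfolding c_def P_def by (rule poincare_series_sums[OF t])
  then have "(\<lambda>k. c (Suc k) * t ^ Suc k) sums (P - 1)"
    using c0 by (subst sums_Suc_iff) simp
  from sums_divide[OF this, of t] have "(\<lambda>k. c (Suc k) * t ^ k) sums ((P - 1) / t)"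
    using t0 by (simp add: field_simps)
  from sums_diff[OF P this] have "(\<lambda>k. t ^ k * (c k - c (Suc k))) sums (P - (P - 1) / t)"
    by (simp add: algebra_simps)
  moreover have "(\<lambda>k. t ^ k * (c k - c (Suc k))) sums igusa_integral p n f s"
    using igusa_integral_sums[OF p vars assms] by (simp add: t_def c_def exp_var_eq_powr[OF p0])
  ultimately have "igusa_integral p n f s = P - (P - 1) / t" by (rule sums_unique2[symmetric])
  also have "\<dots> = (1 - (1 - t) * P) / t" using t0 by (simp add: field_simps)
  finally show ?thesis by (simp add: igusa_rational_def t_def P_def)
qed

lemma meromorphic_igusa_rational: "(\<lambda>s. igusa_rational p J \<nu> N B (exp_var p s)) meromorphic_on A"
  unfolding igusa_rational_def
  by (intro meromorphic_intros analytic_on_imp_meromorphic_on analytic_ceval_exp_var analytic_exp_var)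

lemma analytic_igusa_rational:
  assumes "ceval (den p J \<nu> N) (exp_var p s) \<noteq> 0"
  shows "(\<lambda>s. igusa_rational p J \<nu> N B (exp_var p s)) analytic_on {s}"
  unfolding igusa_rational_def
  by (intro analytic_intros analytic_ceval_exp_var analytic_exp_var) (use assms in \<open>auto simp: exp_var_nonzero\<close>)

lemma norm_exp_var_le_1: "Re s \<ge> 0 \<Longrightarrow> norm (exp_var p s) \<le> 1"
  using prime_gt_1_nat[OF p] powr_mono[of "- Re s" 0 "real p"] by (simp add: norm_exp_var)

text \<open>The rational function in p^(-s), with its removable singularities removed, is a witness
  for the choice in \<open>igusa_zeta\<close>. From here on the chosen function is known only
  through these two properties.\<close>

lemma igusa_zeta_spec:
  "igusa_zeta p n f nicely_meromorphic_on UNIV"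
  "Re s > 0 \<Longrightarrow> igusa_zeta p n f s = igusa_integral p n f s"
proof -
  let ?R = "\<lambda>s. igusa_rational p J \<nu> N B (exp_var p s)"
  have "remove_sings ?R nicely_meromorphic_on UNIV"
    by (rule remove_sings_nicely_meromorphic[OF meromorphic_igusa_rational])
  moreover have "remove_sings ?R s = igusa_integral p n f s" if "Re s > 0" for s
    using that igusa_integral_eq[OF that] norm_exp_var_le_1[of s]
    by (subst remove_sings_at_analytic) (auto intro!: analytic_igusa_rational ceval_den_nonzero)
  ultimately have "\<exists>Z. Z nicely_meromorphic_on UNIV \<and> (\<forall>s. Re s > 0 \<longrightarrow> Z s = igusa_integral p n f s)" by blast
  from someI_ex[OF this] show "igusa_zeta p n f nicely_meromorphic_on UNIV"
    "Re s > 0 \<Longrightarrow> igusa_zeta p n f s = igusa_integral p n f s"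
    unfolding igusa_zeta_def by auto
qed

lemma meromorphic_igusa_zeta: "igusa_zeta p n f meromorphic_on A"
  using igusa_zeta_spec(1) meromorphic_on_subset[of _ UNIV A] by (auto simp: nicely_meromorphic_on_def)

text \<open>Both sides are meromorphic on the plane and agree for Re s > 0, so the identity theorem
  applies; the point 1 in the proof merely lies in this half-plane. Equality is claimed on punctured
  neighbourhoods only, since values at singular points may differ.\<close>

lemma eventually_igusa_zeta_eq:
  "eventually (\<lambda>s. igusa_zeta p n f s = igusa_rational p J \<nu> N B (exp_var p s)) (at s0)"
proof -
  let ?h = "\<lambda>s. igusa_zeta p n f s - igusa_rational p J \<nu> N B (exp_var p s)"
  have "?h meromorphic_on UNIV"
    by (intro meromorphic_intros meromorphic_igusa_zeta meromorphic_igusa_rational)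
  from eventually_eq_0_or_neq_0[OF this] show ?thesis
  proof
    assume "\<forall>s. \<forall>\<^sub>F s in at s. ?h s = 0"
    then show ?thesis by simp
  next
    assume "\<forall>s. \<forall>\<^sub>F s in at s. ?h s \<noteq> 0"
    then have "\<forall>\<^sub>F s in at 1. ?h s \<noteq> 0" by blast
    moreover have "\<forall>\<^sub>F s in at 1. s \<in> {s. Re s > 0}"
      by (intro eventually_at_in_open' open_halfspace_Re_gt) auto
    ultimately have "\<forall>\<^sub>F s in at (1::complex). False"
      by eventually_elim (use igusa_zeta_spec(2) igusa_integral_eq in auto)
    then show ?thesis by simp
  qed
qed

lemma eventually_ceval_den_nonzero:
  "eventually (\<lambda>s. ceval (den p J \<nu> N) (exp_var p s) \<noteq> 0) (at s0)"
proof -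
  let ?h = "\<lambda>s. ceval (den p J \<nu> N) (exp_var p s)"
  have "?h meromorphic_on UNIV"
    by (intro analytic_on_imp_meromorphic_on analytic_ceval_exp_var)
  from eventually_eq_0_or_neq_0[OF this] show ?thesis
  proof
    assume "\<forall>s. \<forall>\<^sub>F s in at s. ?h s = 0"
    then have "\<forall>\<^sub>F s in at 1. ?h s = 0" by blast
    moreover have "\<forall>\<^sub>F s in at 1. s \<in> {s. Re s > 0}"
      by (intro eventually_at_in_open' open_halfspace_Re_gt) auto
    ultimately have "\<forall>\<^sub>F s in at (1::complex). False"
      by eventually_elim (use ceval_den_nonzero norm_exp_var_le_1 in force)
    then show ?thesis by simp
  qed simp
qed

lemma is_pole_igusa_zeta_imp:
  assumes "is_pole (igusa_zeta p n f) s"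
  shows "ceval (den p J \<nu> N) (exp_var p s) = 0"
proof (rule ccontr)
  assume "ceval (den p J \<nu> N) (exp_var p s) \<noteq> 0"
  then have "(\<lambda>s. igusa_rational p J \<nu> N B (exp_var p s)) analytic_on {s}" by (rule analytic_igusa_rational)
  then have "\<not> is_pole (\<lambda>s. igusa_rational p J \<nu> N B (exp_var p s)) s" by (rule analytic_at_imp_no_pole)
  then show False using assms is_pole_cong[OF eventually_igusa_zeta_eq refl] by blast
qed

text \<open>Over the common denominator D*t the numerator is D - (1 - t)*B. Where D vanishes and B
  does not, it is nonzero since t \<noteq> 1, and so nothing cancels.\<close>

lemma is_pole_igusa_zeta:
  assumes "ceval (den p J \<nu> N) (exp_var p s) = 0" "ceval B (exp_var p s) \<noteq> 0"
  shows "is_pole (igusa_zeta p n f) s"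
proof -
  let ?D = "\<lambda>s. ceval (den p J \<nu> N) (exp_var p s)"
  let ?M = "\<lambda>s. (1 - exp_var p s) * ceval B (exp_var p s)"
  have "exp_var p s \<noteq> 1" using assms(1) ceval_den_nonzero[of "exp_var p s"] by auto
  have cont: "(\<lambda>s. ceval q (exp_var p s)) \<midarrow>s\<rightarrow> ceval q (exp_var p s)" for q
    using isCont_exp_var[where p = p and s = s] by (intro tendsto_intros) (simp add: isCont_def)
  have t: "exp_var p \<midarrow>s\<rightarrow> exp_var p s" using isCont_exp_var[where p = p and s = s] by (simp add: isCont_def)
  have "filterlim (\<lambda>s. (?D s - ?M s) / (?D s * exp_var p s)) at_infinity (at s)"
  proof (rule filterlim_divide_at_infinity)
    show "((\<lambda>s. ?D s - ?M s) \<longlongrightarrow> ?D s - ?M s) (at s)" by (intro tendsto_intros cont t)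
    show "?D s - ?M s \<noteq> 0" using assms \<open>exp_var p s \<noteq> 1\<close> by simp
    have "((\<lambda>s. ?D s * exp_var p s) \<longlongrightarrow> ?D s * exp_var p s) (at s)" by (intro tendsto_intros cont t)
    then show "filterlim (\<lambda>s. ?D s * exp_var p s) (at 0) (at s)"
      using assms(1) eventually_ceval_den_nonzero[of s] by (auto simp: filterlim_at exp_var_nonzero)
  qed
  then have pole: "is_pole (\<lambda>s. (?D s - ?M s) / (?D s * exp_var p s)) s" by (simp add: is_pole_def)
  have ev: "\<forall>\<^sub>F s in at s. (?D s - ?M s) / (?D s * exp_var p s) = igusa_zeta p n f s"
    using eventually_igusa_zeta_eq[of s] eventually_ceval_den_nonzero[of s]
    by eventually_elim (simp add: igusa_rational_def field_simps)
  from is_pole_cong[OF ev refl] pole show ?thesis by (rule iffD1)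
qed

lemma Re_eq_of_exp_var_root:
  assumes "N j > 0" "ceval (den_factor p (\<nu> j) (N j)) (exp_var p s) = 0"
  shows "Re s = - (real (\<nu> j) / real (N j))"
proof -
  have p0: "p > 0" "p > 1" using prime_gt_1_nat[OF p] by auto
  have "real p powr (- Re s) = real p powr (real (\<nu> j) / real (N j))"
    using norm_root_den_factor[OF p0(1) assms] by (simp add: norm_exp_var[OF p0(1)])
  then have "- Re s = real (\<nu> j) / real (N j)" using p0 by (subst (asm) powr_inj) auto
  then show ?thesis by simp
qed

text \<open>A factor that does not divide B has, its zeros being distinct, a zero at which B is
  nonzero. So every j contributes a pole on its line, although other zeros of the factor may
  cancel.\<close>

theorem Re_poles_igusa_zeta:
  "{Re s | s. is_pole (igusa_zeta p n f) s} = (\<lambda>j. - (real (\<nu> j) / real (N j))) ` J"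
proof (intro equalityI subsetI)
  fix x assume "x \<in> {Re s | s. is_pole (igusa_zeta p n f) s}"
  then obtain s where s: "x = Re s" "is_pole (igusa_zeta p n f) s" by blast
  obtain j where j: "j \<in> J" "ceval (den_factor p (\<nu> j) (N j)) (exp_var p s) = 0"
    using ceval_den_eq_0D[OF is_pole_igusa_zeta_imp[OF s(2)]] by blast
  then show "x \<in> (\<lambda>j. - (real (\<nu> j) / real (N j))) ` J"
    using Re_eq_of_exp_var_root[of j s] igusa_rep_pos[OF p rep, of j] s(1) by auto
next
  fix x assume "x \<in> (\<lambda>j. - (real (\<nu> j) / real (N j))) ` J"
  then obtain j where j: "j \<in> J" "x = - (real (\<nu> j) / real (N j))" by blast
  have p0: "p > 0" "p > 1" using prime_gt_1_nat[OF p] by auto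
  have pos: "N j > 0" using igusa_rep_pos[OF p rep] j by blast
  have "\<not> den_factor p (\<nu> j) (N j) dvd B" using rep j(1) by (auto simp: igusa_rep_def)
  then obtain z where z: "ceval (den_factor p (\<nu> j) (N j)) z = 0" "ceval B z \<noteq> 0"
    unfolding den_factor_dvd_iff[OF p0(1) pos] by blast
  have "z \<noteq> 0" using z(1) pos by (intro notI) (simp add: ceval_den_factor power_0_left)
  define s where "s = - Ln z / of_real (ln (real p))"
  have sz: "exp_var p s = z" unfolding s_def by (rule exp_var_surj[OF p0(2) \<open>z \<noteq> 0\<close>])
  have "ceval (den p J \<nu> N) z = 0"
    unfolding den_def ceval_prod using igusa_rep_finite[OF p rep] j(1) z(1) by (auto simp: prod_zero_iff)
  then have "is_pole (igusa_zeta p n f) s" using z(2) sz by (intro is_pole_igusa_zeta) auto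
  moreover have "Re s = x" using Re_eq_of_exp_var_root[OF pos] z(1) sz j(2) by simp
  ultimately show "x \<in> {Re s | s. is_pole (igusa_zeta p n f) s}" by blast
qed

end

section \<open>Principal parts determine the components\<close>

lemma eventually_poly_nonzero:
  fixes Y :: "complex poly"
  assumes "Y \<noteq> 0"
  shows "eventually (\<lambda>w. poly Y w \<noteq> 0) (at z)"
proof -
  have "finite ({w. poly Y w = 0} - {z})" using poly_roots_finite[OF assms] by simp
  then have "open (- ({w. poly Y w = 0} - {z}))" by (intro open_Compl finite_imp_closed)
  then have "eventually (\<lambda>w. w \<in> - ({w. poly Y w = 0} - {z}) - {z}) (at z)"
    by (rule eventually_at_in_open) simp
  then show ?thesis by eventually_elim auto
qed

text \<open>Each root of \<open>Y\<close> is a root of \<open>X\<close>, so a linear factor can be cancelled from both.\<close>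

lemma poly_dvd_of_quotient_limits:
  fixes X Y :: "complex poly"
  assumes "Y \<noteq> 0" and "\<And>z. poly Y z = 0 \<Longrightarrow> \<exists>c. ((\<lambda>w. poly X w / poly Y w) \<longlongrightarrow> c) (at z)"
  shows "Y dvd X"
  using assms
proof (induction "degree Y" arbitrary: X Y)
  case 0
  then have "is_unit Y" by (simp add: is_unit_iff_degree)
  then show ?case by (rule unit_imp_dvd)
next
  case (Suc d)
  have "\<not> constant (poly Y)" using Suc.hyps(2) by (simp add: constant_degree)
  then obtain z where z: "poly Y z = 0" using fundamental_theorem_of_algebra by blast
  obtain c where c: "((\<lambda>w. poly X w / poly Y w) \<longlongrightarrow> c) (at z)" using Suc.prems(2)[OF z] by blast
  have "((\<lambda>w. poly X w / poly Y w * poly Y w) \<longlongrightarrow> c * poly Y z) (at z)"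
    using c by (intro tendsto_intros)
  moreover have "\<forall>\<^sub>F w in at z. poly X w / poly Y w * poly Y w = poly X w"
    using eventually_poly_nonzero[OF Suc.prems(1)] by eventually_elim simp
  ultimately have "(poly X \<longlongrightarrow> 0) (at z)" using z by (simp add: tendsto_cong)
  moreover have "(poly X \<longlongrightarrow> poly X z) (at z)" by (intro tendsto_intros)
  ultimately have "poly X z = 0" by (intro LIM_unique)
  then obtain X1 where X1: "X = [:- z, 1:] * X1" by (auto simp: poly_eq_0_iff_dvd)
  obtain Y1 where Y1: "Y = [:- z, 1:] * Y1" using z by (auto simp: poly_eq_0_iff_dvd)
  have Y1_nz: "Y1 \<noteq> 0" using Suc.prems(1) Y1 by auto
  have "degree Y = Suc (degree Y1)" unfolding Y1 using Y1_nz by (subst degree_mult_eq) auto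
  then have deg: "d = degree Y1" using Suc.hyps(2) by simp
  have "Y1 dvd X1"
  proof (rule Suc.hyps(1)[OF deg Y1_nz])
    fix z' assume "poly Y1 z' = 0"
    then have "poly Y z' = 0" by (simp add: Y1)
    then obtain c where c: "((\<lambda>w. poly X w / poly Y w) \<longlongrightarrow> c) (at z')" using Suc.prems(2) by blast
    have "\<forall>\<^sub>F w in at z'. w \<noteq> z"
      using eventually_poly_nonzero[of "[:- z, 1:]" z'] by (auto elim!: eventually_mono)
    then have "\<forall>\<^sub>F w in at z'. poly X w / poly Y w = poly X1 w / poly Y1 w"
    proof eventually_elim
      case (elim w)
      have "poly X w = (w - z) * poly X1 w" "poly Y w = (w - z) * poly Y1 w"
        by (simp_all add: X1 Y1 algebra_simps)
      then show ?case using elim by simp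
    qed
    then have "((\<lambda>w. poly X1 w / poly Y1 w) \<longlongrightarrow> c) (at z')" using c by (simp add: tendsto_cong)
    then show "\<exists>c. ((\<lambda>w. poly X1 w / poly Y1 w) \<longlongrightarrow> c) (at z')" by blast
  qed
  then show ?case unfolding X1 Y1 by (rule mult_dvd_mono[OF dvd_refl])
qed

text \<open>\<open>principal_parts\<close> records poles only; elsewhere the principal part is 0, so
  equal sets mean equal principal parts at every point of the line. The difference then has a
  Laurent expansion without negative powers, and hence a limit.\<close>

lemma eq_principal_parts_imp_limit:
  assumes Z: "igusa_zeta p n f meromorphic_on UNIV" and Z': "igusa_zeta p n f' meromorphic_on UNIV"
    and eq: "principal_parts p n f' (Re s) = principal_parts p n f (Re s)"
  shows "\<exists>c. ((\<lambda>w. igusa_zeta p n f w - igusa_zeta p n f' w) \<longlongrightarrow> c) (at s)"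
proof -
  define F where "F = (\<lambda>f. laurent_expansion (igusa_zeta p n f) s)"
  have L: "(\<lambda>w. igusa_zeta p n f (s + w)) has_laurent_expansion F f"
    "(\<lambda>w. igusa_zeta p n f' (s + w)) has_laurent_expansion F f'"
    unfolding F_def using meromorphic_on_imp_has_laurent_expansion[OF Z] meromorphic_on_imp_has_laurent_expansion[OF Z'] by auto
  have pole: "is_pole (igusa_zeta p n f) s \<longleftrightarrow> fls_prpart (F f) \<noteq> 0"
    "is_pole (igusa_zeta p n f') s \<longleftrightarrow> fls_prpart (F f') \<noteq> 0"
    using is_pole_fls_subdegree_iff[OF L(1)] is_pole_fls_subdegree_iff[OF L(2)] by (auto simp: fls_prpart_eq0_iff)
  have mem: "(s, P) \<in> principal_parts p n g (Re s) \<longleftrightarrow> is_pole (igusa_zeta p n g) s \<and> P = fls_prpart (F g)" for g P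
    by (auto simp: principal_parts_def F_def)
  have "fls_prpart (F f) = fls_prpart (F f')"
    using mem[of "fls_prpart (F f)" f] mem[of "fls_prpart (F f)" f'] mem[of "fls_prpart (F f')" f]
      mem[of "fls_prpart (F f')" f'] eq pole by metis
  moreover have "fls_prpart (F f - F f') = fls_prpart (F f) - fls_prpart (F f')" by (intro poly_eqI) simp
  ultimately have "fls_prpart (F f - F f') = 0" by (simp only: diff_self)
  then have "fls_subdegree (F f - F f') \<ge> 0" by (simp only: fls_prpart_eq0_iff)
  moreover have "(\<lambda>w. igusa_zeta p n f (s + w) - igusa_zeta p n f' (s + w)) has_laurent_expansion (F f - F f')"
    by (intro laurent_expansion_intros L)
  ultimately show ?thesis using has_laurent_expansion_imp_tendsto[of "\<lambda>w. igusa_zeta p n f w - igusa_zeta p n f' w" s] by blast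
qed

text \<open>A branch near z of the inverse of s \<mapsto> p^(-s). Taking \<open>Ln (w / z)\<close>
  instead of \<open>Ln w\<close> puts z at the point 1 of the logarithm, away from its cut, also
  when z is a negative real.\<close>

lemma exp_var_local_inverse:
  assumes "p > 1" "z \<noteq> 0"
  obtains s where "\<And>w. w \<noteq> 0 \<Longrightarrow> exp_var p (s w) = w" "filterlim s (at (s z)) (at z)" "Re (s z) = - ln (norm z) / ln (real p)"
proof -
  define c :: complex where "c = of_real (ln (real p))"
  have c: "c \<noteq> 0" using assms by (simp add: c_def)
  define s0 where "s0 = - Ln z / c"
  define s where "s = (\<lambda>w. s0 - Ln (w / z) / c)"
  have sz: "s z = s0" using assms by (simp add: s_def)
  have E: "exp_var p (s w) = w" if "w \<noteq> 0" for w
  proof -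
    have "- s w * c = Ln z + Ln (w / z)" using c by (simp add: s_def s0_def algebra_simps)
    then show ?thesis using that assms by (simp add: exp_var_def c_def[symmetric] exp_add)
  qed
  have "(s \<longlongrightarrow> s0 - Ln (z / z) / c) (at z)"
    unfolding s_def using assms c by (intro tendsto_intros) auto
  then have "(s \<longlongrightarrow> s z) (at z)" using assms sz by simp
  moreover have "\<forall>\<^sub>F w in at z. s w \<noteq> s z"
  proof -
    have "\<forall>\<^sub>F w in at z. w \<noteq> 0 \<and> w \<noteq> z"
      using tendsto_imp_eventually_ne[OF tendsto_ident_at assms(2)] eventually_neq_at_within[of z z UNIV]
      by eventually_elim simp
    then show ?thesis by eventually_elim (use E assms in metis)
  qed
  ultimately have "filterlim s (at (s z)) (at z)" by (simp add: filterlim_at)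
  moreover have "Re (s z) = - ln (norm z) / ln (real p)" using assms by (simp add: sz s0_def c_def)
  ultimately show thesis using that[of s] E by blast
qed

lemma ceval_tendsto: "(ceval q \<longlongrightarrow> ceval q z) (at z)"
  by (intro tendsto_intros)

context
  fixes p n :: nat and f :: intpoly and J :: "nat set" and \<nu> N :: "nat \<Rightarrow> nat" and B :: "rat poly"
    and Q :: "rat poly" and A :: "nat set \<Rightarrow> rat poly"
  assumes p: "prime p" and rep: "igusa_rep p n f J \<nu> N B"
    and QA: "class_partial_fractions p J \<nu> N B Q A"
begin

lemma igusa_rep_den_nonzero: "den p J \<nu> N \<noteq> 0"
  using coeff_0_den[of J N p \<nu>] igusa_rep_pos[OF p rep] by auto

lemma ceval_partial_fractions:
  assumes "ceval (den p J \<nu> N) w \<noteq> 0"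
  shows "ceval B w / ceval (den p J \<nu> N) w =
    ceval Q w + (\<Sum>K\<in>J // ratio_rel J \<nu> N. ceval (A K) w / ceval (den p K \<nu> N) w)"
proof -
  let ?V = "J // ratio_rel J \<nu> N"
  let ?D = "\<lambda>K. ceval (den p K \<nu> N) w"
  have fin: "finite ?V" by (rule finite_classes[OF p rep])
  have den: "ceval (den p J \<nu> N) w = prod ?D ?V"
    by (simp only: den_eq_prod_classes[OF p rep] ceval_prod)
  have P: "prod ?D ?V \<noteq> 0" using assms den by simp
  have "B = Q * (\<Prod>K\<in>?V. den p K \<nu> N) + (\<Sum>K\<in>?V. A K * (\<Prod>K'\<in>?V - {K}. den p K' \<nu> N))"
    using QA unfolding class_partial_fractions_def[OF p rep] by (rule conjunct1)
  then have "ceval B w = ceval Q w * prod ?D ?V + (\<Sum>K\<in>?V. ceval (A K) w * prod ?D (?V - {K}))"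
    by (simp only: ceval_add ceval_mult ceval_prod ceval_sum)
  then have "ceval B w / prod ?D ?V = ceval Q w + (\<Sum>K\<in>?V. ceval (A K) w * prod ?D (?V - {K}) / prod ?D ?V)"
    using P by (simp add: add_divide_distrib sum_divide_distrib)
  also have "(\<Sum>K\<in>?V. ceval (A K) w * prod ?D (?V - {K}) / prod ?D ?V) = (\<Sum>K\<in>?V. ceval (A K) w / ?D K)"
  proof (rule sum.cong[OF refl])
    fix K assume "K \<in> ?V"
    then have "prod ?D ?V = ?D K * prod ?D (?V - {K})" using fin by (intro prod.remove)
    moreover from this P have "prod ?D (?V - {K}) \<noteq> 0" by auto
    ultimately show "ceval (A K) w * prod ?D (?V - {K}) / prod ?D ?V = ceval (A K) w / ?D K" by simp
  qed
  finally show ?thesis unfolding den .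
qed

lemma norm_root_den_class:
  assumes "K \<in> J // ratio_rel J \<nu> N" "ceval (den p K \<nu> N) z = 0"
  shows "norm z = real p powr (real n - real_of_rat (class_exp n \<nu> N K))"
proof -
  have R: "ratio_class K \<nu> N" by (rule class_ratio_class[OF p rep assms(1)])
  have "finite K" using R by (auto simp: ratio_class_def)
  then obtain j where j: "j \<in> K" "ceval (den_factor p (\<nu> j) (N j)) z = 0"
    using assms(2) unfolding den_def ceval_prod by (auto simp: prod_zero_iff)
  have "N j > 0" using R j by (auto simp: ratio_class_def)
  then have "norm z = real p powr (real (\<nu> j) / real (N j))"
    using norm_root_den_factor[OF prime_gt_0_nat[OF p] _ j(2)] by blast
  moreover have "real n - real_of_rat (class_exp n \<nu> N K) = real (\<nu> j) / real (N j)"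
    unfolding class_exp_eq[OF R j(1)] by (simp add: of_rat_diff of_rat_divide)
  ultimately show ?thesis by simp
qed

text \<open>The denominators of the other classes have their zeros on circles of other radii, and Q
  is a polynomial. So on the circle of K all singular behaviour of P sits in the fraction of
  K.\<close>

lemma other_classes_limit:
  assumes K: "K \<in> J // ratio_rel J \<nu> N" and z: "norm z = real p powr (real n - real_of_rat (class_exp n \<nu> N K))"
  shows "\<exists>c. ((\<lambda>w. ceval B w / ceval (den p J \<nu> N) w - ceval (A K) w / ceval (den p K \<nu> N) w) \<longlongrightarrow> c) (at z)"
proof -
  let ?V = "J // ratio_rel J \<nu> N"
  have fin: "finite ?V" by (rule finite_classes[OF p rep])
  let ?E = "\<lambda>w. ceval Q w + (\<Sum>L\<in>?V - {K}. ceval (A L) w / ceval (den p L \<nu> N) w)"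
  have "ceval (den p L \<nu> N) z \<noteq> 0" if "L \<in> ?V - {K}" for L
  proof
    assume "ceval (den p L \<nu> N) z = 0"
    then have "real p powr (real n - real_of_rat (class_exp n \<nu> N L)) = real p powr (real n - real_of_rat (class_exp n \<nu> N K))"
      using norm_root_den_class[of L z] that z by simp
    then have "class_exp n \<nu> N L = class_exp n \<nu> N K"
      using prime_gt_1_nat[OF p] by (subst (asm) powr_inj) (auto simp: of_rat_eq_iff)
    then have "L = K" using class_exp_inj[OF p rep QA] that K by blast
    with that show False by simp
  qed
  then have "(?E \<longlongrightarrow> ?E z) (at z)"
    by (intro tendsto_add tendsto_sum tendsto_divide ceval_tendsto)
  moreover have "\<forall>\<^sub>F w in at z. ceval B w / ceval (den p J \<nu> N) w - ceval (A K) w / ceval (den p K \<nu> N) w = ?E w"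
  proof -
    have "map_poly of_rat (den p J \<nu> N) \<noteq> (0 :: complex poly)"
      using igusa_rep_den_nonzero by (simp add: map_poly_of_rat_eq_0_iff)
    from eventually_poly_nonzero[OF this] show ?thesis
    proof eventually_elim
      case (elim w)
      show ?case unfolding ceval_partial_fractions[OF elim]
        by (subst sum.remove[OF fin K]) simp
    qed
  qed
  ultimately have "((\<lambda>w. ceval B w / ceval (den p J \<nu> N) w - ceval (A K) w / ceval (den p K \<nu> N) w) \<longlongrightarrow> ?E z) (at z)"
    by (simp only: tendsto_cong)
  then show ?thesis by blast
qed

end

text \<open>The two representations are unrelated: K and K' may consist of different factors, so
  only the quotients can be compared. X / Y in the proof is their difference over the common
  denominator.\<close>

theorem class_series_determined:
  assumes p: "prime p"
    and rep: "in_vars n f" "igusa_rep p n f J \<nu> N B" "class_partial_fractions p J \<nu> N B Q A" "K \<in> J // ratio_rel J \<nu> N"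
    and rep': "in_vars n f'" "igusa_rep p n f' J' \<nu>' N' B'" "class_partial_fractions p J' \<nu>' N' B' Q' A'"
      "K' \<in> J' // ratio_rel J' \<nu>' N'"
    and exps: "class_exp n \<nu>' N' K' = class_exp n \<nu> N K"
    and pp: "principal_parts p n f' (real_of_rat (class_exp n \<nu> N K) - real n) =
      principal_parts p n f (real_of_rat (class_exp n \<nu> N K) - real n)"
  shows "class_series p \<nu>' N' A' K' = class_series p \<nu> N A K"
proof -
  have p1: "p > 1" using p by (rule prime_gt_1_nat)
  define D where "D = den p K \<nu> N"
  define D' where "D' = den p K' \<nu>' N'"
  define X where "X = A K * D' - A' K' * D"
  define Y where "Y = D * D'"
  have D0: "coeff D 0 = 1" "coeff D' 0 = 1"
    unfolding D_def D'_def using coeff_0_den_class[OF p rep(2,4)] coeff_0_den_class[OF p rep'(2,4)] by auto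
  then have DD_nz: "D \<noteq> 0" "D' \<noteq> 0" by auto
  then have Y_nz: "Y \<noteq> 0" by (simp add: Y_def)
  have degs: "degree (A K) < degree D" "degree (A' K') < degree D'"
    unfolding D_def D'_def using rep(3,4) rep'(3,4)
    by (auto simp: class_partial_fractions_def[OF p rep(2)] class_partial_fractions_def[OF p rep'(2)])
  have degX: "degree X < degree Y"
  proof -
    have "degree (A K * D') < degree Y" "degree (A' K' * D) < degree Y"
      using degree_mult_le[of "A K" D'] degree_mult_le[of "A' K'" D] degs DD_nz
      by (auto simp: Y_def degree_mult_eq)
    then show ?thesis unfolding X_def by (rule degree_diff_less)
  qed
  define \<sigma> where "\<sigma> = real_of_rat (class_exp n \<nu> N K) - real n"
  let ?cX = "map_poly of_rat X :: complex poly"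
  let ?cY = "map_poly of_rat Y :: complex poly"
  have "?cY dvd ?cX"
  proof (rule poly_dvd_of_quotient_limits)
    show "?cY \<noteq> 0" using Y_nz by (simp add: map_poly_of_rat_eq_0_iff)
  next
    fix z assume z0: "ceval Y z = 0"
    have normz: "norm z = real p powr (- \<sigma>)"
      using z0 norm_root_den_class[OF p rep(2,3,4), of z] norm_root_den_class[OF p rep'(2,3,4), of z] exps
      by (auto simp: Y_def ceval_mult D_def D'_def \<sigma>_def)
    then have "z \<noteq> 0" using p1 by auto
    \<comment> \<open>Recovering P from the zeta function divides by 1 - t. The point 1 is avoided
      because \<sigma> < 0 puts z outside the closed unit disc.\<close>
    have "z \<noteq> 1"
    proof -
      obtain j where j: "j \<in> K" "\<nu> j > 0" "N j > 0"
        using class_ratio_class[OF p rep(2,4)] by (auto simp: ratio_class_def)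
      have "- \<sigma> = real (\<nu> j) / real (N j)"
        unfolding \<sigma>_def class_exp_eq[OF class_ratio_class[OF p rep(2,4)] j(1)] by (simp add: of_rat_diff of_rat_divide)
      then have "- \<sigma> > 0" using j by simp
      then have "norm z > 1" unfolding normz using p1 by (intro gr_one_powr) auto
      then show ?thesis by auto
    qed
    obtain s where s: "\<And>w. w \<noteq> 0 \<Longrightarrow> exp_var p (s w) = w" "filterlim s (at (s z)) (at z)"
      "Re (s z) = - ln (norm z) / ln (real p)"
      using exp_var_local_inverse[OF p1 \<open>z \<noteq> 0\<close>] by blast
    have "Re (s z) = \<sigma>" unfolding s(3) normz using p1 by (simp add: ln_powr)
    then have "principal_parts p n f' (Re (s z)) = principal_parts p n f (Re (s z))" using pp by (simp add: \<sigma>_def)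
    then obtain c where c: "((\<lambda>w. igusa_zeta p n f w - igusa_zeta p n f' w) \<longlongrightarrow> c) (at (s z))"
      using eq_principal_parts_imp_limit[OF meromorphic_igusa_zeta[OF p rep(1,2)] meromorphic_igusa_zeta[OF p rep'(1,2)]] by blast
    let ?R = "igusa_rational p J \<nu> N B"
    let ?R' = "igusa_rational p J' \<nu>' N' B'"
    let ?\<beta> = "\<lambda>w. ceval B w / ceval (den p J \<nu> N) w"
    let ?\<beta>' = "\<lambda>w. ceval B' w / ceval (den p J' \<nu>' N') w"
    have ev0: "\<forall>\<^sub>F w in at z. w \<noteq> 0" "\<forall>\<^sub>F w in at z. w \<noteq> 1"
      using tendsto_imp_eventually_ne[OF tendsto_ident_at \<open>z \<noteq> 0\<close>] tendsto_imp_eventually_ne[OF tendsto_ident_at \<open>z \<noteq> 1\<close>]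
      by auto
    have "((\<lambda>w. igusa_zeta p n f (s w) - igusa_zeta p n f' (s w)) \<longlongrightarrow> c) (at z)"
      by (rule filterlim_compose[OF c s(2)])
    moreover have "\<forall>\<^sub>F w in at z. igusa_zeta p n f (s w) - igusa_zeta p n f' (s w) = ?R w - ?R' w"
      using eventually_compose_filterlim[OF eventually_igusa_zeta_eq[OF p rep(1,2)] s(2)]
        eventually_compose_filterlim[OF eventually_igusa_zeta_eq[OF p rep'(1,2)] s(2)] ev0(1)
      by eventually_elim (simp add: s(1))
    ultimately have "((\<lambda>w. ?R w - ?R' w) \<longlongrightarrow> c) (at z)" by (simp only: tendsto_cong)
    \<comment> \<open>Since t*Z = 1 - (1 - t)*P, a difference of zeta functions is -(1 - t)/t times
      the difference of the Poincare series; multiplying by -t/(1 - t) undoes this.\<close>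
    then have "((\<lambda>w. - (w / (1 - w)) * (?R w - ?R' w)) \<longlongrightarrow> - (z / (1 - z)) * c) (at z)"
      using \<open>z \<noteq> 1\<close> by (intro tendsto_intros) auto
    moreover have "\<forall>\<^sub>F w in at z. - (w / (1 - w)) * (?R w - ?R' w) = ?\<beta> w - ?\<beta>' w"
      using ev0
    proof eventually_elim
      case (elim w)
      have "- (w / (1 - w)) * ((1 - (1 - w) * x) / w - (1 - (1 - w) * y) / w) = x - y" for x y
      proof -
        have "(1 - (1 - w) * x) / w - (1 - (1 - w) * y) / w = - ((1 - w) * (x - y) / w)"
          unfolding minus_divide_left diff_divide_distrib[symmetric] by (simp add: algebra_simps)
        then show ?thesis using elim by simp
      qed
      then show ?case unfolding igusa_rational_def .
    qed
    ultimately have \<beta>: "((\<lambda>w. ?\<beta> w - ?\<beta>' w) \<longlongrightarrow> - (z / (1 - z)) * c) (at z)" by (simp only: tendsto_cong)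
    obtain e where e: "((\<lambda>w. ?\<beta> w - ceval (A K) w / ceval D w) \<longlongrightarrow> e) (at z)"
      using other_classes_limit[OF p rep(2,3,4), of z] normz by (auto simp: D_def \<sigma>_def)
    obtain e' where e': "((\<lambda>w. ?\<beta>' w - ceval (A' K') w / ceval D' w) \<longlongrightarrow> e') (at z)"
      using other_classes_limit[OF p rep'(2,3,4), of z] normz exps by (auto simp: D'_def \<sigma>_def)
    \<comment> \<open>The remainders left by the other classes of either representation have limits
      too; combining them with the limit of the difference isolates the difference of the two class
      fractions.\<close>
    have "((\<lambda>w. (?\<beta> w - ?\<beta>' w) - (?\<beta> w - ceval (A K) w / ceval D w) + (?\<beta>' w - ceval (A' K') w / ceval D' w))
        \<longlongrightarrow> - (z / (1 - z)) * c - e + e') (at z)"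
      by (intro tendsto_add tendsto_diff \<beta> e e')
    moreover have "\<forall>\<^sub>F w in at z. (?\<beta> w - ?\<beta>' w) - (?\<beta> w - ceval (A K) w / ceval D w) + (?\<beta>' w - ceval (A' K') w / ceval D' w)
        = ceval X w / ceval Y w"
    proof -
      have "?cY \<noteq> 0" using Y_nz by (simp add: map_poly_of_rat_eq_0_iff)
      from eventually_poly_nonzero[OF this] show ?thesis
      proof eventually_elim
        case (elim w)
        then have "ceval D w \<noteq> 0" "ceval D' w \<noteq> 0" by (auto simp: Y_def ceval_mult)
        then have "ceval (A K) w / ceval D w - ceval (A' K') w / ceval D' w = ceval X w / ceval Y w"
          by (simp add: X_def Y_def map_poly_of_rat_diff ceval_mult diff_frac_eq mult.commute)
        then show ?case by simp
      qed
    qed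
    ultimately have "((\<lambda>w. ceval X w / ceval Y w) \<longlongrightarrow> - (z / (1 - z)) * c - e + e') (at z)" by (simp only: tendsto_cong)
    then show "\<exists>c. ((\<lambda>w. ceval X w / ceval Y w) \<longlongrightarrow> c) (at z)" by blast
  qed
  then have "?cX = 0"
    using degX by (metis degree_map_poly_of_rat dvd_imp_degree_le leD)
  then have "A K * D' = A' K' * D" by (simp add: map_poly_of_rat_eq_0_iff X_def)
  then have "fps_of_poly (A K) * fps_of_poly D' = fps_of_poly (A' K') * fps_of_poly D"
    by (metis fps_of_poly_mult)
  moreover define h where "h = fps_of_poly (A' K') / fps_of_poly D'"
  moreover have "h * fps_of_poly D' = fps_of_poly (A' K')"
    unfolding h_def using D0 by (intro fps_divide_times_unit) simp
  ultimately have "(h * fps_of_poly D) * fps_of_poly D' = fps_of_poly (A K) * fps_of_poly D'"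
    by (metis mult.assoc mult.commute)
  moreover have "fps_of_poly D' \<noteq> 0" using DD_nz by simp
  ultimately have "h * fps_of_poly D = fps_of_poly (A K)" by (metis mult_right_cancel)
  then have "fps_of_poly (A K) / fps_of_poly D = h"
    using D0 by (intro fps_divide_eqI) auto
  then show ?thesis unfolding class_series_def[OF p rep(2)] class_series_def[OF p rep'(2)] D_def D'_def h_def by simp
qed

text \<open>Uniqueness is up to renumbering. That principal parts determine \<open>g k\<close> is
  expressed by comparison with every polynomial f' in n variables, with any representation and any
  decomposition, that has the same principal parts on the line. The degree claim is an equivalence
  because equality with m - 1 can fail for a class with several elements; for a one-element class
  the condition on B follows from \<open>igusa_rep\<close>.\<close>

theorem mainTheorem1:
  fixes p n :: nat and f :: intpoly
    and J :: "nat set" and \<nu> N :: "nat \<Rightarrow> nat" and B :: "rat poly"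
  assumes "prime p"
    and "in_vars n f"
    and "igusa_rep p n f J \<nu> N B"
  shows "\<exists>r l g.
    sol_decomposition p n f (rat_fun_degree B (den p J \<nu> N)) r l g \<and>
    (\<forall>r' l' g'. sol_decomposition p n f (rat_fun_degree B (den p J \<nu> N)) r' l' g' \<longrightarrow>
       r' = r \<and>
       (\<exists>\<pi>. bij_betw \<pi> {1..r} {1..r} \<and> (\<forall>k\<in>{1..r}. l' k = l (\<pi> k) \<and> g' k = g (\<pi> k)))) \<and>
    (\<lambda>k. real_of_rat (l k - of_nat n)) ` {1..r} = {Re s | s. is_pole (igusa_zeta p n f) s} \<and>
    (\<exists>C. bij_betw C {1..r} (J // ratio_rel J \<nu> N) \<and>
      (\<forall>k\<in>{1..r}.
        let a = Lcm (\<nu> ` C k); b = Lcm (N ` C k); m = card (C k) in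
        l k - of_nat n = - (of_nat a / of_nat b) \<and>
        (\<exists>q. poly_on_residues b (g k) q \<and>
          Max ((\<lambda>c. degree (q c)) ` {..<b}) \<le> m - 1 \<and>
          (Max ((\<lambda>c. degree (q c)) ` {..<b}) = m - 1 \<longleftrightarrow>
             \<not> den_factor p (Gcd (\<nu> ` C k)) (Gcd (N ` C k)) dvd B)) \<and>
        (\<forall>f' J' \<nu>' N' B' r' l' g' k'.
          in_vars n f' \<and> igusa_rep p n f' J' \<nu>' N' B' \<and>
          sol_decomposition p n f' (rat_fun_degree B' (den p J' \<nu>' N')) r' l' g' \<and>
          k' \<in> {1..r'} \<and> l' k' = l k \<and>
          principal_parts p n f' (- (real a / real b)) = principal_parts p n f (- (real a / real b))
          \<longrightarrow> g' k' = g k)))"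
proof -
  have p1: "p > 1" using assms(1) by (rule prime_gt_1_nat)
  let ?V = "J // ratio_rel J \<nu> N"
  obtain Q A where QA: "class_partial_fractions p J \<nu> N B Q A"
    using ex_class_partial_fractions[OF assms(1,3)] by blast
  define r where "r = card ?V"
  obtain C where C: "bij_betw C {1..r} ?V"
    using ex_bij_betw_nat_finite_1[OF finite_classes[OF assms(1,3)]] unfolding r_def by blast
  have C_in: "C k \<in> ?V" if "k \<in> {1..r}" for k using C that by (rule bij_betwE[rule_format])
  define l where "l = (\<lambda>k. class_exp n \<nu> N (C k))"
  define g where "g = (\<lambda>k. class_fun p n (l k) (class_series p \<nu> N A (C k)))"
  have S: "sol_decomposition p n f (rat_fun_degree B (den p J \<nu> N)) r l g"
    unfolding l_def g_def by (rule canonical_sol_decomposition[OF assms(1,3) QA C])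
  have poles: "(\<lambda>k. real_of_rat (l k - of_nat n)) ` {1..r} = {Re s | s. is_pole (igusa_zeta p n f) s}"
  proof -
    have l: "real_of_rat (class_exp n \<nu> N K - of_nat n) = - (real (\<nu> j) / real (N j))" if "K \<in> ?V" "j \<in> K" for K j
      unfolding class_exp_eq[OF class_ratio_class[OF assms(1,3) that(1)] that(2)]
      by (simp add: of_rat_minus of_rat_divide)
    have "(\<lambda>k. real_of_rat (l k - of_nat n)) ` {1..r} = (\<lambda>K. real_of_rat (class_exp n \<nu> N K - of_nat n)) ` ?V"
      unfolding l_def bij_betw_imp_surj_on[OF C, symmetric] by (simp only: image_image)
    also have "\<dots> = (\<lambda>j. - (real (\<nu> j) / real (N j))) ` J"
    proof (intro equalityI subsetI)
      fix x assume "x \<in> (\<lambda>K. real_of_rat (class_exp n \<nu> N K - of_nat n)) ` ?V"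
      then obtain K where K: "K \<in> ?V" "x = real_of_rat (class_exp n \<nu> N K - of_nat n)" by blast
      obtain j where j: "j \<in> K" using class_ratio_class[OF assms(1,3) K(1)] by (auto simp: ratio_class_def)
      have "j \<in> J" using class_subset[OF assms(1,3) K(1)] j by blast
      then show "x \<in> (\<lambda>j. - (real (\<nu> j) / real (N j))) ` J" using l[OF K(1) j] K(2) by simp
    next
      fix x assume "x \<in> (\<lambda>j. - (real (\<nu> j) / real (N j))) ` J"
      then obtain j where j: "j \<in> J" "x = - (real (\<nu> j) / real (N j))" by blast
      then obtain K where K: "K \<in> ?V" "j \<in> K" using Union_quotient[OF equiv_ratio_rel] by blast
      then show "x \<in> (\<lambda>K. real_of_rat (class_exp n \<nu> N K - of_nat n)) ` ?V"
        using l[OF K] j(2) by (intro image_eqI[of _ _ K]) auto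
    qed
    finally show ?thesis unfolding Re_poles_igusa_zeta[OF assms] .
  qed
  have determined: "g' k' = g k"
    if k: "k \<in> {1..r}" and f': "in_vars n f'" "igusa_rep p n f' J' \<nu>' N' B'"
      and S': "sol_decomposition p n f' (rat_fun_degree B' (den p J' \<nu>' N')) r' l' g'"
      and k': "k' \<in> {1..r'}" "l' k' = l k"
      and pp: "principal_parts p n f' (- (real (Lcm (\<nu> ` C k)) / real (Lcm (N ` C k)))) =
        principal_parts p n f (- (real (Lcm (\<nu> ` C k)) / real (Lcm (N ` C k))))"
    for k f' J' \<nu>' N' B' r' l' g' k'
  proof -
    let ?V' = "J' // ratio_rel J' \<nu>' N'"
    obtain Q' A' where QA': "class_partial_fractions p J' \<nu>' N' B' Q' A'"
      using ex_class_partial_fractions[OF assms(1) f'(2)] by blast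
    obtain C' where C': "bij_betw C' {1..card ?V'} ?V'"
      using ex_bij_betw_nat_finite_1[OF finite_classes[OF assms(1) f'(2)]] by blast
    \<comment> \<open>An arbitrary decomposition of f' carries no information about class series.
      Its component is matched with one of the canonical decomposition, whose functions are built
      from these series.\<close>
    from sol_decomposition_component[OF p1 S' canonical_sol_decomposition[OF assms(1) f'(2) QA' C'] k'(1)]
    obtain k2 where k2: "k2 \<in> {1..card ?V'}" "class_exp n \<nu>' N' (C' k2) = l' k'"
      "class_fun p n (class_exp n \<nu>' N' (C' k2)) (class_series p \<nu>' N' A' (C' k2)) = g' k'" by blast
    have C'_in: "C' k2 \<in> ?V'" using C' k2(1) by (rule bij_betwE[rule_format])
    have "real_of_rat (class_exp n \<nu> N (C k)) - real n = - (real (Lcm (\<nu> ` C k)) / real (Lcm (N ` C k)))"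
      by (simp add: class_exp_def of_rat_diff of_rat_divide)
    then have "class_series p \<nu>' N' A' (C' k2) = class_series p \<nu> N A (C k)"
      using pp k2(2) k'(2) l_def
      by (intro class_series_determined[OF assms(1) assms(2,3) QA C_in[OF k] f' QA' C'_in]) auto
    then show ?thesis using k2(2,3) k'(2) unfolding g_def by simp
  qed
  show ?thesis
    unfolding Let_def
  proof (intro exI[of _ r] exI[of _ l] exI[of _ g] exI[of _ C] conjI ballI allI impI)
    fix r' l' g' assume "sol_decomposition p n f (rat_fun_degree B (den p J \<nu> N)) r' l' g'"
    from sol_decomposition_unique[OF p1 S this]
    show "r' = r" "\<exists>\<pi>. bij_betw \<pi> {1..r} {1..r} \<and> (\<forall>k\<in>{1..r}. l' k = l (\<pi> k) \<and> g' k = g (\<pi> k))"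
      by blast+
  next
    fix k assume k: "k \<in> {1..r}"
    show "l k - of_nat n = - (of_nat (Lcm (\<nu> ` C k)) / of_nat (Lcm (N ` C k)))"
      by (simp add: l_def class_exp_def)
    show "\<exists>q. poly_on_residues (Lcm (N ` C k)) (g k) q \<and>
        Max ((\<lambda>c. degree (q c)) ` {..<Lcm (N ` C k)}) \<le> card (C k) - 1 \<and>
        (Max ((\<lambda>c. degree (q c)) ` {..<Lcm (N ` C k)}) = card (C k) - 1 \<longleftrightarrow>
           \<not> den_factor p (Gcd (\<nu> ` C k)) (Gcd (N ` C k)) dvd B)"
      unfolding g_def l_def by (rule class_fun_residues[OF assms(1,3) QA C_in[OF k]])
    fix f' J' \<nu>' N' B' r' l' g' k'
    assume *: "in_vars n f' \<and> igusa_rep p n f' J' \<nu>' N' B' \<and>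
      sol_decomposition p n f' (rat_fun_degree B' (den p J' \<nu>' N')) r' l' g' \<and>
      k' \<in> {1..r'} \<and> l' k' = l k \<and>
      principal_parts p n f' (- (real (Lcm (\<nu> ` C k)) / real (Lcm (N ` C k)))) =
        principal_parts p n f (- (real (Lcm (\<nu> ` C k)) / real (Lcm (N ` C k))))"
    then show "g' k' = g k" by (elim conjE) (rule determined[OF k])
  qed (rule S poles C)+
qed

end
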